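(* Let $\mathfrak m$ be a non-critical maximal ideal of $\Gamma$. The functor $F_{NC}:\mathcal{NCT}_{\mathfrak m}\to\mathcal D_{\mathfrak m}\text{-mod}$ is faithful and maps irreducible modules to irreducible modules. Moreover, the images under $F_{NC}$ of non-isomorphic modules are non-isomorphic.
   Context: Gelfand-Tsetlin modules. $\mathfrak{gl}_1\subset\dots\subset\mathfrak{gl}_n$ ($n\ge2$) is the chain of principal (upper left corner) submatrices over $\mathbb C$, with elementary matrices $E_{ij}$. $\Gamma\subset U(\mathfrak{gl}_n)$ is the Gelfand-Tsetlin subalgebra generated by the centers of $U(\mathfrak{gl}_k)$, $1\le k\le n$. For a maximal ideal $\mathfrak m$ of $\Gamma$, $V_{\mathfrak m}=\{v\in V:\mathfrak m^kv=0\text{ for some }k\ge 0\}$. $V$ is a Gelfand-Tsetlin module if $V=\bigoplus_{\mathfrak m}V_{\mathfrak m}$. Its Gelfand-Tsetlin support is $\{\mathfrak m:V_{\mathfrak m}\ne0\}$. $V$ is tame if $\Gamma$ acts diagonalizably on $V$. Drinfeld generators. Let $T_{ij}(u)=\delta_{ij}u+E_{ji}\in U(\mathfrak{gl}_n)[u]$. For an $m\times m$ matrix $X(u)$ put $\mathrm{qdet}\,X(u)=\sum_{\sigma\in S_m}(-1)^{l(\sigma)}X_{1\sigma(1)}(u)X_{2\sigma(2)}(u-1)\cdots X_{m\sigma(m)}(u-m+1)$. Let $a_m(u)$ ($1\le m\le n$) be the quantum determinant of $(T_{ij}(u))_{i,j=1}^m$, and $a_0(u)=1$. For $1\le m\le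 n-1$ let $b_m(u)$ be the quantum determinant of the submatrix of $(T_{ij}(u))$ with rows $1,\dots,m-1,m+1$ and columns $1,\dots,m$, and let $c_m(u)$ be that of the submatrix with rows $1,\dots,m$ and columns $1,\dots,m-1,m+1$. The coefficients of all $a_m(u)$ generate $\Gamma$. Together with those of $b_m(u),c_m(u)$ they generate $U(\mathfrak{gl}_n)$. Tableaux and ideals. For $L=(l_{ij})_{1\le j\le i\le n}\in T_n(\mathbb C)=\mathbb C^{n(n+1)/2}$ with $i$-th row $(l_{i1},\dots,l_{ii})$, $\mathfrak m_L$ is the maximal ideal of $\Gamma$ by which $a_k(u)$ has eigenvalue $\alpha_k(u,\mathfrak m_L)=\prod_{i=1}^k(u+l_{ki})$, $1\le k\le n$ (and $\alpha_0=1$). Every maximal ideal has this form, and $L$ is determined by it up to permutations within rows. $L$ and $\mathfrak m_L$ are critical if $L$ has two equal entries in some row. $L\pm\delta_{mi}$ is obtained from $L$ by adding $\pm1$ to $l_{mi}$. $L_{\mathbb Z}$ is the set of all tableaux obtained from $L$ by adding integers to the entries of rows $1,\dots,n-1$. The set $\mathcal{NC}_{\mathfrak m}$. For a non-critical $\mathfrak m=\mathfrak m_L$, $\mathcal{NC}_{\mathbb Z}(L)$ is the set of $L'\in L_{\mathbb Z}$ lying in the same component as $L$ of the complement in $L_{\mathbb Z}$ of the hyperplanes $z_{mi_1}=z_{mi_2}$ ($m\le n-1$). That is, for all $m\le n-1$ and $i_1\neq i_2$ with $l_{mi_1}-l_{mi_2}\in\mathbb Z$, the integer $l'_{mi_1}-l'_{mi_2}$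 is nonzero and has the same sign as $l_{mi_1}-l_{mi_2}$. Put $\mathcal{NC}_{\mathfrak m}=\{\mathfrak m_{L'}:L'\in\mathcal{NC}_{\mathbb Z}(L)\}$ (independent of the choice of $L$; $L'\mapsto \mathfrak m_{L'}$ is injective on $\mathcal{NC}_{\mathbb Z}(L)$). The Drinfeld quiver $\mathcal D_{\mathfrak m}$. Its vertices are the elements of $\mathcal{NC}_{\mathfrak m}$. At the vertex $\mathfrak m_{L'}$, $L'=(l'_{ij})\in \mathcal{NC}_{\mathbb Z}(L)$, start the following edges, for $1\le m\le n-1$, $1\le i\le m$: loops $a_k(-l'_{mi})$ ($1\le k\le n$); an edge $b_m(-l'_{mi})$ to $\mathfrak m_{L'+\delta_{mi}}$; an edge $c_m(-l'_{mi})$ to $\mathfrak m_{L'-\delta_{mi}}$ (an edge whose end point is not in $\mathcal{NC}_{\mathfrak m}$ is interpreted as $0$). The relations, at every vertex $\mathfrak m_{L'}$ with idempotent $e_{\mathfrak m_{L'}}$, are: - $a_k(-l'_{mi})e_{\mathfrak m_{L'}}=\alpha_k(-l'_{mi},\mathfrak m_{L'})e_{\mathfrak m_{L'}}$; - $c_m(-l'_{mi})b_l(-l'_{lj})=b_l(-l'_{lj})c_m(-l'_{mi})$ if $l\ne m$, or if $l=m$ and $i\ne j$; - $s_m(-l'_{mi})s_l(-l'_{lj})=s_l(-l'_{lj})s_m(-l'_{mi})$ for $s\in\{b,c\}$ and $|l-m|\ne1$; - $b_m(-l'_{mi}+1)c_m(-l'_{mi})=-\alpha_{m+1}(-l'_{mi}+1,\mathfrak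 m_{L'})\,\alpha_{m-1}(-l'_{mi},\mathfrak m_{L'})\,e_{\mathfrak m_{L'}}$; - $c_m(-l'_{mi}-1)b_m(-l'_{mi})=-\alpha_{m+1}(-l'_{mi},\mathfrak m_{L'})\,\alpha_{m-1}(-l'_{mi}-1,\mathfrak m_{L'})\,e_{\mathfrak m_{L'}}$; - the relations obtained, with $x,y$ evaluated at the numbers $-l'_{mi}$, from $(x-y)[a_m(x),c_m(y)]=c_m(x)a_m(y)-c_m(y)a_m(x)$ and $(x-y)[a_m(x),b_m(y)]=-b_m(x)a_m(y)+b_m(y)a_m(x)$. Products denote composition of paths, read from right to left starting at $\mathfrak m_{L'}$. $\mathcal D_{\mathfrak m}$-mod is the category of representations of this quiver with relations; $V_\omega$ denotes the space at the vertex $\omega$. The functor. $\mathcal{NCT}_{\mathfrak m}$ is the full subcategory of the category of Gelfand-Tsetlin $\mathfrak{gl}_n$-modules consisting of the tame modules whose Gelfand-Tsetlin support is contained in $\mathcal{NC}_{\mathfrak m}$. For $V\in\mathcal{NCT}_{\mathfrak m}$ the operators satisfy $b_m(-l'_{mi})V_{\mathfrak m_{L'}}\subset V_{\mathfrak m_{L'+\delta_{mi}}}$ and $c_m(-l'_{mi})V_{\mathfrak m_{L'}}\subset V_{\mathfrak m_{L'-\delta_{mi}}}$. $F_{NC}(V)$ is the representation $(V_\omega)_{\omega\in\mathcal{NC}_{\mathfrak m}}$ in which each edge acts by the corresponding element of $U(\mathfrak{gl}_n)$. On morphisms $F_{NC}$ is restriction to the spaces $V_\omega$. *)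

theory Defs
  imports
    Complex_Main
    "HOL-Library.Poly_Mapping"
    "HOL-Library.FuncSet"
    "HOL-Combinatorics.Permutations"
    "HOL-Algebra.QuotRing"
    "HOL-Algebra.Generated_Rings"
    "HOL-Algebra.Ideal_Product"
begin

section \<open>The universal enveloping algebra of \<open>gl\<^sub>n\<close>\<close>

text \<open>
  The free monoid is written additively, so that \<open>'a fword \<Rightarrow>\<^sub>0 complex\<close>, with the convolution
  product of \<^theory>\<open>HOL-Library.Poly_Mapping\<close>, is the free associative algebra on \<open>'a\<close>.
\<close>

datatype 'a fword = FWord (letters: "'a list")

instantiation fword :: (type) monoid_add
begin

definition zero_fword :: "'a fword" where
  "zero_fword = FWord []"

definition plus_fword :: "'a fword \<Rightarrow> 'a fword \<Rightarrow> 'a fword" where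
  "plus_fword v w = FWord (letters v @ letters w)"

instance
  by standard (auto simp: zero_fword_def plus_fword_def)

end

type_synonym free_gl = "(nat \<times> nat) fword \<Rightarrow>\<^sub>0 complex"

definition cst :: "complex \<Rightarrow> free_gl" where
  "cst c = Poly_Mapping.single 0 c"

definition gen :: "nat \<Rightarrow> nat \<Rightarrow> free_gl" where
  "gen i j = Poly_Mapping.single (FWord [(i, j)]) 1"

definition free_alg :: "nat \<Rightarrow> free_gl ring" where
  "free_alg n =
     \<lparr>carrier = {f. \<forall>w\<in>Poly_Mapping.keys f. set (letters w) \<subseteq> {1..n} \<times> {1..n}},
      mult = (*), one = 1, zero = 0, add = (+)\<rparr>"

definition gl_ideal :: "nat \<Rightarrow> free_gl set" where
  "gl_ideal n = genideal (free_alg n)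
     {gen i j * gen k l - gen k l * gen i j
        - ((if j = k then gen i l else 0) - (if i = l then gen k j else 0)) | i j k l.
      i \<in> {1..n} \<and> j \<in> {1..n} \<and> k \<in> {1..n} \<and> l \<in> {1..n}}"

definition U_gl :: "nat \<Rightarrow> free_gl set ring" where
  "U_gl n = free_alg n Quot gl_ideal n"

definition cls :: "nat \<Rightarrow> free_gl \<Rightarrow> free_gl set" where
  "cls n f = a_r_coset (free_alg n) (gl_ideal n) f"

definition gen_subalg :: "nat \<Rightarrow> free_gl set set \<Rightarrow> free_gl set set" where
  "gen_subalg n S = generate_ring (U_gl n) (range (\<lambda>c. cls n (cst c)) \<union> S)"

text \<open>\<open>U(gl\<^sub>k)\<close>, for \<open>k \<le> n\<close>, as a subalgebra of \<open>U(gl\<^sub>n)\<close>.\<close>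

definition U_sub :: "nat \<Rightarrow> nat \<Rightarrow> free_gl set set" where
  "U_sub n k = gen_subalg n {cls n (gen i j) | i j. i \<in> {1..k} \<and> j \<in> {1..k}}"

definition Z_sub :: "nat \<Rightarrow> nat \<Rightarrow> free_gl set set" where
  "Z_sub n k = {z \<in> U_sub n k. \<forall>x\<in>U_sub n k. z \<otimes>\<^bsub>U_gl n\<^esub> x = x \<otimes>\<^bsub>U_gl n\<^esub> z}"

definition Gamma :: "nat \<Rightarrow> free_gl set ring" where
  "Gamma n = (U_gl n)\<lparr>carrier := gen_subalg n (\<Union>k\<in>{1..n}. Z_sub n k)\<rparr>"


section \<open>Quantum determinants and Drinfeld generators\<close>

text \<open>
  A polynomial over \<open>U(gl\<^sub>n)\<close> is represented by its values at complex numbers; these are given by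
  representatives in the free algebra.
\<close>

definition qdet :: "nat \<Rightarrow> (nat \<Rightarrow> nat \<Rightarrow> complex \<Rightarrow> 'a::ring_1) \<Rightarrow> complex \<Rightarrow> 'a" where
  "qdet m X u =
     (\<Sum>\<sigma> | \<sigma> permutes {1..m}.
        of_int (sign \<sigma>) * prod_list (map (\<lambda>r. X r (\<sigma> r) (u - of_nat (r - 1))) [1..<m + 1]))"

definition T_gl :: "nat \<Rightarrow> nat \<Rightarrow> complex \<Rightarrow> free_gl" where
  "T_gl i j u = (if i = j then cst u else 0) + gen j i"

definition a_gen :: "nat \<Rightarrow> complex \<Rightarrow> free_gl" where
  "a_gen m = qdet m T_gl"

definition b_gen :: "nat \<Rightarrow> complex \<Rightarrow> free_gl" where
  "b_gen m = qdet m (\<lambda>r c. T_gl (if r = m then m + 1 else r) c)"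

definition c_gen :: "nat \<Rightarrow> complex \<Rightarrow> free_gl" where
  "c_gen m = qdet m (\<lambda>r c. T_gl r (if c = m then m + 1 else c))"


section \<open>Tableaux and maximal ideals of \<open>\<Gamma>\<close>\<close>

text \<open>The entry \<open>l\<^sub>i\<^sub>j\<close> is \<open>L i j\<close>; entries outside the triangle are normalised to \<open>0\<close>.\<close>

type_synonym tableau = "nat \<Rightarrow> nat \<Rightarrow> complex"

definition tableaux :: "nat \<Rightarrow> tableau set" where
  "tableaux n = {L. \<forall>i j. \<not> (1 \<le> j \<and> j \<le> i \<and> i \<le> n) \<longrightarrow> L i j = 0}"

definition critical :: "nat \<Rightarrow> tableau \<Rightarrow> bool" where
  "critical n L \<longleftrightarrow> (\<exists>m\<in>{1..n}. \<exists>i\<in>{1..m}. \<exists>j\<in>{1..m}. i \<noteq> j \<and> L m i = L m j)"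

definition shift :: "tableau \<Rightarrow> nat \<Rightarrow> nat \<Rightarrow> complex \<Rightarrow> tableau" where
  "shift L m i c = L(m := (L m)(i := L m i + c))"

definition alpha :: "nat \<Rightarrow> complex \<Rightarrow> tableau \<Rightarrow> complex" where
  "alpha k u L = (\<Prod>i=1..k. u + L k i)"

text \<open>
  The ideal \<open>m\<^sub>L\<close>: the coefficients of the \<open>a\<^sub>k(u)\<close> generate the algebra \<open>\<Gamma>\<close>, so the maximal ideal
  modulo which \<open>a\<^sub>k(u)\<close> equals \<open>\<alpha>\<^sub>k(u)\<close> is generated by the coefficients of the
  polynomials \<open>a\<^sub>k(u) - \<alpha>\<^sub>k(u)\<close>; equivalently, by their values.
\<close>

definition mL :: "nat \<Rightarrow> tableau \<Rightarrow> free_gl set set" where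
  "mL n L = genideal (Gamma n) {cls n (a_gen k u - cst (alpha k u L)) | k u. k \<in> {1..n}}"

definition L_int :: "nat \<Rightarrow> tableau \<Rightarrow> tableau set" where
  "L_int n L = {L' \<in> tableaux n.
     (\<forall>m\<in>{1..n-1}. \<forall>i\<in>{1..m}. L' m i - L m i \<in> \<int>) \<and> (\<forall>i\<in>{1..n}. L' n i = L n i)}"

definition NC_int :: "nat \<Rightarrow> tableau \<Rightarrow> tableau set" where
  "NC_int n L = {L' \<in> L_int n L.
     \<forall>m\<in>{1..n-1}. \<forall>i\<in>{1..m}. \<forall>j\<in>{1..m}. \<forall>p q :: int.
       i \<noteq> j \<and> L m i - L m j = of_int p \<and> L' m i - L' m j = of_int q
         \<longrightarrow> q \<noteq> 0 \<and> sgn q = sgn p}"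

definition NC :: "nat \<Rightarrow> tableau \<Rightarrow> free_gl set set set" where
  "NC n L = mL n ` NC_int n L"


section \<open>Gelfand-Tsetlin modules\<close>

record 'v gl_mod =
  scl :: "complex \<Rightarrow> 'v \<Rightarrow> 'v"
  opr :: "nat \<Rightarrow> nat \<Rightarrow> 'v \<Rightarrow> 'v"

text \<open>Only the operators \<open>opr V i j\<close> with \<open>1 \<le> i, j \<le> n\<close> belong to the module structure.\<close>

definition gl_module :: "nat \<Rightarrow> 'v::ab_group_add gl_mod \<Rightarrow> bool" where
  "gl_module n V \<longleftrightarrow>
     vector_space (scl V) \<and>
     (\<forall>i\<in>{1..n}. \<forall>j\<in>{1..n}. Vector_Spaces.linear (scl V) (scl V) (opr V i j)) \<and>
     (\<forall>i\<in>{1..n}. \<forall>j\<in>{1..n}. \<forall>k\<in>{1..n}. \<forall>l\<in>{1..n}. \<forall>v.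
        opr V i j (opr V k l v) - opr V k l (opr V i j v)
          = (if j = k then opr V i l v else 0) - (if i = l then opr V k j v else 0))"

definition free_act :: "'v::ab_group_add gl_mod \<Rightarrow> free_gl \<Rightarrow> 'v \<Rightarrow> 'v" where
  "free_act V f v =
     (\<Sum>w\<in>Poly_Mapping.keys f.
        scl V (Poly_Mapping.lookup f w) (foldr (\<lambda>(i, j). opr V i j) (letters w) v))"

text \<open>All representatives of a class in \<open>U(gl\<^sub>n)\<close> act on a module in the same way.\<close>

definition U_act :: "'v::ab_group_add gl_mod \<Rightarrow> free_gl set \<Rightarrow> 'v \<Rightarrow> 'v" where
  "U_act V x v = the_elem ((\<lambda>f. free_act V f v) ` x)"

definition gl_hom ::
    "nat \<Rightarrow> 'v::ab_group_add gl_mod \<Rightarrow> 'w::ab_group_add gl_mod \<Rightarrow> ('v \<Rightarrow> 'w) set" where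
  "gl_hom n V W = {f. Vector_Spaces.linear (scl V) (scl W) f \<and>
     (\<forall>i\<in>{1..n}. \<forall>j\<in>{1..n}. \<forall>v. f (opr V i j v) = opr W i j (f v))}"

definition gl_iso :: "nat \<Rightarrow> 'v::ab_group_add gl_mod \<Rightarrow> 'w::ab_group_add gl_mod \<Rightarrow> bool" where
  "gl_iso n V W \<longleftrightarrow> (\<exists>f\<in>gl_hom n V W. bij f)"

definition gl_irreducible :: "nat \<Rightarrow> 'v::ab_group_add gl_mod \<Rightarrow> bool" where
  "gl_irreducible n V \<longleftrightarrow> (UNIV :: 'v set) \<noteq> {0} \<and>
     (\<forall>S. Modules.module.subspace (scl V) S \<and>
          (\<forall>i\<in>{1..n}. \<forall>j\<in>{1..n}. \<forall>v\<in>S. opr V i j v \<in> S) \<longrightarrow> S = {0} \<or> S = UNIV)"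

text \<open>The zeroth power of an ideal of \<open>\<Gamma>\<close> is \<open>\<Gamma>\<close>.\<close>

definition ideal_power :: "nat \<Rightarrow> free_gl set set \<Rightarrow> nat \<Rightarrow> free_gl set set" where
  "ideal_power n \<mm> k = (ideal_prod (Gamma n) \<mm> ^^ k) (carrier (Gamma n))"

definition gt_space ::
    "nat \<Rightarrow> 'v::ab_group_add gl_mod \<Rightarrow> free_gl set set \<Rightarrow> 'v set" where
  "gt_space n V \<mm> = {v. \<exists>k. \<forall>x\<in>ideal_power n \<mm> k. U_act V x v = 0}"

definition internal_direct_sum :: "'i set \<Rightarrow> ('i \<Rightarrow> 'v::ab_group_add set) \<Rightarrow> bool" where
  "internal_direct_sum I W \<longleftrightarrow>
     (\<forall>v. \<exists>!f. (\<forall>i\<in>I. f i \<in> W i) \<and> (\<forall>i. i \<notin> I \<longrightarrow> f i = 0) \<and> finite {i. f i \<noteq> 0} \<and>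
            v = (\<Sum>i | f i \<noteq> 0. f i))"

definition gt_module :: "nat \<Rightarrow> 'v::ab_group_add gl_mod \<Rightarrow> bool" where
  "gt_module n V \<longleftrightarrow>
     gl_module n V \<and> internal_direct_sum {\<mm>. maximalideal \<mm> (Gamma n)} (gt_space n V)"

definition gt_support :: "nat \<Rightarrow> 'v::ab_group_add gl_mod \<Rightarrow> free_gl set set set" where
  "gt_support n V = {\<mm>. maximalideal \<mm> (Gamma n) \<and> gt_space n V \<mm> \<noteq> {0}}"

definition tame :: "nat \<Rightarrow> 'v::ab_group_add gl_mod \<Rightarrow> bool" where
  "tame n V \<longleftrightarrow>
     (\<exists>B. \<not> Modules.module.dependent (scl V) B \<and> Modules.module.span (scl V) B = UNIV \<and>
          (\<forall>b\<in>B. \<forall>x\<in>carrier (Gamma n). \<exists>c. U_act V x b = scl V c b))"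

definition NCT :: "nat \<Rightarrow> tableau \<Rightarrow> 'v::ab_group_add gl_mod set" where
  "NCT n L = {V. gt_module n V \<and> tame n V \<and> gt_support n V \<subseteq> NC n L}"


section \<open>The Drinfeld quiver and its representations\<close>

text \<open>
  For \<open>L' \<in> NC_int n L\<close>, the edges starting at the vertex \<open>mL n L'\<close> are the loops
  \<open>LoopA k m i\<close>, standing for \<open>a\<^sub>k(-l'\<^sub>m\<^sub>i)\<close>, and \<open>EdgeB m i\<close>, \<open>EdgeC m i\<close>, standing for
  \<open>b\<^sub>m(-l'\<^sub>m\<^sub>i)\<close>, \<open>c\<^sub>m(-l'\<^sub>m\<^sub>i)\<close>.
\<close>

datatype edge = LoopA nat nat nat | EdgeB nat nat | EdgeC nat nat

definition edges :: "nat \<Rightarrow> edge set" where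
  "edges n = {LoopA k m i | k m i. k \<in> {1..n} \<and> m \<in> {1..n-1} \<and> i \<in> {1..m}}
     \<union> {EdgeB m i | m i. m \<in> {1..n-1} \<and> i \<in> {1..m}}
     \<union> {EdgeC m i | m i. m \<in> {1..n-1} \<and> i \<in> {1..m}}"

fun target :: "tableau \<Rightarrow> edge \<Rightarrow> tableau" where
  "target L' (LoopA k m i) = L'"
| "target L' (EdgeB m i) = shift L' m i 1"
| "target L' (EdgeC m i) = shift L' m i (-1)"

fun edge_elt :: "tableau \<Rightarrow> edge \<Rightarrow> free_gl" where
  "edge_elt L' (LoopA k m i) = a_gen k (- L' m i)"
| "edge_elt L' (EdgeB m i) = b_gen m (- L' m i)"
| "edge_elt L' (EdgeC m i) = c_gen m (- L' m i)"

text \<open>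
  The spaces at the vertices are subspaces of one vector space \<open>'v\<close>, which may be as large as
  desired; they are not required to be independent.  The map of the edge \<open>e\<close> starting at \<open>mL n L'\<close>
  is \<open>emap R L' e\<close>.
\<close>

record 'v drep =
  rscl :: "complex \<Rightarrow> 'v \<Rightarrow> 'v"
  vsp :: "free_gl set set \<Rightarrow> 'v set"
  emap :: "tableau \<Rightarrow> edge \<Rightarrow> 'v \<Rightarrow> 'v"

definition linear_between ::
    "(complex \<Rightarrow> 'v \<Rightarrow> 'v) \<Rightarrow> 'v set \<Rightarrow> (complex \<Rightarrow> 'w \<Rightarrow> 'w) \<Rightarrow> 'w set
       \<Rightarrow> ('v::ab_group_add \<Rightarrow> 'w::ab_group_add) \<Rightarrow> bool" where
  "linear_between s A t B f \<longleftrightarrow> f \<in> A \<rightarrow> B \<and>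
     (\<forall>x\<in>A. \<forall>y\<in>A. f (x + y) = f x + f y) \<and> (\<forall>c. \<forall>x\<in>A. f (s c x) = t c (f x))"

text \<open>Edges leading out of \<open>NC\<close> are interpreted as \<open>0\<close>; this also kills the paths through them.\<close>

definition arr ::
    "nat \<Rightarrow> tableau \<Rightarrow> 'v::ab_group_add drep \<Rightarrow> tableau \<Rightarrow> edge \<Rightarrow> 'v \<Rightarrow> 'v" where
  "arr n L R L' e v =
     (if L' \<in> NC_int n L \<and> target L' e \<in> NC_int n L then emap R L' e v else 0)"

text \<open>
  The last two relations below are equations between combinations of paths with different end
  points, i.e. in the direct sum of the spaces at the vertices; \<open>at_vertex M w\<close> is the element of
  this sum with component \<open>w\<close> at \<open>M\<close>.  For \<open>i = j\<close> both of their sides vanish.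
  The commutation relations are imposed for \<open>(l, j) \<noteq> (m, i)\<close>: otherwise they are
  tautological, or do not involve paths of the quiver.
\<close>

definition at_vertex :: "tableau \<Rightarrow> 'v::zero \<Rightarrow> tableau \<Rightarrow> 'v" where
  "at_vertex M w \<tau> = (if \<tau> = M then w else 0)"

definition drinfeld_relations :: "nat \<Rightarrow> tableau \<Rightarrow> 'v::ab_group_add drep \<Rightarrow> bool" where
  "drinfeld_relations n L R \<longleftrightarrow>
    (\<forall>L'\<in>NC_int n L. \<forall>v\<in>vsp R (mL n L').
      let s = rscl R;
          A = (\<lambda>M k m i. arr n L R M (LoopA k m i));
          B = (\<lambda>M m i. arr n L R M (EdgeB m i));
          C = (\<lambda>M m i. arr n L R M (EdgeC m i));
          up = (\<lambda>m i. shift L' m i 1);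
          dn = (\<lambda>m i. shift L' m i (-1))
      in
      (\<forall>k\<in>{1..n}. \<forall>m\<in>{1..n-1}. \<forall>i\<in>{1..m}.
         A L' k m i v = s (alpha k (- L' m i) L') v) \<and>
      (\<forall>m\<in>{1..n-1}. \<forall>i\<in>{1..m}. \<forall>l\<in>{1..n-1}. \<forall>j\<in>{1..l}.
         l \<noteq> m \<or> i \<noteq> j \<longrightarrow>
         C (up l j) m i (B L' l j v) = B (dn m i) l j (C L' m i v)) \<and>
      (\<forall>m\<in>{1..n-1}. \<forall>i\<in>{1..m}. \<forall>l\<in>{1..n-1}. \<forall>j\<in>{1..l}.
         \<bar>int l - int m\<bar> \<noteq> 1 \<and> (l, j) \<noteq> (m, i) \<longrightarrow>
         B (up l j) m i (B L' l j v) = B (up m i) l j (B L' m i v) \<and>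
         C (dn l j) m i (C L' l j v) = C (dn m i) l j (C L' m i v)) \<and>
      (\<forall>m\<in>{1..n-1}. \<forall>i\<in>{1..m}.
         B (dn m i) m i (C L' m i v)
           = s (- alpha (m + 1) (- L' m i + 1) L' * alpha (m - 1) (- L' m i) L') v \<and>
         C (up m i) m i (B L' m i v)
           = s (- alpha (m + 1) (- L' m i) L' * alpha (m - 1) (- L' m i - 1) L') v) \<and>
      (\<forall>m\<in>{1..n-1}. \<forall>i\<in>{1..m}. \<forall>j\<in>{1..m}. i \<noteq> j \<longrightarrow>
        (\<forall>\<tau>. let x = - L' m i; y = - L' m j in
          s (x - y) (at_vertex (dn m j) (A (dn m j) m m i (C L' m j v)) \<tau>
                     - at_vertex (dn m j) (C L' m j (A L' m m i v)) \<tau>)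
            = at_vertex (dn m i) (C L' m i (A L' m m j v)) \<tau>
              - at_vertex (dn m j) (C L' m j (A L' m m i v)) \<tau> \<and>
          s (x - y) (at_vertex (up m j) (A (up m j) m m i (B L' m j v)) \<tau>
                     - at_vertex (up m j) (B L' m j (A L' m m i v)) \<tau>)
            = - at_vertex (up m i) (B L' m i (A L' m m j v)) \<tau>
              + at_vertex (up m j) (B L' m j (A L' m m i v)) \<tau>)))"

definition D_rep :: "nat \<Rightarrow> tableau \<Rightarrow> 'v::ab_group_add drep \<Rightarrow> bool" where
  "D_rep n L R \<longleftrightarrow>
     vector_space (rscl R) \<and>
     (\<forall>\<omega>\<in>NC n L. Modules.module.subspace (rscl R) (vsp R \<omega>)) \<and>
     (\<forall>L'\<in>NC_int n L. \<forall>e\<in>edges n. target L' e \<in> NC_int n L \<longrightarrow>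
        linear_between (rscl R) (vsp R (mL n L')) (rscl R) (vsp R (mL n (target L' e)))
          (emap R L' e)) \<and>
     drinfeld_relations n L R"

definition D_hom ::
    "nat \<Rightarrow> tableau \<Rightarrow> 'v::ab_group_add drep \<Rightarrow> 'w::ab_group_add drep
       \<Rightarrow> (free_gl set set \<Rightarrow> 'v \<Rightarrow> 'w) set" where
  "D_hom n L R S = {\<phi> \<in> (\<Pi>\<^sub>E \<omega>\<in>NC n L. extensional (vsp R \<omega>)).
     (\<forall>\<omega>\<in>NC n L. linear_between (rscl R) (vsp R \<omega>) (rscl S) (vsp S \<omega>) (\<phi> \<omega>)) \<and>
     (\<forall>L'\<in>NC_int n L. \<forall>e\<in>edges n. target L' e \<in> NC_int n L \<longrightarrow>
        (\<forall>v\<in>vsp R (mL n L').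
           \<phi> (mL n (target L' e)) (emap R L' e v) = emap S L' e (\<phi> (mL n L') v)))}"

definition D_id ::
    "nat \<Rightarrow> tableau \<Rightarrow> 'v drep \<Rightarrow> free_gl set set \<Rightarrow> 'v \<Rightarrow> 'v" where
  "D_id n L R = (\<lambda>\<omega>\<in>NC n L. \<lambda>v\<in>vsp R \<omega>. v)"

definition D_comp ::
    "nat \<Rightarrow> tableau \<Rightarrow> 'v drep \<Rightarrow> (free_gl set set \<Rightarrow> 'w \<Rightarrow> 'x)
       \<Rightarrow> (free_gl set set \<Rightarrow> 'v \<Rightarrow> 'w) \<Rightarrow> free_gl set set \<Rightarrow> 'v \<Rightarrow> 'x" where
  "D_comp n L R \<psi> \<phi> = (\<lambda>\<omega>\<in>NC n L. compose (vsp R \<omega>) (\<psi> \<omega>) (\<phi> \<omega>))"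

definition D_iso ::
    "nat \<Rightarrow> tableau \<Rightarrow> 'v::ab_group_add drep \<Rightarrow> 'w::ab_group_add drep \<Rightarrow> bool" where
  "D_iso n L R S \<longleftrightarrow>
     (\<exists>\<phi>\<in>D_hom n L R S. \<forall>\<omega>\<in>NC n L. bij_betw (\<phi> \<omega>) (vsp R \<omega>) (vsp S \<omega>))"

definition D_irreducible :: "nat \<Rightarrow> tableau \<Rightarrow> 'v::ab_group_add drep \<Rightarrow> bool" where
  "D_irreducible n L R \<longleftrightarrow> D_rep n L R \<and> (\<exists>\<omega>\<in>NC n L. vsp R \<omega> \<noteq> {0}) \<and>
     (\<forall>W. (\<forall>\<omega>\<in>NC n L. Modules.module.subspace (rscl R) (W \<omega>) \<and> W \<omega> \<subseteq> vsp R \<omega>) \<and>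
          (\<forall>L'\<in>NC_int n L. \<forall>e\<in>edges n. target L' e \<in> NC_int n L \<longrightarrow>
             emap R L' e ` W (mL n L') \<subseteq> W (mL n (target L' e)))
        \<longrightarrow> (\<forall>\<omega>\<in>NC n L. W \<omega> = {0}) \<or> (\<forall>\<omega>\<in>NC n L. W \<omega> = vsp R \<omega>))"


section \<open>The functor\<close>

definition F_NC :: "nat \<Rightarrow> 'v::ab_group_add gl_mod \<Rightarrow> 'v drep" where
  "F_NC n V = \<lparr>rscl = scl V, vsp = gt_space n V,
     emap = (\<lambda>L' e. U_act V (cls n (edge_elt L' e)))\<rparr>"

definition F_NC_mor ::
    "nat \<Rightarrow> tableau \<Rightarrow> 'v::ab_group_add gl_mod \<Rightarrow> ('v \<Rightarrow> 'w) \<Rightarrow> free_gl set set \<Rightarrow> 'v \<Rightarrow> 'w" where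
  "F_NC_mor n L V f = (\<lambda>\<omega>\<in>NC n L. restrict f (gt_space n V \<omega>))"

end

theory Submission
  imports Defs "HOL-Computational_Algebra.Polynomial"
begin

text \<open>
  The functor sends a module to the family of its weight spaces.  The theorem therefore rests on two
  facts: the Drinfeld generators satisfy the relations of the quiver, and conversely the edges of the
  quiver determine the action of all of \<open>gl\<^sub>n\<close>.

  \<^emph>\<open>Relations.\<close>  Two properties of the column determinant \<open>a\<^sub>m(u)\<close> are proved from its
  definition: it commutes with \<open>E\<^sub>p\<^sub>q\<close> for \<open>p, q \<le> m\<close> (\<open>comm_E_a_zero\<close>), and it can be expanded along
  its last column (\<open>D_last_column\<close>).  The expansion gives a matrix \<open>adj\<^sub>m(u)\<close> with
  \<open>adj\<^sub>m(u) T\<^sub>m(u) = a\<^sub>m(u)\<close>, where \<open>T\<^sub>m(u) = u - m + 1 + (E\<^sub>i\<^sub>j)\<close>.  Its entries are polynomials in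
  \<open>u\<close> while \<open>T\<^sub>m(u)\<close> is monic of degree one, so a row of polynomials which \<open>T\<^sub>m(u)\<close> kills from the right is
  zero (\<open>row_cancel\<close>).  By this cancellation \<open>T\<^sub>m adj\<^sub>m = a\<^sub>m\<close>, the matrix \<open>adj\<^sub>m\<close> transforms under
  \<open>gl\<^sub>m\<close> like the matrix \<open>(E\<^sub>i\<^sub>j)\<close>, and the commutators of the entries of \<open>adj\<^sub>m\<^sub>+\<^sub>1(x)\<close> with \<open>a\<^sub>m(y)\<close>
  are known.  Now \<open>b\<^sub>m = [a\<^sub>m, E\<^sub>m\<^sub>,\<^sub>m\<^sub>+\<^sub>1]\<close> and \<open>c\<^sub>m = [E\<^sub>m\<^sub>+\<^sub>1\<^sub>,\<^sub>m, a\<^sub>m]\<close>, and the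
  lower right \<open>2 \<times> 2\<close> block of \<open>adj\<^sub>m\<^sub>+\<^sub>1\<close> consists of \<open>d\<^sub>m, -b\<^sub>m, -c\<^sub>m, a\<^sub>m\<close> for a further
  polynomial \<open>d\<^sub>m\<close>.  All relations between the \<open>a\<^sub>m, b\<^sub>m, c\<^sub>m\<close> become short matrix computations.

  \<^emph>\<open>Weight spaces.\<close>  A tame module has a basis of common eigenvectors of \<open>\<Gamma>\<close>.  The annihilator of such a
  vector is a maximal ideal (\<open>annihilator_maximal\<close>), hence belongs to the support and is \<open>m\<^sub>M\<close> for some
  \<open>M\<close> in \<open>NC\<close>.  It follows that the generalised weight space of \<open>m\<^sub>M\<close> is the common eigenspace of the
  \<open>a\<^sub>k(u)\<close> with eigenvalues \<open>\<alpha>\<^sub>k(u, M)\<close> (\<open>gt_space_eq\<close>), and that this eigenspace is zero when a row of \<open>M\<close>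
  above the last one has a repeated entry (\<open>eig_critical\<close>).  A shift that leaves \<open>NC\<close> creates such a
  repetition, so the edges that the quiver interprets as zero do act as zero.

  \<^emph>\<open>Recovering the module.\<close>  As a polynomial in \<open>u\<close>, \<open>b\<^sub>m(u)\<close> has degree at most \<open>m - 1\<close> and the coefficient of
  \<open>u\<^sup>m\<^sup>-\<^sup>1\<close> is \<open>E\<^sub>m\<^sub>,\<^sub>m\<^sub>+\<^sub>1\<close>; similarly for \<open>c\<^sub>m(u)\<close> and \<open>E\<^sub>m\<^sub>+\<^sub>1\<^sub>,\<^sub>m\<close>.  At a vertex the \<open>m\<close> points
  \<open>-l\<^sub>m\<^sub>i\<close> are distinct, and interpolation there writes these matrix units as combinations of edges whose
  coefficients depend only on the tableau (\<open>E_from_edges\<close>).  Together with \<open>E\<^sub>1\<^sub>1 = a\<^sub>1(0)\<close> they generate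
  \<open>gl\<^sub>n\<close>.  Hence the span of a subrepresentation is a submodule, and an isomorphism of representations
  extends to a linear bijection of the modules that commutes with \<open>gl\<^sub>n\<close>.
\<close>


section \<open>Commutators\<close>

definition comm :: "'r::ring \<Rightarrow> 'r \<Rightarrow> 'r" where
  "comm x y = x * y - y * x"

lemma comm_mult_right: "comm x (y * z) = comm x y * z + y * comm x z"
  and comm_mult_left: "comm (x * y) z = x * comm y z + comm x z * y"
  and comm_add_right: "comm x (y + z) = comm x y + comm x z"
  and comm_add_left: "comm (x + y) z = comm x z + comm y z"
  and comm_diff_right: "comm x (y - z) = comm x y - comm x z"
  and comm_diff_left: "comm (x - y) z = comm x z - comm y z"
  and comm_uminus_right: "comm x (- y) = - comm x y"
  and comm_uminus_left: "comm (- x) y = - comm x y"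
  and comm_zero_right [simp]: "comm x 0 = 0"
  and comm_zero_left [simp]: "comm 0 x = 0"
  and comm_self [simp]: "comm x x = 0"
  and comm_jacobi: "comm x (comm y z) = comm (comm x y) z + comm y (comm x z)"
  by (simp_all add: comm_def algebra_simps)

lemma comm_swap: "comm x y = - comm y x"
  by (simp add: comm_def)

lemma comm_eq_0_swap: "comm x y = 0 \<Longrightarrow> comm y x = 0"
  by (simp add: comm_def)

lemma comm_eq_0D: "comm x y = 0 \<Longrightarrow> x * y = y * x"
  by (simp add: comm_def)

lemma comm_one_right [simp]: "comm x (1::'r::{ring,monoid_mult}) = 0"
  by (simp add: comm_def)

lemma comm_sum_right: "comm x (\<Sum>i\<in>A. f i) = (\<Sum>i\<in>A. comm x (f i))"
  by (simp add: comm_def sum_distrib_left sum_distrib_right sum_subtractf)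

lemma comm_sum_left: "comm (\<Sum>i\<in>A. f i) x = (\<Sum>i\<in>A. comm (f i) x)"
  by (simp add: comm_def sum_distrib_left sum_distrib_right sum_subtractf)

lemma comm_prod_list:
  fixes g :: "'a \<Rightarrow> 'r::{ring,monoid_mult}"
  assumes "distinct xs"
  shows "comm x (prod_list (map g xs)) = (\<Sum>r\<in>set xs. prod_list (map (g(r := comm x (g r))) xs))"
  using assms
proof (induction xs)
  case (Cons y ys)
  have "(\<Sum>r\<in>set ys. prod_list (map (g(r := comm x (g r))) (y # ys)))
      = (\<Sum>r\<in>set ys. g y * prod_list (map (g(r := comm x (g r))) ys))"
    by (rule sum.cong) (use Cons.prems in auto)
  moreover have "prod_list (map (g(y := comm x (g y))) ys) = prod_list (map g ys)"
    by (subst map_fun_upd) (use Cons.prems in auto)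
  ultimately have "(\<Sum>r\<in>set (y # ys). prod_list (map (g(r := comm x (g r))) (y # ys)))
      = comm x (g y) * prod_list (map g ys)
        + (\<Sum>r\<in>set ys. g y * prod_list (map (g(r := comm x (g r))) ys))"
    using Cons.prems by (simp del: fun_upd_apply add: fun_upd_same)
  then show ?case
    using Cons by (simp del: fun_upd_apply add: comm_mult_right sum_distrib_left)
qed simp

lemma comm_prod_list_eq_0:
  fixes x :: "'r::{ring,monoid_mult}"
  shows "(\<And>y. y \<in> set ys \<Longrightarrow> comm x y = 0) \<Longrightarrow> comm x (prod_list ys) = 0"
  by (induction ys) (simp_all add: comm_mult_right)

lemma prod_list_upd_diff:
  fixes g :: "'a \<Rightarrow> 'r::{ring,monoid_mult}"
  assumes "distinct xs" "r \<in> set xs"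
  shows "prod_list (map (g(r := x - y)) xs)
    = prod_list (map (g(r := x)) xs) - prod_list (map (g(r := y)) xs)"
  using assms
proof (induction xs)
  case (Cons a xs)
  show ?case
  proof (cases "a = r")
    case True
    then have "prod_list (map (g(r := z)) xs) = prod_list (map g xs)" for z
      by (subst map_fun_upd) (use Cons.prems in auto)
    then show ?thesis
      using True by (simp del: fun_upd_apply add: fun_upd_same left_diff_distrib)
  next
    case False
    then show ?thesis
      using Cons by (simp del: fun_upd_apply add: fun_upd_other right_diff_distrib)
  qed
qed simp

lemma prod_list_upd_zero:
  fixes g :: "'a \<Rightarrow> 'r::{ring,monoid_mult}"
  assumes "r \<in> set xs"
  shows "prod_list (map (g(r := 0)) xs) = 0"
  using assms by (induction xs) auto


section \<open>Interpolation of the top coefficient\<close>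

text \<open>
  The functional that reads off the coefficient of degree \<open>card I - 1\<close> is a combination of evaluations at the
  points \<open>x i\<close>.  Its weights (those of the divided difference) are built by adding one point \<open>x a\<close> at a time:
  the old functional is applied to \<open>(f - f (x a)) / (X - x a)\<close>.
\<close>
lemma top_coeff_functional:
  fixes x :: "'i \<Rightarrow> complex"
  assumes "finite I" "I \<noteq> {}" "inj_on x I"
  shows "\<exists>c. \<forall>p<card I. (\<Sum>i\<in>I. c i * x i ^ p) = (if p = card I - 1 then 1 else 0)"
  using assms
proof (induction I rule: finite_ne_induct)
  case (singleton a)
  show ?case by (rule exI[of _ "\<lambda>_. 1"]) auto
next
  case (insert a I)
  then obtain c where c: "\<And>p. p < card I \<Longrightarrow> (\<Sum>i\<in>I. c i * x i ^ p) = (if p = card I - 1 then 1 else 0)"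
    by auto
  have ne: "x i - x a \<noteq> 0" if "i \<in> I" for i
    using insert that by (auto simp: inj_on_def)
  define d where "d i = c i / (x i - x a)" for i
  define c' where "c' i = (if i = a then - (\<Sum>i\<in>I. d i) else d i)" for i
  have sum_c': "(\<Sum>i\<in>insert a I. c' i * x i ^ p) = (\<Sum>i\<in>I. d i * (x i ^ p - x a ^ p))" for p
  proof -
    have "(\<Sum>i\<in>I. c' i * x i ^ p) = (\<Sum>i\<in>I. d i * x i ^ p)"
      by (rule sum.cong) (use insert in \<open>auto simp: c'_def\<close>)
    then show ?thesis
      using insert by (simp add: c'_def right_diff_distrib sum_subtractf sum_distrib_right)
  qed
  have "(\<Sum>i\<in>insert a I. c' i * x i ^ p) = (if p = card (insert a I) - 1 then 1 else 0)"
    if p: "p < card (insert a I)" for p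
  proof (cases p)
    case 0
    then show ?thesis using insert sum_c'[of 0] by simp
  next
    case (Suc q)
    have "(\<Sum>i\<in>I. d i * (x i ^ Suc q - x a ^ Suc q)) = (\<Sum>i\<in>I. c i * (\<Sum>s<Suc q. x i ^ s * x a ^ (q - s)))"
    proof (rule sum.cong)
      fix i assume i: "i \<in> I"
      have "x i ^ Suc q - x a ^ Suc q = (x i - x a) * (\<Sum>s<Suc q. x i ^ s * x a ^ (q - s))"
        by (subst diff_power_eq_sum) simp
      then show "d i * (x i ^ Suc q - x a ^ Suc q) = c i * (\<Sum>s<Suc q. x i ^ s * x a ^ (q - s))"
        using ne[OF i] by (simp add: d_def)
    qed simp
    also have "\<dots> = (\<Sum>s<Suc q. x a ^ (q - s) * (\<Sum>i\<in>I. c i * x i ^ s))"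
      by (simp only: sum_distrib_left, subst sum.swap) (simp only: ac_simps)
    also have "\<dots> = (\<Sum>s<Suc q. x a ^ (q - s) * (if s = card I - 1 then 1 else 0))"
      by (rule sum.cong) (use p Suc insert c in auto)
    also have "\<dots> = (\<Sum>s<Suc q. if s = card I - 1 then x a ^ (q - s) else 0)"
      by (rule sum.cong) auto
    also have "\<dots> = (if card I - 1 < Suc q then x a ^ (q - (card I - 1)) else 0)"
      by (subst sum.delta) auto
    also have "\<dots> = (if p = card (insert a I) - 1 then 1 else 0)"
      using p Suc insert by (auto simp: card_gt_0_iff)
    finally show ?thesis using sum_c'[of p] Suc by simp
  qed
  then show ?case by blast
qed


section \<open>Column determinants over \<open>gl\<^sub>n\<close>\<close>

text \<open>
  Elements \<open>E i j\<close> of a ring that satisfy the commutation relations of \<open>gl\<^sub>n\<close>; the homomorphism \<open>k\<close>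
  embeds the scalars.  The intended ring consists of all additive endomorphisms of a module, where scalars
  commute with the \<open>E i j\<close> but are not central, and where \<open>0 = 1\<close> if the module is zero.
\<close>
locale gl_family =
  fixes n :: nat and k :: "complex \<Rightarrow> 'r::{ring,monoid_mult}" and E :: "nat \<Rightarrow> nat \<Rightarrow> 'r"
  assumes k_add: "k (x + y) = k x + k y"
    and k_mult: "k (x * y) = k x * k y"
    and k_one [simp]: "k 1 = 1"
    and k_E: "\<lbrakk>i \<in> {1..n}; j \<in> {1..n}\<rbrakk> \<Longrightarrow> comm (k z) (E i j) = 0"
    and comm_E: "\<lbrakk>i \<in> {1..n}; j \<in> {1..n}; p \<in> {1..n}; q \<in> {1..n}\<rbrakk> \<Longrightarrow>
      comm (E i j) (E p q) = (if j = p then E i q else 0) - (if i = q then E p j else 0)"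
begin

lemma k_zero [simp]: "k 0 = 0"
  using k_add[of 0 0] by simp

lemma k_uminus: "k (- x) = - k x"
  using k_add[of x "- x"] by (simp add: eq_neg_iff_add_eq_0 add.commute)

lemma k_diff: "k (x - y) = k x - k y"
  using k_add[of x "- y"] by (simp add: k_uminus)

lemma k_commute: "k x * k y = k y * k x"
  by (simp flip: k_mult add: mult.commute)

lemma comm_k_k [simp]: "comm (k x) (k y) = 0"
  by (simp add: comm_def k_commute)

lemma k_cancel:
  assumes "c \<noteq> 0" "k c * x = 0"
  shows "x = 0"
proof -
  have "k (inverse c) * (k c * x) = x"
    using assms(1) by (simp flip: mult.assoc k_mult)
  then show ?thesis using assms(2) by simp
qed

lemma eq_uminus_imp_zero:
  assumes "(x::'r) = - x"
  shows "x = 0"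
proof (rule k_cancel[of 2])
  have "k 2 * x = (k 1 + k 1) * x" by (simp only: one_add_one flip: k_add)
  also have "\<dots> = x + x" by (simp add: distrib_right)
  finally show "k 2 * x = 0" using assms by (simp add: eq_neg_iff_add_eq_0)
qed simp

text \<open>This is the transpose of the matrix \<open>T_gl\<close>: the entry \<open>T_gl j i\<close> acts as \<open>t i j\<close>.\<close>
definition t :: "nat \<Rightarrow> nat \<Rightarrow> complex \<Rightarrow> 'r" where
  "t i j u = (if i = j then k u else 0) + E i j"

lemma k_E_commute: "\<lbrakk>i \<in> {1..n}; j \<in> {1..n}\<rbrakk> \<Longrightarrow> E i j * k z = k z * E i j"
  using k_E by (simp add: comm_def)

lemma comm_E_k: "\<lbrakk>i \<in> {1..n}; j \<in> {1..n}\<rbrakk> \<Longrightarrow> comm (E i j) (k z) = 0"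
  by (simp add: comm_def k_E_commute)

lemma comm_E_t:
  "\<lbrakk>p \<in> {1..n}; q \<in> {1..n}; i \<in> {1..n}; j \<in> {1..n}\<rbrakk> \<Longrightarrow>
    comm (E p q) (t i j z) = (if q = i then t p j z else 0) - (if p = j then t i q z else 0)"
  by (auto simp: t_def comm_add_right comm_E comm_E_k)

text \<open>
  The column determinant of the minor of \<open>t\<close> with rows \<open>\<alpha> 1, \<dots>, \<alpha> m\<close> and columns \<open>\<beta> 1, \<dots>, \<beta> m\<close>.
  Repetitions among the indices are allowed; they are what makes the determinant vanish.
\<close>
definition D :: "nat \<Rightarrow> (nat \<Rightarrow> nat) \<Rightarrow> (nat \<Rightarrow> nat) \<Rightarrow> complex \<Rightarrow> 'r" where
  "D m \<alpha> \<beta> u = (\<Sum>\<sigma> | \<sigma> permutes {1..m}. k (of_int (sign \<sigma>)) *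
     prod_list (map (\<lambda>r. t (\<alpha> (\<sigma> r)) (\<beta> r) (u - of_nat (r - 1))) [1..<m + 1]))"

definition a :: "nat \<Rightarrow> complex \<Rightarrow> 'r" where
  "a m = D m id id"

lemma a_0 [simp]: "a 0 u = 1"
  by (simp add: a_def D_def)

lemma D_cong:
  assumes "\<And>r. r \<in> {1..m} \<Longrightarrow> \<alpha> r = \<alpha>' r" "\<And>r. r \<in> {1..m} \<Longrightarrow> \<beta> r = \<beta>' r"
  shows "D m \<alpha> \<beta> u = D m \<alpha>' \<beta>' u"
  unfolding D_def
proof (intro sum.cong refl arg_cong2[where f = "(*)"] arg_cong[where f = prod_list] map_cong)
  fix \<sigma> r assume "\<sigma> \<in> {\<sigma>. \<sigma> permutes {1..m}}" "r \<in> set [1..<m + 1]"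
  then have "r \<in> {1..m}" "\<sigma> r \<in> {1..m}"
    by (simp_all only: permutes_in_image mem_Collect_eq) auto
  then show "t (\<alpha> (\<sigma> r)) (\<beta> r) (u - of_nat (r - 1)) = t (\<alpha>' (\<sigma> r)) (\<beta>' r) (u - of_nat (r - 1))"
    using assms by simp
qed

lemma sign_swap:
  fixes m :: nat
  assumes "\<sigma> permutes {1..m}" "i \<in> {1..m}" "j \<in> {1..m}" "i \<noteq> j"
  shows "sign (transpose i j \<circ> \<sigma>) = - sign \<sigma>" "sign (\<sigma> \<circ> transpose i j) = - sign \<sigma>"
proof -
  have "permutation \<sigma>" "permutation (transpose i j)"
    using permutes_imp_permutation[OF finite_atLeastAtMost assms(1)] by (simp_all add: permutation_swap_id)
  then show "sign (transpose i j \<circ> \<sigma>) = - sign \<sigma>" "sign (\<sigma> \<circ> transpose i j) = - sign \<sigma>"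
    using assms(4) by (simp_all add: sign_compose sign_swap_id)
qed

lemma D_row_repeat:
  assumes "i \<in> {1..m}" "j \<in> {1..m}" "i \<noteq> j" "\<alpha> i = \<alpha> j"
  shows "D m \<alpha> \<beta> u = 0"
proof (rule eq_uminus_imp_zero)
  let ?\<tau> = "transpose i j"
  have \<tau>: "?\<tau> permutes {1..m}"
    by (rule permutes_swap_id) (use assms in auto)
  have \<alpha>: "\<alpha> (?\<tau> x) = \<alpha> x" for x
    using assms(4) by (cases "x = i \<or> x = j") auto
  have "D m \<alpha> \<beta> u = (\<Sum>\<sigma> | \<sigma> permutes {1..m}. k (of_int (sign (?\<tau> \<circ> \<sigma>))) *
     prod_list (map (\<lambda>r. t (\<alpha> ((?\<tau> \<circ> \<sigma>) r)) (\<beta> r) (u - of_nat (r - 1))) [1..<m + 1]))"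
    unfolding D_def
    by (rule sum.reindex_bij_witness[of _ "\<lambda>\<sigma>. ?\<tau> \<circ> \<sigma>" "\<lambda>\<sigma>. ?\<tau> \<circ> \<sigma>"])
       (use \<tau> in \<open>simp_all add: permutes_compose o_assoc transpose_comp_involutory\<close>)
  also have "\<dots> = - D m \<alpha> \<beta> u"
    unfolding D_def sum_negf[symmetric]
    by (rule sum.cong) (use assms in \<open>auto simp: sign_swap \<alpha> k_uminus\<close>)
  finally show "D m \<alpha> \<beta> u = - D m \<alpha> \<beta> u" .
qed

text \<open>
  The shift of the parameter by one from factor to factor is chosen for this identity: the \<open>2 \<times> 2\<close> column determinants with
  parameters \<open>v\<close> and \<open>v - 1\<close> are antisymmetric also in their columns.
\<close>
lemma t_exchange:
  assumes "x \<in> {1..n}" "x' \<in> {1..n}" "y \<in> {1..n}" "y' \<in> {1..n}"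
  shows "t x y v * t x' y' (v - 1) - t x' y v * t x y' (v - 1)
       + t x y' v * t x' y (v - 1) - t x' y' v * t x y (v - 1) = 0"
proof -
  let ?\<delta> = "\<lambda>i j. if i = j then (1::'r) else 0"
  define U where "U i j = (if i = j then k v else 0)" for i j :: nat
  have t: "t i j v = U i j + E i j" "t i j (v - 1) = U i j - ?\<delta> i j + E i j" for i j
    by (simp_all add: t_def U_def k_diff)
  have U_E: "E i j * U i' j' = U i' j' * E i j" if "i \<in> {1..n}" "j \<in> {1..n}" for i j i' j'
    using that by (simp add: U_def k_E_commute)
  have U_U: "U i j * U i' j' = U i' j' * U i j" for i j i' j'
    by (simp add: U_def)
  have U_\<delta>: "U i j * ?\<delta> i' j' = U i' j' * ?\<delta> i j" for i j i' j'
    by (simp add: U_def)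
  have \<delta>_E: "?\<delta> i j * x = (if i = j then x else 0)" "x * ?\<delta> i j = (if i = j then x else 0)" for i j x
    by simp_all
  have "t x y v * t x' y' (v - 1) - t x' y v * t x y' (v - 1)
       + t x y' v * t x' y (v - 1) - t x' y' v * t x y (v - 1)
     = comm (E x y) (E x' y') + comm (E x y') (E x' y)
       - E x y * ?\<delta> x' y' + E x' y * ?\<delta> x y' - E x y' * ?\<delta> x' y + E x' y' * ?\<delta> x y"
    unfolding t comm_def
    using assms U_U[of x y x' y'] U_U[of x y' x' y] U_\<delta>[of x y x' y'] U_\<delta>[of x y' x' y]
    by (simp add: distrib_left distrib_right left_diff_distrib right_diff_distrib U_E
             del: mult_zero_right mult_1_right mult.left_neutral if_distrib)
  also have "\<dots> = 0"
    using assms by (simp only: comm_E \<delta>_E) auto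
  finally show ?thesis .
qed

lemma upt_split_pair:
  assumes "1 \<le> r" "Suc r \<le> m"
  shows "[1..<m + 1] = [1..<r] @ [r, Suc r] @ [Suc (Suc r)..<m + 1]"
proof -
  have "[1..<m + 1] = [1..<r] @ [r..<m + 1]"
    using assms upt_add_eq_append[of 1 r "m + 1 - r"] by simp
  also have "[r..<m + 1] = r # Suc r # [Suc (Suc r)..<m + 1]"
    using assms by (simp add: upt_conv_Cons)
  finally show ?thesis by simp
qed

text \<open>
  Pairing \<open>\<sigma>\<close> with \<open>\<sigma> \<circ> s\<close>, for the adjacent transposition \<open>s\<close>, exhibits \<open>2 D\<close> as a sum of products with a
  \<open>2 \<times> 2\<close> determinant in the columns \<open>r, r + 1\<close>, to which \<open>t_exchange\<close> applies.
\<close>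
lemma D_col_swap:
  assumes "m \<le> n" "1 \<le> r" "Suc r \<le> m"
    and \<alpha>: "\<alpha> ` {1..m} \<subseteq> {1..n}" and \<beta>: "\<beta> ` {1..m} \<subseteq> {1..n}"
  shows "D m \<alpha> (\<beta> \<circ> transpose r (Suc r)) u = - D m \<alpha> \<beta> u"
proof -
  let ?s = "transpose r (Suc r)"
  define P where "P \<beta> \<sigma> = prod_list (map (\<lambda>r. t (\<alpha> (\<sigma> r)) (\<beta> r) (u - of_nat (r - 1))) [1..<m + 1])"
    for \<beta> \<sigma>
  have s: "?s permutes {1..m}"
    by (rule permutes_swap_id) (use assms in auto)
  have D2: "D m \<alpha> \<beta> u + D m \<alpha> \<beta> u = (\<Sum>\<sigma> | \<sigma> permutes {1..m}. k (of_int (sign \<sigma>)) * (P \<beta> \<sigma> - P \<beta> (\<sigma> \<circ> ?s)))" for \<beta>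
  proof -
    have "D m \<alpha> \<beta> u = (\<Sum>\<sigma> | \<sigma> permutes {1..m}. k (of_int (sign (\<sigma> \<circ> ?s))) * P \<beta> (\<sigma> \<circ> ?s))"
      unfolding D_def P_def[symmetric]
      by (rule sum_permutations_compose_right[OF s, where f = "\<lambda>\<sigma>. k (of_int (sign \<sigma>)) * P \<beta> \<sigma>"])
    also have "\<dots> = - (\<Sum>\<sigma> | \<sigma> permutes {1..m}. k (of_int (sign \<sigma>)) * P \<beta> (\<sigma> \<circ> ?s))"
      unfolding sum_negf[symmetric]
      by (rule sum.cong) (use assms in \<open>auto simp: sign_swap k_uminus\<close>)
    finally have "D m \<alpha> \<beta> u = - (\<Sum>\<sigma> | \<sigma> permutes {1..m}. k (of_int (sign \<sigma>)) * P \<beta> (\<sigma> \<circ> ?s))" .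
    moreover have "D m \<alpha> \<beta> u = (\<Sum>\<sigma> | \<sigma> permutes {1..m}. k (of_int (sign \<sigma>)) * P \<beta> \<sigma>)"
      unfolding D_def P_def ..
    ultimately show ?thesis
      by (simp add: right_diff_distrib sum_subtractf)
  qed
  have key: "P \<beta> \<sigma> - P \<beta> (\<sigma> \<circ> ?s) + (P (\<beta> \<circ> ?s) \<sigma> - P (\<beta> \<circ> ?s) (\<sigma> \<circ> ?s)) = 0"
    if "\<sigma> permutes {1..m}" for \<sigma>
  proof -
    define A where "A = prod_list (map (\<lambda>r. t (\<alpha> (\<sigma> r)) (\<beta> r) (u - of_nat (r - 1))) [1..<r])"
    define B where "B = prod_list (map (\<lambda>r. t (\<alpha> (\<sigma> r)) (\<beta> r) (u - of_nat (r - 1))) [Suc (Suc r)..<m + 1])"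
    define v where "v = u - of_nat (r - 1)"
    have v: "u - of_nat r = v - 1" using assms by (simp add: v_def of_nat_diff)
    have fixes_s: "?s x = x" if "x \<in> set [1..<r] \<union> set [Suc (Suc r)..<m + 1]" for x
      using that by (auto simp: transpose_def)
    have A': "prod_list (map (\<lambda>r. t (\<alpha> (\<sigma>' r)) (\<beta>' r) (u - of_nat (r - 1))) [1..<r]) = A"
       and B': "prod_list (map (\<lambda>r. t (\<alpha> (\<sigma>' r)) (\<beta>' r) (u - of_nat (r - 1))) [Suc (Suc r)..<m + 1]) = B"
       if "\<sigma>' \<in> {\<sigma>, \<sigma> \<circ> ?s}" "\<beta>' \<in> {\<beta>, \<beta> \<circ> ?s}" for \<sigma>' \<beta>'
      unfolding A_def B_def
      by (rule arg_cong[where f = prod_list], rule map_cong[OF refl], use that fixes_s in force)+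
    have P: "P \<beta>' \<sigma>' = A * (t (\<alpha> (\<sigma>' r)) (\<beta>' r) v * t (\<alpha> (\<sigma>' (Suc r))) (\<beta>' (Suc r)) (v - 1)) * B"
      if "\<sigma>' \<in> {\<sigma>, \<sigma> \<circ> ?s}" "\<beta>' \<in> {\<beta>, \<beta> \<circ> ?s}" for \<sigma>' \<beta>'
      unfolding P_def upt_split_pair[OF assms(2,3)]
      by (simp only: map_append prod_list.append A'[OF that] B'[OF that] list.map prod_list.Cons
            prod_list.Nil mult_1_right diff_Suc_1 v v_def[symmetric] mult.assoc)
    have in_n: "\<alpha> (\<sigma> r) \<in> {1..n}" "\<alpha> (\<sigma> (Suc r)) \<in> {1..n}" "\<beta> r \<in> {1..n}" "\<beta> (Suc r) \<in> {1..n}"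
    proof -
      have "\<sigma> r \<in> {1..m}" "\<sigma> (Suc r) \<in> {1..m}"
        using permutes_in_image[OF that] assms by auto
      then show "\<alpha> (\<sigma> r) \<in> {1..n}" "\<alpha> (\<sigma> (Suc r)) \<in> {1..n}" "\<beta> r \<in> {1..n}" "\<beta> (Suc r) \<in> {1..n}"
        using \<alpha> \<beta> assms(2,3) by (simp_all only: image_subset_iff) auto
    qed
    let ?X1 = "t (\<alpha> (\<sigma> r)) (\<beta> r) v * t (\<alpha> (\<sigma> (Suc r))) (\<beta> (Suc r)) (v - 1)"
    let ?X2 = "t (\<alpha> (\<sigma> (Suc r))) (\<beta> r) v * t (\<alpha> (\<sigma> r)) (\<beta> (Suc r)) (v - 1)"
    let ?X3 = "t (\<alpha> (\<sigma> r)) (\<beta> (Suc r)) v * t (\<alpha> (\<sigma> (Suc r))) (\<beta> r) (v - 1)"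
    let ?X4 = "t (\<alpha> (\<sigma> (Suc r))) (\<beta> (Suc r)) v * t (\<alpha> (\<sigma> r)) (\<beta> r) (v - 1)"
    have "P \<beta> \<sigma> = A * ?X1 * B" "P \<beta> (\<sigma> \<circ> ?s) = A * ?X2 * B"
      "P (\<beta> \<circ> ?s) \<sigma> = A * ?X3 * B" "P (\<beta> \<circ> ?s) (\<sigma> \<circ> ?s) = A * ?X4 * B"
      by (subst P; simp only: o_apply transpose_apply_first transpose_apply_second insert_iff simp_thms)+
    then have "P \<beta> \<sigma> - P \<beta> (\<sigma> \<circ> ?s) + (P (\<beta> \<circ> ?s) \<sigma> - P (\<beta> \<circ> ?s) (\<sigma> \<circ> ?s))
      = A * (?X1 - ?X2 + ?X3 - ?X4) * B"
      by (simp only: right_diff_distrib left_diff_distrib distrib_left distrib_right add_diff_eq)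
    then show ?thesis by (simp only: t_exchange[OF in_n] mult_zero_left mult_zero_right)
  qed
  have "(D m \<alpha> \<beta> u + D m \<alpha> \<beta> u) + (D m \<alpha> (\<beta> \<circ> ?s) u + D m \<alpha> (\<beta> \<circ> ?s) u) = 0"
    unfolding D2 sum.distrib[symmetric] distrib_left[symmetric]
    by (rule sum.neutral) (use key in simp)
  then have "D m \<alpha> \<beta> u + D m \<alpha> (\<beta> \<circ> ?s) u = - (D m \<alpha> \<beta> u + D m \<alpha> (\<beta> \<circ> ?s) u)"
    by (simp add: algebra_simps eq_neg_iff_add_eq_0)
  from eq_uminus_imp_zero[OF this] show ?thesis
    by (simp add: eq_neg_iff_add_eq_0 add.commute)
qed

text \<open>Adjacent swaps bring the two equal columns next to each other.\<close>
lemma D_col_repeat: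
  assumes "m \<le> n" "i \<in> {1..m}" "j \<in> {1..m}" "i < j" "\<beta> i = \<beta> j"
    and \<alpha>: "\<alpha> ` {1..m} \<subseteq> {1..n}" and \<beta>: "\<beta> ` {1..m} \<subseteq> {1..n}"
  shows "D m \<alpha> \<beta> u = 0"
  using assms(2-5) \<beta>
proof (induction "j - Suc i" arbitrary: j \<beta>)
  case 0
  then have j: "j = Suc i" by simp
  have "\<beta> \<circ> transpose i j = \<beta>"
    using 0 by (auto simp: fun_eq_iff transpose_def)
  then have "D m \<alpha> \<beta> u = - D m \<alpha> \<beta> u"
    using D_col_swap[of m i \<alpha> \<beta> u] 0 j assms(1) \<alpha> by auto
  then show ?case by (rule eq_uminus_imp_zero)
next
  case (Suc d)
  obtain j' where j: "j = Suc j'" using Suc by (cases j) auto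
  let ?\<beta> = "\<beta> \<circ> transpose j' (Suc j')"
  have "D m \<alpha> ?\<beta> u = 0"
  proof (rule Suc.hyps(1))
    show "d = j' - Suc i" "j' \<in> {1..m}" "i < j'" using Suc j by auto
    show "?\<beta> i = ?\<beta> j'" using Suc j by (simp add: transpose_def)
    have "?\<beta> ` {1..m} = \<beta> ` (transpose j' (Suc j') ` {1..m})"
      by (simp add: image_comp)
    also have "transpose j' (Suc j') ` {1..m} = {1..m}"
      by (rule permutes_image[OF permutes_swap_id]) (use Suc j in auto)
    finally show "?\<beta> ` {1..m} \<subseteq> {1..n}" using Suc by simp
  qed (use Suc in auto)
  then show ?case
    using D_col_swap[of m j' \<alpha> \<beta> u] Suc j assms(1) \<alpha> by auto
qed

end

context gl_family begin

text \<open>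
  Bracketing with \<open>E p q\<close> is a derivation.  On each product in the determinant it replaces the row index \<open>q\<close> by
  \<open>p\<close>, and with the opposite sign the column index \<open>p\<close> by \<open>q\<close>.
\<close>
lemma comm_E_a_eq:
  assumes "p \<in> {1..n}" "q \<in> {1..n}" "m \<le> n"
  shows "comm (E p q) (a m u) =
    (if q \<le> m then D m (id(q := p)) id u else 0) - (if p \<le> m then D m id (id(p := q)) u else 0)"
proof -
  define z where "z r = u - of_nat (r - 1)" for r :: nat
  have m: "set [1..<m + 1] = {1..m}" by auto
  have key: "comm (E p q) (prod_list (map (\<lambda>r. t (\<sigma> r) r (z r)) [1..<m + 1]))
     = (if q \<le> m then prod_list (map (\<lambda>r. t ((id(q := p)) (\<sigma> r)) r (z r)) [1..<m + 1]) else 0)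
     - (if p \<le> m then prod_list (map (\<lambda>r. t (\<sigma> r) ((id(p := q)) r) (z r)) [1..<m + 1]) else 0)"
    if \<sigma>: "\<sigma> permutes {1..m}" for \<sigma>
  proof -
    define g where "g r = t (\<sigma> r) r (z r)" for r
    define Pq where "Pq = prod_list (map (\<lambda>r. t ((id(q := p)) (\<sigma> r)) r (z r)) [1..<m + 1])"
    define Pp where "Pp = prod_list (map (\<lambda>r. t (\<sigma> r) ((id(p := q)) r) (z r)) [1..<m + 1])"
    have inj: "\<sigma> r = \<sigma> s \<longleftrightarrow> r = s" for r s
      using permutes_inj[OF \<sigma>] by (auto simp: inj_def)
    have "prod_list (map (g(r := comm (E p q) (g r))) [1..<m + 1])
      = (if r = inv_into UNIV \<sigma> q then Pq else 0) - (if r = p then Pp else 0)" if r: "r \<in> {1..m}" for r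
    proof -
      have "\<sigma> r \<in> {1..m}" using permutes_in_image[OF \<sigma>] r by blast
      then have "comm (E p q) (g r) = (if q = \<sigma> r then t p r (z r) else 0) - (if p = r then t (\<sigma> r) q (z r) else 0)"
        unfolding g_def using assms r by (intro comm_E_t) auto
      then have "prod_list (map (g(r := comm (E p q) (g r))) [1..<m + 1])
        = prod_list (map (g(r := if q = \<sigma> r then t p r (z r) else 0)) [1..<m + 1])
        - prod_list (map (g(r := if p = r then t (\<sigma> r) q (z r) else 0)) [1..<m + 1])"
        using r by (simp only: prod_list_upd_diff distinct_upt m)
      also have "prod_list (map (g(r := if q = \<sigma> r then t p r (z r) else 0)) [1..<m + 1])
        = (if r = inv_into UNIV \<sigma> q then Pq else 0)"
      proof (cases "q = \<sigma> r")
        case True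
        then have "r = inv_into UNIV \<sigma> q" using permutes_inverses[OF \<sigma>] by simp
        moreover have "map (g(r := t p r (z r))) [1..<m + 1] = map (\<lambda>r. t ((id(q := p)) (\<sigma> r)) r (z r)) [1..<m + 1]"
          by (rule map_cong) (use True in \<open>auto simp: g_def inj\<close>)
        ultimately show ?thesis using True by (simp only: Pq_def if_True simp_thms)
      next
        case False
        then have "r \<noteq> inv_into UNIV \<sigma> q" using permutes_inverses[OF \<sigma>] by auto
        moreover have "prod_list (map (g(r := 0)) [1..<m + 1]) = 0"
          by (rule prod_list_upd_zero) (use r in auto)
        ultimately show ?thesis using False by (simp only: if_False simp_thms)
      qed
      also have "prod_list (map (g(r := if p = r then t (\<sigma> r) q (z r) else 0)) [1..<m + 1])
        = (if r = p then Pp else 0)"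
      proof (cases "p = r")
        case True
        then have "map (g(r := t (\<sigma> r) q (z r))) [1..<m + 1] = map (\<lambda>r. t (\<sigma> r) ((id(p := q)) r) (z r)) [1..<m + 1]"
          by (intro map_cong) (auto simp: g_def)
        then show ?thesis using True by (simp only: Pp_def if_True simp_thms)
      next
        case False
        have "prod_list (map (g(r := 0)) [1..<m + 1]) = 0"
          by (rule prod_list_upd_zero) (use r in auto)
        then show ?thesis using False by (simp only: if_False simp_thms) auto
      qed
      finally show ?thesis .
    qed
    then have "comm (E p q) (prod_list (map g [1..<m + 1]))
      = (\<Sum>r=1..m. (if r = inv_into UNIV \<sigma> q then Pq else 0) - (if r = p then Pp else 0))"
      by (simp only: comm_prod_list distinct_upt m cong: sum.cong)
    also have "\<dots> = (if inv_into UNIV \<sigma> q \<in> {1..m} then Pq else 0) - (if p \<in> {1..m} then Pp else 0)"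
      by (simp add: sum_subtractf sum.delta)
    also have "inv_into UNIV \<sigma> q \<in> {1..m} \<longleftrightarrow> q \<le> m"
      using permutes_in_image[OF permutes_inv[OF \<sigma>], of q] assms by auto
    finally show ?thesis
      using assms by (simp add: Pq_def Pp_def g_def del: upt_Suc)
  qed
  have "comm (E p q) (a m u) = (\<Sum>\<sigma> | \<sigma> permutes {1..m}. k (of_int (sign \<sigma>)) *
     comm (E p q) (prod_list (map (\<lambda>r. t (\<sigma> r) r (z r)) [1..<m + 1])))"
    using assms by (simp only: a_def D_def z_def comm_sum_right comm_mult_right comm_E_k id_apply
        mult_zero_left add_0)
  also have "\<dots> = (\<Sum>\<sigma> | \<sigma> permutes {1..m}. k (of_int (sign \<sigma>)) *
     ((if q \<le> m then prod_list (map (\<lambda>r. t ((id(q := p)) (\<sigma> r)) r (z r)) [1..<m + 1]) else 0)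
     - (if p \<le> m then prod_list (map (\<lambda>r. t (\<sigma> r) ((id(p := q)) r) (z r)) [1..<m + 1]) else 0)))"
    by (rule sum.cong) (simp_all only: key mem_Collect_eq)
  also have "\<dots> = (if q \<le> m then D m (id(q := p)) id u else 0) - (if p \<le> m then D m id (id(p := q)) u else 0)"
    by (simp add: D_def z_def right_diff_distrib sum_subtractf del: upt_Suc fun_upd_apply)
  finally show ?thesis .
qed

text \<open>The replacements inside the index range repeat a row or a column, unless \<open>p = q\<close>, when they cancel.\<close>
lemma comm_E_a_zero:
  assumes "m \<le> n" "p \<in> {1..m}" "q \<in> {1..m}"
  shows "comm (E p q) (a m u) = 0"
proof (cases "p = q")
  case True
  then have "id(q := p) = id" "id(p := q) = id" by auto
  then show ?thesis using assms by (subst comm_E_a_eq) auto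
next
  case False
  have "D m (id(q := p)) id u = 0"
    by (rule D_row_repeat[of p m q]) (use assms False in auto)
  moreover have "D m id (id(p := q)) u = 0"
  proof (rule D_col_repeat[of m "min p q" "max p q"])
    show "(id(p := q)) ` {1..m} \<subseteq> {1..n}" using assms by auto
  qed (use assms False in \<open>auto simp: min_def max_def\<close>)
  ultimately show ?thesis using assms by (subst comm_E_a_eq) auto
qed

text \<open>
  A permutation of \<open>{1..m + 1}\<close> is \<open>(m + 1 i) \<circ> q\<close> for a unique \<open>i\<close> and a unique permutation \<open>q\<close> of \<open>{1..m}\<close>.
  The factor of the last column is \<open>t i (\<beta> (m + 1))\<close>, and what remains is the determinant \<open>D m\<close> in which \<open>m + 1\<close>
  takes the place of the row \<open>i\<close>.
\<close>
lemma D_last_column: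
  shows "D (Suc m) id \<beta> u = D m id \<beta> u * t (Suc m) (\<beta> (Suc m)) (u - of_nat m)
    - (\<Sum>i=1..m. D m (id(i := Suc m)) \<beta> u * t i (\<beta> (Suc m)) (u - of_nat m))"
proof -
  define z where "z r = u - of_nat (r - 1)" for r :: nat
  define f where "f \<sigma> = k (of_int (sign \<sigma>)) *
     prod_list (map (\<lambda>r. t (\<sigma> r) (\<beta> r) (z r)) [1..<Suc m + 1])" for \<sigma>
  have f: "f (transpose (Suc m) i \<circ> q) =
      (if i = Suc m then 1 else - 1) * (k (of_int (sign q)) *
       prod_list (map (\<lambda>r. t ((id(i := Suc m)) (q r)) (\<beta> r) (z r)) [1..<m + 1]) * t i (\<beta> (Suc m)) (z (Suc m)))"
    if q: "q permutes {1..m}" and i: "i \<in> {1..Suc m}" for i q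
  proof -
    have qm: "q (Suc m) = Suc m" using q by (auto simp: permutes_def)
    have "q permutes {1..Suc m}" using q by (rule permutes_subset) auto
    then have sgn: "sign (transpose (Suc m) i \<circ> q) = (if i = Suc m then 1 else - 1) * sign q"
      using sign_swap(1)[of q "Suc m" "Suc m" i] i by auto
    have map: "map (\<lambda>r. t (transpose (Suc m) i (q r)) (\<beta> r) (z r)) [1..<m + 1]
       = map (\<lambda>r. t ((id(i := Suc m)) (q r)) (\<beta> r) (z r)) [1..<m + 1]"
    proof (rule map_cong)
      fix r assume "r \<in> set [1..<m + 1]"
      then have "q r \<in> {1..m}" using permutes_in_image[OF q, of r] by auto
      then show "t (transpose (Suc m) i (q r)) (\<beta> r) (z r) = t ((id(i := Suc m)) (q r)) (\<beta> r) (z r)"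
        by (auto simp: transpose_def)
    qed simp
    have "[1..<Suc m + 1] = [1..<m + 1] @ [Suc m]" by simp
    then have "f (transpose (Suc m) i \<circ> q) = k (of_int (sign (transpose (Suc m) i \<circ> q))) *
       (prod_list (map (\<lambda>r. t ((id(i := Suc m)) (q r)) (\<beta> r) (z r)) [1..<m + 1]) * t i (\<beta> (Suc m)) (z (Suc m)))"
      unfolding f_def by (simp only: map_append prod_list.append map list.map prod_list.Cons
          prod_list.Nil mult_1_right o_apply qm transpose_apply_first)
    then show ?thesis
      by (simp add: sgn k_uminus mult.assoc del: upt_Suc fun_upd_apply)
  qed
  have "{1..Suc m} = insert (Suc m) {1..m}" by auto
  then have "D (Suc m) id \<beta> u = (\<Sum>i=1..Suc m. \<Sum>q | q permutes {1..m}. f (transpose (Suc m) i \<circ> q))"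
    using sum_over_permutations_insert[of "{1..m}" "Suc m" f] by (simp add: D_def f_def z_def del: upt_Suc)
  also have "\<dots> = (\<Sum>i=1..Suc m. (if i = Suc m then 1 else - 1) *
      (D m (id(i := Suc m)) \<beta> u * t i (\<beta> (Suc m)) (z (Suc m))))"
    by (intro sum.cong refl) (simp add: f D_def z_def sum_distrib_left sum_distrib_right del: upt_Suc fun_upd_apply)
  also have "\<dots> = D m (id(Suc m := Suc m)) \<beta> u * t (Suc m) (\<beta> (Suc m)) (u - of_nat m)
     + (\<Sum>i=1..m. (if i = Suc m then 1 else - 1) * (D m (id(i := Suc m)) \<beta> u * t i (\<beta> (Suc m)) (u - of_nat m)))"
    by (simp add: z_def del: fun_upd_apply)
  also have "id(Suc m := Suc m) = id" by auto
  also have "(\<Sum>i=1..m. (if i = Suc m then 1 else - 1) * (D m (id(i := Suc m)) \<beta> u * t i (\<beta> (Suc m)) (u - of_nat m)))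
     = - (\<Sum>i=1..m. D m (id(i := Suc m)) \<beta> u * t i (\<beta> (Suc m)) (u - of_nat m))"
    unfolding sum_negf[symmetric] by (rule sum.cong) auto
  finally show ?thesis by (simp only: add_uminus_conv_diff)
qed

text \<open>Elements built from \<open>gl\<^sub>m\<close> and scalars commute with everything that centralizes \<open>gl\<^sub>m\<close>.\<close>
definition centralizes :: "nat \<Rightarrow> 'r \<Rightarrow> bool" where
  "centralizes m x \<longleftrightarrow> (\<forall>z. comm x (k z) = 0) \<and> (\<forall>i\<in>{1..m}. \<forall>j\<in>{1..m}. comm x (E i j) = 0)"

lemma centralizes_mono: "centralizes m x \<Longrightarrow> l \<le> m \<Longrightarrow> centralizes l x"
  by (auto simp: centralizes_def)

lemma centralizes_k: "centralizes n (k z)"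
  by (auto simp: centralizes_def k_E)

lemma centralizes_E:
  "\<lbrakk>p \<in> {1..n}; q \<in> {1..n}; m \<le> n; m < p; m < q\<rbrakk> \<Longrightarrow> centralizes m (E p q)"
  by (auto simp: centralizes_def comm_E comm_E_k)

lemma centralizes_comm:
  assumes "centralizes m x" "centralizes m y"
  shows "centralizes m (comm x y)"
proof -
  have "comm (comm x y) w = comm x (comm y w) - comm y (comm x w)" for w
    by (simp add: comm_jacobi[of x y w])
  then show ?thesis using assms by (simp add: centralizes_def)
qed

lemma comm_D_zero:
  assumes "centralizes m x" "l \<le> m" "\<alpha> ` {1..l} \<subseteq> {1..m}" "\<beta> ` {1..l} \<subseteq> {1..m}"
  shows "comm x (D l \<alpha> \<beta> u) = 0"
proof -
  have "comm x (t (\<alpha> (\<sigma> r)) (\<beta> r) z) = 0" if "\<sigma> permutes {1..l}" "r \<in> {1..l}" for \<sigma> r z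
  proof -
    have "\<sigma> r \<in> {1..l}" using permutes_in_image[OF that(1)] that(2) by blast
    then have "\<alpha> (\<sigma> r) \<in> {1..m}" "\<beta> r \<in> {1..m}" using assms that by blast+
    then show ?thesis using assms(1) by (auto simp: centralizes_def t_def comm_add_right)
  qed
  then have "comm x (prod_list (map (\<lambda>r. t (\<alpha> (\<sigma> r)) (\<beta> r) (u - of_nat (r - 1))) [1..<l + 1])) = 0"
    if "\<sigma> permutes {1..l}" for \<sigma>
    using that by (intro comm_prod_list_eq_0) auto
  then show ?thesis
    using assms(1) unfolding D_def centralizes_def
    by (simp add: comm_sum_right comm_mult_right del: upt_Suc)
qed

lemma comm_a_zero: "centralizes m x \<Longrightarrow> l \<le> m \<Longrightarrow> comm x (a l u) = 0"
  unfolding a_def by (rule comm_D_zero) auto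

lemma centralizes_a: "m \<le> n \<Longrightarrow> centralizes m (a m u)"
  using comm_a_zero[OF centralizes_k] comm_E_a_zero
  by (auto simp: centralizes_def intro: comm_eq_0_swap)

lemma comm_a_a:
  assumes "l \<le> n" "m \<le> n"
  shows "comm (a l x) (a m y) = 0"
proof (cases "l \<le> m")
  case True
  then show ?thesis using comm_a_zero[OF centralizes_a] assms comm_eq_0_swap by blast
next
  case False
  then show ?thesis using comm_a_zero[OF centralizes_a] assms by simp
qed

section \<open>Operator-valued polynomials\<close>

text \<open>
  \<open>f\<close> is a polynomial of degree at most \<open>d\<close> whose coefficients commute with scalars, and \<open>e\<close> is the coefficient of
  degree \<open>d\<close> (possibly \<open>0\<close>).  Recording \<open>d\<close> and \<open>e\<close> is enough to cancel matrices and to interpolate.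
\<close>
definition polytop :: "nat \<Rightarrow> 'r \<Rightarrow> (complex \<Rightarrow> 'r) \<Rightarrow> bool" where
  "polytop d e f \<longleftrightarrow> (\<exists>c. (\<forall>p z. comm (k z) (c p) = 0) \<and> c d = e \<and>
     (\<forall>z. f z = (\<Sum>p\<le>d. k (z ^ p) * c p)))"

lemma polytop_interpolation:
  assumes "finite I" "\<And>p. p \<le> d \<Longrightarrow> (\<Sum>i\<in>I. w i * x i ^ p) = (if p = d then 1 else 0)"
    and "polytop d e f"
  shows "e = (\<Sum>i\<in>I. k (w i) * f (x i))"
proof -
  have k_sum: "k (sum g I) = (\<Sum>i\<in>I. k (g i))" for g
    using assms(1) by (induction I rule: finite_induct) (simp_all add: k_add)
  obtain c where c: "c d = e" "\<And>z. f z = (\<Sum>p\<le>d. k (z ^ p) * c p)"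
    using assms(3) unfolding polytop_def by blast
  have "(\<Sum>i\<in>I. k (w i) * f (x i)) = (\<Sum>p\<le>d. \<Sum>i\<in>I. k (w i * x i ^ p) * c p)"
    unfolding c(2) sum_distrib_left by (subst sum.swap) (simp add: k_mult mult.assoc)
  also have "\<dots> = (\<Sum>p\<le>d. k (\<Sum>i\<in>I. w i * x i ^ p) * c p)"
    by (simp add: k_sum sum_distrib_right)
  also have "\<dots> = (\<Sum>p\<le>d. if p = d then e else 0)"
    by (rule sum.cong) (auto simp: assms(2) c(1))
  also have "\<dots> = e" by simp
  finally show ?thesis by simp
qed

lemma polytop_unique:
  assumes "polytop d e f" "polytop d e' f"
  shows "e = e'"
proof -
  obtain w where w: "\<forall>p<card {..d}. (\<Sum>i\<in>{..d}. w i * of_nat i ^ p) = (if p = card {..d} - 1 then 1 else (0::complex))"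
    using top_coeff_functional[of "{..d}" of_nat] by (auto simp: inj_on_def)
  have w': "(\<Sum>i\<in>{..d}. w i * of_nat i ^ p) = (if p = d then 1 else 0)" if "p \<le> d" for p
    using w that by simp
  show ?thesis
    using polytop_interpolation[OF _ w' assms(1)] polytop_interpolation[OF _ w' assms(2)] by simp
qed

lemma polytop_const: "(\<And>z. comm (k z) r = 0) \<Longrightarrow> polytop 0 r (\<lambda>_. r)"
  unfolding polytop_def by (rule exI[of _ "\<lambda>_. r"]) simp

lemma polytop_zero: "polytop d 0 (\<lambda>_. 0)"
  unfolding polytop_def by (rule exI[of _ "\<lambda>_. 0"]) simp

lemma polytop_add:
  assumes "polytop d e f" "polytop d e' g"
  shows "polytop d (e + e') (\<lambda>z. f z + g z)"
proof -
  obtain c c' where "\<forall>p z. comm (k z) (c p) = 0" "c d = e" "\<And>z. f z = (\<Sum>p\<le>d. k (z ^ p) * c p)"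
    "\<forall>p z. comm (k z) (c' p) = 0" "c' d = e'" "\<And>z. g z = (\<Sum>p\<le>d. k (z ^ p) * c' p)"
    using assms unfolding polytop_def by blast
  then show ?thesis unfolding polytop_def
    by (intro exI[of _ "\<lambda>p. c p + c' p"]) (simp add: comm_add_right distrib_left sum.distrib)
qed

lemma polytop_mult_left:
  assumes "polytop d e f" "\<And>z. comm (k z) r = 0"
  shows "polytop d (r * e) (\<lambda>z. r * f z)"
proof -
  obtain c where "\<forall>p z. comm (k z) (c p) = 0" "c d = e" "\<And>z. f z = (\<Sum>p\<le>d. k (z ^ p) * c p)"
    using assms unfolding polytop_def by blast
  moreover have "r * (k z * y) = k z * (r * y)" for z y
    using comm_eq_0D[OF assms(2)] by (metis mult.assoc)
  ultimately show ?thesis unfolding polytop_def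
    by (intro exI[of _ "\<lambda>p. r * c p"]) (simp add: comm_mult_right assms(2) sum_distrib_left)
qed

lemma polytop_mult_right:
  assumes "polytop d e f" "\<And>z. comm (k z) r = 0"
  shows "polytop d (e * r) (\<lambda>z. f z * r)"
proof -
  obtain c where "\<forall>p z. comm (k z) (c p) = 0" "c d = e" "\<And>z. f z = (\<Sum>p\<le>d. k (z ^ p) * c p)"
    using assms unfolding polytop_def by blast
  then show ?thesis unfolding polytop_def
    by (intro exI[of _ "\<lambda>p. c p * r"]) (simp add: comm_mult_right assms(2) sum_distrib_right mult.assoc)
qed

lemma polytop_uminus: "polytop d e f \<Longrightarrow> polytop d (- e) (\<lambda>z. - f z)"
  using polytop_mult_left[of d e f "- 1"] by (simp add: comm_uminus_right)

lemma polytop_diff: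
  "polytop d e f \<Longrightarrow> polytop d e' g \<Longrightarrow> polytop d (e - e') (\<lambda>z. f z - g z)"
  using polytop_add[OF _ polytop_uminus] by fastforce

lemma polytop_sum:
  "finite A \<Longrightarrow> (\<And>i. i \<in> A \<Longrightarrow> polytop d (e i) (f i)) \<Longrightarrow> polytop d (\<Sum>i\<in>A. e i) (\<lambda>z. \<Sum>i\<in>A. f i z)"
  by (induction A rule: finite_induct) (auto intro: polytop_zero polytop_add)

lemma polytop_Suc:
  assumes "polytop d e f"
  shows "polytop (Suc d) 0 f"
proof -
  obtain c where "\<forall>p z. comm (k z) (c p) = 0" "\<And>z. f z = (\<Sum>p\<le>d. k (z ^ p) * c p)"
    using assms unfolding polytop_def by blast
  then show ?thesis unfolding polytop_def
    by (intro exI[of _ "\<lambda>p. if p \<le> d then c p else 0"]) simp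
qed

lemma polytop_mult_var:
  assumes "polytop d e f"
  shows "polytop (Suc d) e (\<lambda>z. k z * f z)"
proof -
  obtain c where "\<forall>p z. comm (k z) (c p) = 0" "c d = e" "\<And>z. f z = (\<Sum>p\<le>d. k (z ^ p) * c p)"
    using assms unfolding polytop_def by blast
  then show ?thesis unfolding polytop_def
    by (intro exI[of _ "\<lambda>p. case p of 0 \<Rightarrow> 0 | Suc q \<Rightarrow> c q"])
       (auto simp: sum.atMost_Suc_shift sum_distrib_left k_mult mult.assoc simp del: sum.atMost_Suc split: nat.split)
qed

lemma polytop_drop:
  assumes "polytop (Suc d) 0 f"
  shows "\<exists>e. polytop d e f"
proof -
  obtain c where "\<forall>p z. comm (k z) (c p) = 0" "c (Suc d) = 0" "\<And>z. f z = (\<Sum>p\<le>Suc d. k (z ^ p) * c p)"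
    using assms unfolding polytop_def by blast
  then show ?thesis unfolding polytop_def
    by (intro exI[of _ "c d"] exI[of _ c]) simp
qed

lemma polytop_commute: "polytop d e f \<Longrightarrow> comm (k x) (f z) = 0"
  unfolding polytop_def by (auto simp: comm_sum_right comm_mult_right)

lemma polytop_mult_shift:
  assumes "polytop d e f"
  shows "polytop (Suc d) e (\<lambda>z. k (z - z0) * f z)"
proof -
  have "polytop (Suc d) (e - 0) (\<lambda>z. k z * f z - k z0 * f z)"
    by (intro polytop_diff polytop_mult_var assms polytop_Suc[OF polytop_mult_left[OF assms]]) simp
  then show ?thesis by (simp add: k_diff left_diff_distrib)
qed

text \<open>The matrix \<open>t\<close> is monic in its parameter, so the top coefficients of a row are passed on unchanged.\<close>
lemma polytop_row_times_t:
  assumes "m \<le> n" "\<And>s. s \<in> {1..m} \<Longrightarrow> polytop d (e s) (N s)" "j \<in> {1..m}"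
  shows "polytop (Suc d) (e j) (\<lambda>z. \<Sum>s=1..m. N s z * t s j (z - z0))"
proof -
  have "polytop (Suc d) (if s = j then e j else 0) (\<lambda>z. N s z * t s j (z - z0))" if s: "s \<in> {1..m}" for s
  proof -
    have *: "polytop (Suc d) 0 (\<lambda>z. N s z * E s j)"
      by (rule polytop_Suc[OF polytop_mult_right[OF assms(2)]]) (use s assms in \<open>auto simp: k_E\<close>)
    show ?thesis
    proof (cases "s = j")
      case True
      have "polytop (Suc d) (e j + 0) (\<lambda>z. k (z - z0) * N s z + N s z * E s j)"
        using polytop_mult_shift[OF assms(2)] s True by (intro polytop_add *) auto
      moreover have "k x * N s z = N s z * k x" for x z
        using polytop_commute[OF assms(2)] s by (intro comm_eq_0D) auto
      ultimately show ?thesis using True by (simp add: t_def distrib_left)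
    next
      case False
      then show ?thesis using * by (simp add: t_def)
    qed
  qed
  then have "polytop (Suc d) (\<Sum>s=1..m. if s = j then e j else 0) (\<lambda>z. \<Sum>s=1..m. N s z * t s j (z - z0))"
    by (intro polytop_sum) auto
  then show ?thesis using assms(3) by simp
qed

definition is_poly :: "(complex \<Rightarrow> 'r) \<Rightarrow> bool" where
  "is_poly f \<longleftrightarrow> (\<exists>d e. polytop d e f)"

lemma polytop_raise:
  assumes "polytop d e f" "d \<le> d'"
  shows "\<exists>e. polytop d' e f"
  using assms(2,1) by (induction d' rule: dec_induct) (auto intro: polytop_Suc)

lemma is_poly_common_degree:
  assumes "finite A" "\<And>s. s \<in> A \<Longrightarrow> is_poly (N s)"
  shows "\<exists>d. \<forall>s\<in>A. \<exists>e. polytop d e (N s)"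
  using assms
proof (induction A rule: finite_induct)
  case (insert s A)
  then obtain d d' e' where "\<forall>s\<in>A. \<exists>e. polytop d e (N s)" "polytop d' e' (N s)"
    unfolding is_poly_def by blast
  then show ?case
    by (intro exI[of _ "max d d'"]) (metis insertE max.cobounded1 max.cobounded2 polytop_raise)
qed simp

text \<open>
  If the product vanishes then so do the top coefficients of \<open>N\<close>, by \<open>polytop_row_times_t\<close> and uniqueness of the top coefficient;
  the degree drops until nothing is left.
\<close>
lemma row_cancel:
  assumes "m \<le> n" "\<And>s. s \<in> {1..m} \<Longrightarrow> is_poly (N s)"
    and zero: "\<And>z j. j \<in> {1..m} \<Longrightarrow> (\<Sum>s=1..m. N s z * t s j (z - z0)) = 0"
    and s: "s \<in> {1..m}"
  shows "N s z = 0"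
proof -
  obtain d where "\<forall>s\<in>{1..m}. \<exists>e. polytop d e (N s)"
    using is_poly_common_degree[of "{1..m}" N] assms(2) by auto
  then have "\<forall>s\<in>{1..m}. \<forall>z. N s z = 0"
  proof (induction d)
    case 0
    then obtain e where e: "\<And>s. s \<in> {1..m} \<Longrightarrow> polytop 0 (e s) (N s)" by metis
    have "e j = 0" if "j \<in> {1..m}" for j
      using polytop_row_times_t[of m 0 e N j z0, OF assms(1) e that]
      unfolding zero[OF that] by (rule polytop_unique[OF _ polytop_zero])
    moreover have "N s z = e s" if "s \<in> {1..m}" for s z
      using e[OF that] unfolding polytop_def by (elim exE conjE) (simp del: One_nat_def)
    ultimately show ?case by simp
  next
    case (Suc d)
    then obtain e where e: "\<And>s. s \<in> {1..m} \<Longrightarrow> polytop (Suc d) (e s) (N s)" by metis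
    have "e j = 0" if "j \<in> {1..m}" for j
      using polytop_row_times_t[of m "Suc d" e N j z0, OF assms(1) e that]
      unfolding zero[OF that] by (rule polytop_unique[OF _ polytop_zero])
    then have "\<forall>s\<in>{1..m}. \<exists>e. polytop d e (N s)"
      by (intro ballI polytop_drop) (use e in metis)
    then show ?case by (rule Suc.IH)
  qed
  then show ?thesis using s by blast
qed

lemma is_poly_add: "is_poly f \<Longrightarrow> is_poly g \<Longrightarrow> is_poly (\<lambda>z. f z + g z)"
proof -
  assume "is_poly f" "is_poly g"
  then obtain d where "\<forall>h\<in>{f, g}. \<exists>e. polytop d e h"
    using is_poly_common_degree[of "{f, g}" "\<lambda>h. h"] by auto
  then show ?thesis unfolding is_poly_def by (auto dest: polytop_add)
qed

lemma is_poly_mult_left: "is_poly f \<Longrightarrow> (\<And>z. comm (k z) r = 0) \<Longrightarrow> is_poly (\<lambda>z. r * f z)"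
  unfolding is_poly_def using polytop_mult_left by blast

lemma is_poly_mult_right: "is_poly f \<Longrightarrow> (\<And>z. comm (k z) r = 0) \<Longrightarrow> is_poly (\<lambda>z. f z * r)"
  unfolding is_poly_def using polytop_mult_right by blast

lemma is_poly_uminus: "is_poly f \<Longrightarrow> is_poly (\<lambda>z. - f z)"
  unfolding is_poly_def using polytop_uminus by blast

lemma is_poly_diff: "is_poly f \<Longrightarrow> is_poly g \<Longrightarrow> is_poly (\<lambda>z. f z - g z)"
  using is_poly_add[OF _ is_poly_uminus] by fastforce

lemma is_poly_zero: "is_poly (\<lambda>_. 0)"
  unfolding is_poly_def using polytop_zero by blast

lemma is_poly_sum: "(\<And>i. i \<in> A \<Longrightarrow> is_poly (f i)) \<Longrightarrow> is_poly (\<lambda>z. \<Sum>i\<in>A. f i z)"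
  by (induction A rule: infinite_finite_induct) (auto intro: is_poly_zero is_poly_add)

lemma is_poly_comm: "is_poly f \<Longrightarrow> (\<And>z. comm (k z) r = 0) \<Longrightarrow> is_poly (\<lambda>z. comm r (f z))"
  unfolding comm_def by (intro is_poly_diff is_poly_mult_left is_poly_mult_right) (auto simp: comm_def)

lemma is_poly_t_times:
  assumes "is_poly f" "i \<in> {1..n}" "j \<in> {1..n}"
  shows "is_poly (\<lambda>z. t i j (z - z0) * f z)"
proof -
  have "is_poly (\<lambda>z. E i j * f z)"
    using assms by (intro is_poly_mult_left) (auto simp: k_E)
  moreover have "is_poly (\<lambda>z. k (z - z0) * f z)"
    using assms(1) polytop_mult_shift unfolding is_poly_def by blast
  ultimately show ?thesis
    by (cases "i = j") (auto simp: t_def distrib_right intro: is_poly_add)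
qed

lemma polytop_D:
  assumes "m \<le> n"
  shows "\<exists>e. polytop m e (D m id id)"
proof -
  have "\<exists>e. polytop (length xs) e (\<lambda>z. prod_list (map (\<lambda>r. t (\<alpha> r) r (z - s r)) xs))"
    if "\<And>r. r \<in> set xs \<Longrightarrow> r \<in> {1..n} \<and> \<alpha> r \<in> {1..n}" for xs and \<alpha> :: "nat \<Rightarrow> nat" and s
    using that
  proof (induction xs)
    case Nil
    then show ?case using polytop_const[of 1] by auto
  next
    case (Cons r xs)
    then obtain e where e: "polytop (length xs) e (\<lambda>z. prod_list (map (\<lambda>r. t (\<alpha> r) r (z - s r)) xs))"
      by auto
    have "polytop (Suc (length xs)) 0 (\<lambda>z. E (\<alpha> r) r * prod_list (map (\<lambda>r. t (\<alpha> r) r (z - s r)) xs))"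
      by (rule polytop_Suc[OF polytop_mult_left[OF e]]) (use Cons.prems in \<open>auto simp: k_E\<close>)
    moreover note polytop_mult_shift[OF e, of "s r"]
    ultimately show ?case
      by (cases "\<alpha> r = r") (auto simp: t_def distrib_right dest: polytop_add)
  qed
  note prod = this
  have "\<exists>e. polytop m e (\<lambda>u. k (of_int (sign \<sigma>)) *
     prod_list (map (\<lambda>r. t (\<sigma> r) r (u - of_nat (r - 1))) [1..<m + 1]))"
    if \<sigma>: "\<sigma> permutes {1..m}" for \<sigma>
  proof -
    have *: "r \<in> {1..n} \<and> \<sigma> r \<in> {1..n}" if "r \<in> set [1..<m + 1]" for r
      using permutes_in_image[OF \<sigma>, of r] that assms by auto
    have "length [1..<m + 1] = m" by simp
    then obtain e where "polytop m e (\<lambda>z. prod_list (map (\<lambda>r. t (\<sigma> r) r (z - of_nat (r - 1))) [1..<m + 1]))"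
      using prod[of "[1..<m + 1]" \<sigma> "\<lambda>r. of_nat (r - 1)", OF *] by (metis (no_types))
    from polytop_mult_left[OF this comm_k_k] show ?thesis by (rule exI)
  qed
  then have "\<forall>\<sigma>\<in>{\<sigma>. \<sigma> permutes {1..m}}. \<exists>e. polytop m e (\<lambda>u. k (of_int (sign \<sigma>)) *
     prod_list (map (\<lambda>r. t (\<sigma> r) r (u - of_nat (r - 1))) [1..<m + 1]))"
    by blast
  then obtain e where "\<forall>\<sigma>\<in>{\<sigma>. \<sigma> permutes {1..m}}. polytop m (e \<sigma>) (\<lambda>u. k (of_int (sign \<sigma>)) *
     prod_list (map (\<lambda>r. t (\<sigma> r) r (u - of_nat (r - 1))) [1..<m + 1]))"
    unfolding bchoice_iff by (elim exE)
  then have "polytop m (\<Sum>\<sigma> | \<sigma> permutes {1..m}. e \<sigma>) (\<lambda>u. \<Sum>\<sigma> | \<sigma> permutes {1..m}. k (of_int (sign \<sigma>)) *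
     prod_list (map (\<lambda>r. t (\<sigma> r) r (u - of_nat (r - 1))) [1..<m + 1]))"
    by (intro polytop_sum) (simp_all add: finite_permutations del: upt_Suc)
  then show ?thesis
    unfolding D_def id_apply by (rule exI)
qed

end


section \<open>The adjugate matrix\<close>

text \<open>Rewriting \<open>1\<close> to \<open>Suc 0\<close> would hide the index sets \<open>{1..m}\<close> from the equations below.\<close>

declare One_nat_def [simp del]

context gl_family begin

lemma polytop_a_ex: "m \<le> n \<Longrightarrow> \<exists>e. polytop m e (a m)"
  unfolding a_def by (rule polytop_D)

lemma is_poly_a: "m \<le> n \<Longrightarrow> is_poly (a m)"
  using polytop_a_ex unfolding is_poly_def by blast

text \<open>The parameter of the last factor of the column determinant \<open>a m u\<close> is \<open>u - (m - 1)\<close>.\<close>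
definition T :: "nat \<Rightarrow> nat \<Rightarrow> nat \<Rightarrow> complex \<Rightarrow> 'r" where
  "T m i j u = t i j (u - of_nat (m - 1))"

lemma comm_E_T:
  "\<lbrakk>p \<in> {1..n}; q \<in> {1..n}; i \<in> {1..n}; j \<in> {1..n}\<rbrakk> \<Longrightarrow>
    comm (E p q) (T m i j z) = (if q = i then T m p j z else 0) - (if p = j then T m i q z else 0)"
  unfolding T_def by (rule comm_E_t)

lemma T_shift: "T m i j y = T m i j x + (if i = j then k (y - x) else 0)"
  by (simp add: T_def t_def k_diff)

lemma t_shift_eq: "t i j x = t i j y + (if i = j then k (x - y) else 0)"
  by (simp add: t_def k_diff)

lemma T_off_diagonal: "i \<noteq> j \<Longrightarrow> T m i j x = E i j"
  by (simp add: T_def t_def)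

lemma is_poly_T_times:
  "is_poly f \<Longrightarrow> i \<in> {1..n} \<Longrightarrow> j \<in> {1..n} \<Longrightarrow> is_poly (\<lambda>z. T m i j z * f z)"
  unfolding T_def by (rule is_poly_t_times)

lemma row_cancel_T:
  assumes "m \<le> n" "\<And>s. s \<in> {1..m} \<Longrightarrow> is_poly (N s)"
    and "\<And>z j. j \<in> {1..m} \<Longrightarrow> (\<Sum>s=1..m. N s z * T m s j z) = 0"
    and "s \<in> {1..m}"
  shows "N s z = 0"
  by (rule row_cancel[of m N "of_nat (m - 1)"]) (use assms in \<open>auto simp: T_def\<close>)

text \<open>
  The cofactors of the last column of the determinant \<open>a m\<close>: replacing a row of \<open>a (m - 1)\<close> by \<open>m\<close> is, up to sign,
  bracketing with \<open>E m s\<close>.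
\<close>
definition adj_row :: "nat \<Rightarrow> nat \<Rightarrow> complex \<Rightarrow> 'r" where
  "adj_row m s u = (if s = m then a (m - 1) u else comm (a (m - 1) u) (E m s))"

text \<open>
  The other rows of the adjugate are obtained from the last one by the action of \<open>E i m\<close>, which avoids further
  signs of permutations.
\<close>
definition adj :: "nat \<Rightarrow> nat \<Rightarrow> nat \<Rightarrow> complex \<Rightarrow> 'r" where
  "adj m i s u = comm (E i m) (adj_row m s u) + (if i = s then a (m - 1) u else 0)"

lemma comm_adj_row_zero:
  assumes "centralizes m x" "1 \<le> m" "s \<in> {1..m}"
  shows "comm x (adj_row m s u) = 0"
proof -
  have "comm x (a (m - 1) u) = 0" "comm x (E m s) = 0"
    using assms comm_a_zero[OF assms(1), of "m - 1"] by (auto simp: centralizes_def)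
  then show ?thesis by (simp add: adj_row_def comm_jacobi)
qed

lemma comm_adj_zero:
  assumes "centralizes m x" "i \<in> {1..m}" "s \<in> {1..m}"
  shows "comm x (adj m i s u) = 0"
proof -
  have "comm x (a (m - 1) u) = 0" "comm x (E i m) = 0" "comm x (adj_row m s u) = 0"
    using assms comm_a_zero[OF assms(1), of "m - 1"] comm_adj_row_zero[OF assms(1)]
    by (auto simp: centralizes_def)
  then show ?thesis by (simp add: adj_def comm_jacobi comm_add_right)
qed

lemma adj_k_commute: "\<lbrakk>m \<le> n; i \<in> {1..m}; s \<in> {1..m}\<rbrakk> \<Longrightarrow> comm (k z) (adj m i s u) = 0"
  by (intro comm_adj_zero centralizes_mono[OF centralizes_k]) auto

lemma polytop_adj_ex:
  assumes "m \<le> n" "i \<in> {1..m}" "s \<in> {1..m}"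
  shows "\<exists>e. polytop (m - 1) e (adj m i s)"
proof -
  have comm: "\<exists>e. polytop l e (\<lambda>z. comm (E p q) (f z))"
    if "\<exists>e. polytop l e f" "p \<in> {1..n}" "q \<in> {1..n}" for l f p q
    using that polytop_diff[OF polytop_mult_left polytop_mult_right] k_E unfolding comm_def[of "E p q"]
    by blast
  have "m - 1 \<le> n" using assms by simp
  then obtain e where e: "polytop (m - 1) e (a (m - 1))" using polytop_a_ex by blast
  have "\<exists>e. polytop (m - 1) e (\<lambda>z. - comm (E m s) (a (m - 1) z))"
    using comm[of "m - 1" "a (m - 1)" m s] e assms polytop_uminus by (metis atLeastAtMost_iff le_trans order_refl)
  then have "\<exists>e. polytop (m - 1) e (adj_row m s)"
    unfolding adj_row_def using e by (cases "s = m") (auto simp flip: comm_swap)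
  then have "\<exists>e. polytop (m - 1) e (\<lambda>z. comm (E i m) (adj_row m s z))"
    using assms by (intro comm) auto
  moreover have "\<exists>e. polytop (m - 1) e (\<lambda>z. if i = s then a (m - 1) z else 0)"
    using e polytop_zero by (cases "i = s") auto
  ultimately show ?thesis
    unfolding adj_def using polytop_add by blast
qed

lemma is_poly_adj: "\<lbrakk>m \<le> n; i \<in> {1..m}; s \<in> {1..m}\<rbrakk> \<Longrightarrow> is_poly (adj m i s)"
  using polytop_adj_ex unfolding is_poly_def by blast

lemma adj_row_t:
  assumes "1 \<le> m" "m \<le> n" "j \<in> {1..m}"
  shows "(\<Sum>s=1..m. adj_row m s u * T m s j u) = (if j = m then a m u else 0)"
proof -
  obtain l where m: "m = Suc l" using assms by (cases m) auto
  let ?\<beta> = "id(m := j)"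
  have 1: "D l id (id(Suc l := j)) u = a l u"
    unfolding a_def by (rule D_cong) (auto simp: m)
  have 2: "D l (id(i := m)) ?\<beta> u = - adj_row m i u" if "i \<in> {1..l}" for i
  proof -
    have "D l (id(i := m)) ?\<beta> u = D l (id(i := m)) id u"
      by (rule D_cong) (auto simp: m)
    also have "\<dots> = comm (E m i) (a l u)"
      using that assms m by (subst comm_E_a_eq) auto
    finally show ?thesis using that comm_swap[of "E m i"] by (simp add: adj_row_def m)
  qed
  have "D m id ?\<beta> u = a l u * T m m j u - (\<Sum>i=1..l. - adj_row m i u * T m i j u)"
  proof -
    have "D m id ?\<beta> u = D l id ?\<beta> u * t m (?\<beta> m) (u - of_nat l)
      - (\<Sum>i=1..l. D l (id(i := m)) ?\<beta> u * t i (?\<beta> m) (u - of_nat l))"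
      unfolding m by (rule D_last_column)
    also have "(\<Sum>i=1..l. D l (id(i := m)) ?\<beta> u * t i (?\<beta> m) (u - of_nat l))
      = (\<Sum>i=1..l. - adj_row m i u * T m i j u)"
      by (rule sum.cong[OF refl], subst 2) (simp_all add: T_def m)
    finally show ?thesis by (simp only: 1 T_def m diff_Suc_1 fun_upd_same)
  qed
  also have "\<dots> = (\<Sum>s=1..m. adj_row m s u * T m s j u)"
    by (simp add: m sum_negf adj_row_def)
  finally have "(\<Sum>s=1..m. adj_row m s u * T m s j u) = D m id ?\<beta> u" ..
  moreover have "D m id ?\<beta> u = 0" if "j \<noteq> m"
    by (rule D_col_repeat[of m j m]) (use assms that in auto)
  moreover have "D m id ?\<beta> u = a m u" if "j = m"
    using that by (simp add: a_def fun_upd_idem)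
  ultimately show ?thesis by simp
qed

text \<open>Bracketing the equation of the last row with \<open>E i m\<close> gives the equation of the row \<open>i\<close>, as \<open>a m\<close> is central.\<close>
lemma adj_t:
  assumes "m \<le> n" "i \<in> {1..m}" "j \<in> {1..m}"
  shows "(\<Sum>s=1..m. adj m i s u * T m s j u) = (if i = j then a m u else 0)"
proof -
  have m: "1 \<le> m" "i \<in> {1..n}" "m \<in> {1..n}" "m \<in> {1..m}" "j \<in> {1..n}" using assms by auto
  have "0 = comm (E i m) (\<Sum>s=1..m. adj_row m s u * T m s j u)"
    unfolding adj_row_t[OF m(1) assms(1,3)] using comm_E_a_zero[OF assms(1,2) m(4)] by simp
  also have "\<dots> = (\<Sum>s=1..m. comm (E i m) (adj_row m s u) * T m s j u
      + ((if s = m then adj_row m s u * T m i j u else 0) - (if i = j then adj_row m s u * T m s m u else 0)))"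
    unfolding comm_sum_right
  proof (intro sum.cong refl)
    fix s assume "s \<in> {1..m}"
    then have "s \<in> {1..n}" using assms by auto
    then show "comm (E i m) (adj_row m s u * T m s j u) = comm (E i m) (adj_row m s u) * T m s j u
      + ((if s = m then adj_row m s u * T m i j u else 0) - (if i = j then adj_row m s u * T m s m u else 0))"
      using m by (auto simp: comm_mult_right comm_E_T right_diff_distrib)
  qed
  also have "\<dots> = (\<Sum>s=1..m. comm (E i m) (adj_row m s u) * T m s j u)
     + (adj_row m m u * T m i j u - (if i = j then (\<Sum>s=1..m. adj_row m s u * T m s m u) else 0))"
    using m by (cases "i = j") (simp_all add: sum.distrib sum_subtractf sum.delta)
  also have "\<dots> = (\<Sum>s=1..m. comm (E i m) (adj_row m s u) * T m s j u)
     + (a (m - 1) u * T m i j u - (if i = j then a m u else 0))"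
    using adj_row_t[of m m u] m assms by (simp add: adj_row_def)
  finally have "(\<Sum>s=1..m. comm (E i m) (adj_row m s u) * T m s j u) + a (m - 1) u * T m i j u
      = (if i = j then a m u else 0)"
    by (simp add: algebra_simps)
  moreover have "(\<Sum>s=1..m. adj m i s u * T m s j u) = (\<Sum>s=1..m. comm (E i m) (adj_row m s u) * T m s j u
      + (if s = i then a (m - 1) u * T m i j u else 0))"
    by (rule sum.cong) (auto simp: adj_def distrib_right)
  ultimately show ?thesis using assms by (simp add: sum.distrib sum.delta)
qed

lemma sum_product_assoc:
  fixes A C :: "nat \<Rightarrow> 'r"
  shows "(\<Sum>s\<in>I. A s * (\<Sum>r\<in>J. B s r * C r)) = (\<Sum>r\<in>J. (\<Sum>s\<in>I. A s * B s r) * C r)"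
  unfolding sum_distrib_left sum_distrib_right by (subst sum.swap) (simp add: mult.assoc)

lemma a_commute_t:
  assumes "m \<le> n" "i \<in> {1..m}" "j \<in> {1..m}"
  shows "a m x * T m i j z = T m i j z * a m x"
proof -
  have "comm (a m x) (T m i j z) = 0"
    using centralizes_a[OF assms(1), of x] assms(2,3) by (auto simp: centralizes_def T_def t_def comm_add_right)
  then show ?thesis by (rule comm_eq_0D)
qed

text \<open>With \<open>N = T adj - a\<close> one has \<open>N T = T (adj T) - a T = 0\<close>, so \<open>N\<close> vanishes by cancellation.\<close>
lemma t_adj:
  assumes "m \<le> n" "i \<in> {1..m}" "j \<in> {1..m}"
  shows "(\<Sum>s=1..m. T m i s u * adj m s j u) = (if i = j then a m u else 0)"
proof -
  define N where "N l z = (\<Sum>s=1..m. T m i s z * adj m s l z) - (if i = l then a m z else 0)" for l z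
  have "N j u = 0"
  proof (rule row_cancel_T[of m N, OF assms(1) _ _ assms(3)])
    fix l assume l: "l \<in> {1..m}"
    have "is_poly (\<lambda>z. T m i s z * adj m s l z)" if "s \<in> {1..m}" for s
      using that l assms by (intro is_poly_T_times is_poly_adj) auto
    moreover have "is_poly (\<lambda>z. if i = l then a m z else 0)"
      using is_poly_a[OF assms(1)] is_poly_zero by (cases "i = l") auto
    ultimately show "is_poly (N l)"
      unfolding N_def by (intro is_poly_diff is_poly_sum)
  next
    fix z l assume l: "l \<in> {1..m}"
    have "(\<Sum>s=1..m. N s z * T m s l z)
      = (\<Sum>s=1..m. (\<Sum>r=1..m. T m i r z * adj m r s z) * T m s l z)
      - (\<Sum>s=1..m. if s = i then a m z * T m s l z else 0)"
      unfolding N_def left_diff_distrib sum_subtractf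
      by (intro arg_cong2[where f = "(-)"] refl sum.cong) auto
    also have "\<dots> = (\<Sum>r=1..m. T m i r z * (if r = l then a m z else 0)) - a m z * T m i l z"
      unfolding sum_product_assoc[symmetric]
      by (intro arg_cong2[where f = "(-)"] sum.cong refl arg_cong2[where f = "(*)"] adj_t)
         (use assms l in auto)
    also have "\<dots> = (\<Sum>r=1..m. if r = l then T m i l z * a m z else 0) - a m z * T m i l z"
      by (intro arg_cong2[where f = "(-)"] refl sum.cong) auto
    also have "\<dots> = 0" using l a_commute_t[OF assms(1,2) l] by simp
    finally show "(\<Sum>s=1..m. N s z * T m s l z) = 0" .
  qed
  then show ?thesis by (simp add: N_def)
qed

text \<open>
  The adjugate transforms under \<open>gl\<^sub>m\<close> like the matrix \<open>E\<close>: bracketing \<open>adj T = a\<close> with \<open>E p q\<close> shows that the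
  difference \<open>N\<close> of the two sides is killed by \<open>T\<close>.
\<close>
lemma comm_E_adj:
  assumes "m \<le> n" "p \<in> {1..m}" "q \<in> {1..m}" "i \<in> {1..m}" "j \<in> {1..m}"
  shows "comm (E p q) (adj m i j u) = (if q = i then adj m p j u else 0) - (if p = j then adj m i q u else 0)"
proof -
  define N where "N l z = comm (E p q) (adj m i l z)
    - ((if q = i then adj m p l z else 0) - (if p = l then adj m i q z else 0))" for l z
  have n: "p \<in> {1..n}" "q \<in> {1..n}" using assms by auto
  have "N j u = 0"
  proof (rule row_cancel_T[of m N, OF assms(1) _ _ assms(5)])
    fix l assume l: "l \<in> {1..m}"
    have "is_poly (\<lambda>z. comm (E p q) (adj m i l z))"
      using l assms n by (intro is_poly_comm is_poly_adj) (auto simp: k_E)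
    moreover have "is_poly (\<lambda>z. if Q then adj m r s z else 0)" if "r \<in> {1..m}" "s \<in> {1..m}" for Q r s
      using is_poly_adj[OF assms(1) that] is_poly_zero by (cases Q) auto
    ultimately show "is_poly (N l)"
      unfolding N_def using l assms by (intro is_poly_diff) auto
  next
    fix z l assume l: "l \<in> {1..m}"
    have "0 = comm (E p q) (\<Sum>s=1..m. adj m i s z * T m s l z)"
      unfolding adj_t[OF assms(1,4) l] using comm_E_a_zero[OF assms(1-3)] by simp
    also have "\<dots> = (\<Sum>s=1..m. comm (E p q) (adj m i s z) * T m s l z
        + ((if s = q then adj m i q z * T m p l z else 0) - (if p = l then adj m i s z * T m s q z else 0)))"
      unfolding comm_sum_right
    proof (intro sum.cong refl)
      fix s assume "s \<in> {1..m}"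
      then have "s \<in> {1..n}" "l \<in> {1..n}" using assms l by auto
      then show "comm (E p q) (adj m i s z * T m s l z) = comm (E p q) (adj m i s z) * T m s l z
        + ((if s = q then adj m i q z * T m p l z else 0) - (if p = l then adj m i s z * T m s q z else 0))"
        using n by (auto simp: comm_mult_right comm_E_T right_diff_distrib)
    qed
    also have "\<dots> = (\<Sum>s=1..m. comm (E p q) (adj m i s z) * T m s l z) + (adj m i q z * T m p l z
        - (if p = l then (\<Sum>s=1..m. adj m i s z * T m s q z) else 0))"
      using assms by (cases "p = l") (simp_all add: sum.distrib sum_subtractf sum.delta)
    finally have 1: "(\<Sum>s=1..m. comm (E p q) (adj m i s z) * T m s l z)
       = (if p = l then (\<Sum>s=1..m. adj m i s z * T m s q z) else 0) - adj m i q z * T m p l z"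
      by (simp add: algebra_simps)
    have 2: "(\<Sum>s=1..m. (if q = i then adj m p s z else 0) * T m s l z) = (if q = i \<and> p = l then a m z else 0)"
      using assms l by (cases "q = i") (simp_all add: adj_t)
    have 3: "(\<Sum>s=1..m. (if p = s then adj m i q z else 0) * T m s l z)
       = (\<Sum>s=1..m. if s = p then adj m i q z * T m p l z else 0)"
      by (rule sum.cong) auto
    show "(\<Sum>s=1..m. N s z * T m s l z) = 0"
      unfolding N_def left_diff_distrib sum_subtractf 1 2 3 using assms by (simp add: adj_t)
  qed
  then show ?thesis by (simp add: N_def)
qed

lemma adj_corner: "1 \<le> m \<Longrightarrow> m \<le> n \<Longrightarrow> adj m m m u = a (m - 1) u"
proof -
  assume m: "1 \<le> m" "m \<le> n"
  have "centralizes (m - 1) (E m m)"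
    using m by (intro centralizes_E) auto
  then show ?thesis using comm_a_zero[of "m - 1"] by (simp add: adj_def adj_row_def)
qed

lemma a_commute_adj:
  assumes "m \<le> n" "i \<in> {1..m}" "j \<in> {1..m}"
  shows "adj m i j y * a m x = a m x * adj m i j y"
  using comm_eq_0D[OF comm_adj_zero[OF centralizes_a]] assms by metis

text \<open>
  Evaluate \<open>adj(x) T(y) adj(y)\<close> in two ways: \<open>T(y) adj(y) = a(y)\<close>, while
  \<open>adj(x) T(y) = a(x) + (y - x) adj(x)\<close>.
\<close>
lemma adj_adj:
  assumes "m \<le> n" "i \<in> {1..m}" "j \<in> {1..m}"
  shows "k (x - y) * (\<Sum>s=1..m. adj m i s x * adj m s j y) = a m x * adj m i j y - a m y * adj m i j x"
proof -
  have adj_ty: "(\<Sum>s=1..m. adj m i s x * T m s r y)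
      = (if i = r then a m x else 0) + k (y - x) * adj m i r x" if r: "r \<in> {1..m}" for r
  proof -
    have "(\<Sum>s=1..m. adj m i s x * T m s r y)
      = (\<Sum>s=1..m. adj m i s x * T m s r x + (if s = r then adj m i r x * k (y - x) else 0))"
      by (rule sum.cong) (auto simp: T_shift[of _ _ _ y x] distrib_left)
    also have "\<dots> = (if i = r then a m x else 0) + adj m i r x * k (y - x)"
      using assms r by (simp add: sum.distrib adj_t)
    also have "adj m i r x * k (y - x) = k (y - x) * adj m i r x"
      using comm_eq_0D[OF adj_k_commute] assms r by metis
    finally show ?thesis .
  qed
  have "adj m i j x * a m y = (\<Sum>s=1..m. if s = j then adj m i j x * a m y else 0)"
    using assms by simp
  also have "\<dots> = (\<Sum>s=1..m. adj m i s x * (\<Sum>r=1..m. T m s r y * adj m r j y))"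
    by (rule sum.cong) (use assms in \<open>auto simp: t_adj\<close>)
  also have "\<dots> = (\<Sum>r=1..m. ((if i = r then a m x else 0) + k (y - x) * adj m i r x) * adj m r j y)"
    unfolding sum_product_assoc by (rule sum.cong) (simp_all add: adj_ty)
  also have "\<dots> = (\<Sum>r=1..m. (if r = i then a m x * adj m i j y else 0) + k (y - x) * (adj m i r x * adj m r j y))"
    by (rule sum.cong) (auto simp: distrib_right mult.assoc)
  also have "\<dots> = a m x * adj m i j y + k (y - x) * (\<Sum>s=1..m. adj m i s x * adj m s j y)"
    using assms by (simp add: sum.distrib sum_distrib_left)
  finally have "a m y * adj m i j x = a m x * adj m i j y + k (y - x) * (\<Sum>s=1..m. adj m i s x * adj m s j y)"
    using a_commute_adj assms by simp
  moreover have "k (x - y) = - k (y - x)" by (simp flip: k_uminus)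
  ultimately show ?thesis by (simp add: algebra_simps)
qed

text \<open>
  For \<open>i = m\<close>, bracket the equation \<open>\<Sum>\<^sub>s adj\<^sub>m\<^sub>s T\<^sub>s\<^sub>m = a\<^sub>m\<close> with \<open>E m (m + 1)\<close>, which commutes with the last
  row of the adjugate.  The action of \<open>E i m\<close> carries the result to the other \<open>i\<close>.
\<close>
lemma comm_a_column:
  assumes "Suc m \<le> n" "i \<in> {1..m}"
  shows "comm (a m x) (E i (Suc m)) = (\<Sum>s=1..m. adj m i s x * E s (Suc m))"
proof -
  let ?e = "E m (Suc m)"
  have m: "1 \<le> m" "m \<le> n" "m \<in> {1..m}" "m \<in> {1..n}" "Suc m \<in> {1..n}" using assms by auto
  have e_a: "comm ?e (a (m - 1) u) = 0" for u
    by (rule comm_a_zero[OF centralizes_E, of _ _ "m - 1"]) (use m in auto)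
  have e_row: "comm ?e (adj_row m s u) = 0" if s: "s \<in> {1..m}" for s u
  proof (cases "s = m")
    case False
    then have "comm ?e (E m s) = 0" using s m by (subst comm_E) auto
    then show ?thesis using False e_a by (simp add: adj_row_def comm_jacobi[of ?e])
  qed (simp add: adj_row_def e_a)
  have e_adj: "comm ?e (adj m m s u) = 0" if s: "s \<in> {1..m}" for s u
  proof -
    have if_a: "comm ?e (if m = s then a (m - 1) u else 0) = 0" using e_a[of u] by (cases "m = s") auto
    have "comm ?e (E m m) = - ?e" using m by (subst comm_E) auto
    then show ?thesis
      by (simp add: adj_def comm_add_right comm_jacobi[of ?e] e_row[OF s] comm_uminus_left if_a)
  qed
  have main: "comm (a m x) ?e = (\<Sum>s=1..m. adj m m s x * E s (Suc m))"
  proof -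
    have "comm ?e (a m x) = comm ?e (\<Sum>s=1..m. adj m m s x * T m s m x)"
      using m by (simp add: adj_t)
    also have "\<dots> = (\<Sum>s=1..m. - (adj m m s x * E s (Suc m)))"
      unfolding comm_sum_right
    proof (intro sum.cong refl)
      fix s assume s: "s \<in> {1..m}"
      then have "comm ?e (T m s m x) = - E s (Suc m)" using m by (subst comm_E_T) (auto simp: T_def t_def)
      then show "comm ?e (adj m m s x * T m s m x) = - (adj m m s x * E s (Suc m))"
        by (simp add: comm_mult_right e_adj[OF s])
    qed
    finally show ?thesis using comm_swap[of "a m x" ?e] by (simp add: sum_negf)
  qed
  show ?thesis
  proof (cases "i = m")
    case False
    have i: "i \<in> {1..n}" "i \<noteq> Suc m" using assms by auto
    have Ea: "comm (E i m) (a m x) = 0" using comm_E_a_zero assms m by blast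
    have Ee: "comm (E i m) ?e = E i (Suc m)" using i m by (subst comm_E) auto
    have "comm (a m x) (E i (Suc m)) = comm (E i m) (comm (a m x) ?e)"
      by (simp add: comm_jacobi[of "E i m"] Ea Ee)
    also have "\<dots> = (\<Sum>s=1..m. adj m i s x * E s (Suc m)
        - (if s = i then adj m m m x * E i (Suc m) else 0) + (if s = m then adj m m m x * E i (Suc m) else 0))"
      unfolding main comm_sum_right
    proof (intro sum.cong refl)
      fix s assume s: "s \<in> {1..m}"
      have "comm (E i m) (E s (Suc m)) = (if m = s then E i (Suc m) else 0)"
        using i m s assms by (subst comm_E) auto
      then show "comm (E i m) (adj m m s x * E s (Suc m)) = adj m i s x * E s (Suc m)
        - (if s = i then adj m m m x * E i (Suc m) else 0) + (if s = m then adj m m m x * E i (Suc m) else 0)"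
        using assms m s by (auto simp: comm_mult_right comm_E_adj left_diff_distrib)
    qed
    also have "\<dots> = (\<Sum>s=1..m. adj m i s x * E s (Suc m))"
      using assms m by (simp add: sum.distrib sum_subtractf)
    finally show ?thesis .
  qed (simp add: main)
qed

text \<open>The mirror image: here \<open>E (m + 1) m\<close> commutes with the last column of the adjugate.\<close>
lemma comm_row_a:
  assumes "Suc m \<le> n" "j \<in> {1..m}"
  shows "comm (E (Suc m) j) (a m x) = (\<Sum>s=1..m. E (Suc m) s * adj m s j x)"
proof -
  let ?f = "E (Suc m) m"
  have m: "1 \<le> m" "m \<le> n" "m \<in> {1..m}" "m \<in> {1..n}" "Suc m \<in> {1..n}" using assms by auto
  have f_a: "comm ?f (a (m - 1) u) = 0" for u
    by (rule comm_a_zero[OF centralizes_E, of _ _ "m - 1"]) (use m in auto)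
  have f_adj: "comm ?f (adj m s m u) = 0" if s: "s \<in> {1..m}" for s u
  proof -
    have "comm ?f (E s m) = (if s = m then ?f else 0)" using m s assms by (subst comm_E) auto
    then show ?thesis
      by (simp add: adj_def adj_row_def comm_add_right comm_jacobi[of ?f] f_a)
  qed
  have main: "comm ?f (a m x) = (\<Sum>s=1..m. E (Suc m) s * adj m s m x)"
  proof -
    have "comm ?f (a m x) = comm ?f (\<Sum>s=1..m. T m m s x * adj m s m x)"
      using m by (simp add: t_adj)
    also have "\<dots> = (\<Sum>s=1..m. E (Suc m) s * adj m s m x)"
      unfolding comm_sum_right
    proof (intro sum.cong refl)
      fix s assume s: "s \<in> {1..m}"
      then have "comm ?f (T m m s x) = E (Suc m) s" using m by (subst comm_E_T) (auto simp: T_def t_def)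
      then show "comm ?f (T m m s x * adj m s m x) = E (Suc m) s * adj m s m x"
        by (simp add: comm_mult_right f_adj[OF s])
    qed
    finally show ?thesis .
  qed
  show ?thesis
  proof (cases "j = m")
    case False
    have j: "j \<in> {1..n}" "j \<noteq> Suc m" using assms by auto
    have Ea: "comm (E m j) (a m x) = 0" using comm_E_a_zero assms m by blast
    have Ef: "comm (E m j) ?f = - E (Suc m) j" using j m by (subst comm_E) auto
    have "- comm (E (Suc m) j) (a m x) = comm (E m j) (comm ?f (a m x))"
      by (simp add: comm_jacobi[of "E m j"] Ea Ef comm_uminus_left)
    also have "\<dots> = (\<Sum>s=1..m. (if s = j then E (Suc m) j * adj m m m x else 0)
        - (if s = m then E (Suc m) j * adj m m m x else 0) - E (Suc m) s * adj m s j x)"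
      unfolding main comm_sum_right
    proof (intro sum.cong refl)
      fix s assume s: "s \<in> {1..m}"
      have "comm (E m j) (E (Suc m) s) = - (if m = s then E (Suc m) j else 0)"
        using j m s assms by (subst comm_E) auto
      then show "comm (E m j) (E (Suc m) s * adj m s m x) = (if s = j then E (Suc m) j * adj m m m x else 0)
        - (if s = m then E (Suc m) j * adj m m m x else 0) - E (Suc m) s * adj m s j x"
        using assms m s by (auto simp: comm_mult_right comm_E_adj right_diff_distrib)
    qed
    also have "\<dots> = - (\<Sum>s=1..m. E (Suc m) s * adj m s j x)"
      using assms m by (simp add: sum.distrib sum_subtractf sum_negf)
    finally show ?thesis by simp
  qed (simp add: main)
qed

end


section \<open>Relations between the Drinfeld generators\<close>

context gl_family begin

text \<open>
  Commutators are easier to handle than the minors that define the Drinfeld generators; the two agree by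
  \<open>b_eq_D\<close> and \<open>c_eq_D\<close>.
\<close>
definition b :: "nat \<Rightarrow> complex \<Rightarrow> 'r" where
  "b m u = comm (a m u) (E m (Suc m))"

definition c :: "nat \<Rightarrow> complex \<Rightarrow> 'r" where
  "c m u = comm (E (Suc m) m) (a m u)"

definition d :: "nat \<Rightarrow> complex \<Rightarrow> 'r" where
  "d m u = adj (Suc m) m m u"

lemma b_eq_adj: "1 \<le> m \<Longrightarrow> Suc m \<le> n \<Longrightarrow> b m x = (\<Sum>s=1..m. adj m m s x * E s (Suc m))"
  unfolding b_def by (rule comm_a_column) auto

lemma c_eq_adj: "1 \<le> m \<Longrightarrow> Suc m \<le> n \<Longrightarrow> c m x = (\<Sum>s=1..m. E (Suc m) s * adj m s m x)"
  unfolding c_def by (rule comm_row_a) auto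

text \<open>
  The corner of \<open>adj (m + 1)\<close> is \<open>a m\<close>; acting on it by \<open>E m (m + 1)\<close> and \<open>E (m + 1) m\<close> gives its neighbours.
\<close>
lemma adj_Suc_entries:
  assumes "1 \<le> m" "Suc m \<le> n"
  shows "adj (Suc m) (Suc m) (Suc m) u = a m u"
    and "adj (Suc m) m (Suc m) u = - b m u"
    and "adj (Suc m) (Suc m) m u = - c m u"
proof -
  show corner: "adj (Suc m) (Suc m) (Suc m) u = a m u"
    using adj_corner[of "Suc m"] assms by simp
  have "comm (E m (Suc m)) (a m u) = adj (Suc m) m (Suc m) u"
    unfolding corner[symmetric] using assms by (subst comm_E_adj) auto
  then show "adj (Suc m) m (Suc m) u = - b m u"
    using comm_swap[of "E m (Suc m)" "a m u"] by (simp add: b_def)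
  have "comm (E (Suc m) m) (a m u) = - adj (Suc m) (Suc m) m u"
    unfolding corner[symmetric] using assms by (subst comm_E_adj) auto
  then show "adj (Suc m) (Suc m) m u = - c m u" by (simp add: c_def)
qed

lemma raise_lower:
  assumes "1 \<le> m" "Suc m \<le> n"
  shows "comm (E m (Suc m)) (a m u) = - b m u"
    and "comm (E (Suc m) m) (a m u) = c m u"
    and "comm (E m (Suc m)) (b m u) = 0"
    and "comm (E (Suc m) m) (b m u) = d m u - a m u"
    and "comm (E (Suc m) m) (d m u) = - c m u"
proof -
  have b: "b m u = - adj (Suc m) m (Suc m) u" by (simp add: adj_Suc_entries assms)
  show "comm (E m (Suc m)) (a m u) = - b m u"
    using comm_swap[of "E m (Suc m)"] by (simp add: b_def)
  show "comm (E (Suc m) m) (a m u) = c m u" by (simp add: c_def)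
  show "comm (E m (Suc m)) (b m u) = 0"
    unfolding b comm_uminus_right using assms by (subst comm_E_adj) auto
  show "comm (E (Suc m) m) (b m u) = d m u - a m u"
    unfolding b comm_uminus_right using assms by (subst comm_E_adj) (auto simp: d_def adj_Suc_entries)
  show "comm (E (Suc m) m) (d m u) = - c m u"
    unfolding d_def using assms by (subst comm_E_adj) (auto simp: adj_Suc_entries)
qed

text \<open>Apply \<open>E m (m + 1)\<close> to \<open>[a(x), a(y)] = 0\<close>.\<close>
lemma comm_a_b_sym:
  assumes "1 \<le> m" "Suc m \<le> n"
  shows "comm (a m x) (b m y) = comm (a m y) (b m x)"
proof -
  have "0 = comm (E m (Suc m)) (comm (a m x) (a m y))"
    using comm_a_a[of m m x y] assms by simp
  also have "\<dots> = - comm (b m x) (a m y) - comm (a m x) (b m y)"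
    by (simp add: comm_jacobi[of "E m (Suc m)"] raise_lower assms comm_uminus_left comm_uminus_right)
  also have "- comm (b m x) (a m y) = comm (a m y) (b m x)"
    using comm_swap[of "a m y" "b m x"] by simp
  finally show ?thesis by simp
qed

text \<open>
  Applying \<open>E m (m + 1)\<close> once more, to the symmetry of \<open>[a(x), b(y)]\<close>, shows that \<open>[b(x), b(y)]\<close> is symmetric; it is
  antisymmetric anyway.
\<close>
lemma comm_b_b:
  assumes "1 \<le> m" "Suc m \<le> n"
  shows "comm (b m x) (b m y) = 0"
proof (rule eq_uminus_imp_zero)
  have "comm (E m (Suc m)) (comm (a m x) (b m y)) = comm (E m (Suc m)) (comm (a m y) (b m x))"
    using comm_a_b_sym[OF assms] by simp
  then have "comm (b m x) (b m y) = comm (b m y) (b m x)"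
    by (simp add: comm_jacobi[of "E m (Suc m)"] raise_lower assms comm_uminus_left)
  then show "comm (b m x) (b m y) = - comm (b m x) (b m y)"
    using comm_swap[of "b m y" "b m x"] by simp
qed

lemma comm_c_c:
  assumes "1 \<le> m" "Suc m \<le> n"
  shows "comm (c m x) (c m y) = 0"
proof -
  have f_c: "comm (E (Suc m) m) (c m u) = 0" for u
  proof -
    have "c m u = - adj (Suc m) (Suc m) m u" by (simp add: adj_Suc_entries assms)
    then show ?thesis using assms by (simp add: comm_uminus_right comm_E_adj)
  qed
  have "0 = comm (E (Suc m) m) (comm (E (Suc m) m) (comm (a m x) (a m y)))"
    using comm_a_a[of m m x y] assms by simp
  also have "\<dots> = comm (c m x) (c m y) + comm (c m x) (c m y)"
    by (simp add: comm_jacobi[of "E (Suc m) m"] raise_lower assms comm_add_right f_c)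
  finally show ?thesis
    by (intro eq_uminus_imp_zero) (simp add: eq_neg_iff_add_eq_0)
qed

text \<open>
  Write \<open>b(y)\<close> as the product of the last row of \<open>adj(y)\<close> with the column \<open>\<epsilon> = (E s (m + 1))\<^sub>s\<close>.  As \<open>a(x)\<close> commutes with
  \<open>adj(y)\<close> and \<open>[a(x), \<epsilon>] = adj(x) \<epsilon>\<close>, the commutator is a row of \<open>adj(y) adj(x) \<epsilon>\<close>, which \<open>adj_adj\<close> evaluates.
\<close>
lemma comm_a_b:
  assumes "1 \<le> m" "Suc m \<le> n"
  shows "k (x - y) * comm (a m x) (b m y) = b m y * a m x - b m x * a m y"
proof -
  have m: "m \<in> {1..m}" "m \<le> n" using assms by auto
  have "comm (a m x) (b m y) = (\<Sum>s=1..m. adj m m s y * (\<Sum>r=1..m. adj m s r x * E r (Suc m)))"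
    unfolding b_eq_adj[OF assms] comm_sum_right
  proof (intro sum.cong refl)
    fix s assume s: "s \<in> {1..m}"
    have "comm (a m x) (adj m m s y) = 0"
      by (rule comm_adj_zero[OF centralizes_a]) (use s m in auto)
    then show "comm (a m x) (adj m m s y * E s (Suc m)) = adj m m s y * (\<Sum>r=1..m. adj m s r x * E r (Suc m))"
      by (simp add: comm_mult_right comm_a_column[OF assms(2) s])
  qed
  then have "k (y - x) * comm (a m x) (b m y)
     = k (y - x) * (\<Sum>r=1..m. (\<Sum>s=1..m. adj m m s y * adj m s r x) * E r (Suc m))"
    by (simp only: sum_product_assoc)
  also have "\<dots> = (\<Sum>r=1..m. (k (y - x) * (\<Sum>s=1..m. adj m m s y * adj m s r x)) * E r (Suc m))"
    by (subst sum_distrib_left) (simp only: mult.assoc)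
  also have "\<dots> = (\<Sum>r=1..m. a m y * (adj m m r x * E r (Suc m)) - a m x * (adj m m r y * E r (Suc m)))"
    by (intro sum.cong refl) (simp add: adj_adj m left_diff_distrib mult.assoc)
  also have "\<dots> = a m y * b m x - a m x * b m y"
    unfolding b_eq_adj[OF assms] by (simp add: sum_subtractf sum_distrib_left)
  finally have "k (x - y) * comm (a m x) (b m y) = a m x * b m y - a m y * b m x"
    using k_uminus[of "y - x"] by (simp add: algebra_simps)
  also have "\<dots> = b m y * a m x - b m x * a m y"
    using comm_a_b_sym[OF assms, of x y] by (simp add: comm_def algebra_simps)
  finally show ?thesis .
qed

lemma comm_a_c:
  assumes "1 \<le> m" "Suc m \<le> n"
  shows "k (x - y) * comm (a m x) (c m y) = c m x * a m y - c m y * a m x"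
proof -
  have m: "m \<in> {1..m}" "m \<le> n" using assms by auto
  have "comm (a m x) (c m y) = - (\<Sum>s=1..m. (\<Sum>r=1..m. E (Suc m) r * adj m r s x) * adj m s m y)"
    unfolding c_eq_adj[OF assms] comm_sum_right sum_negf[symmetric]
  proof (intro sum.cong refl)
    fix s assume s: "s \<in> {1..m}"
    have "comm (a m x) (adj m s m y) = 0"
      by (rule comm_adj_zero[OF centralizes_a]) (use s m in auto)
    then show "comm (a m x) (E (Suc m) s * adj m s m y) = - ((\<Sum>r=1..m. E (Suc m) r * adj m r s x) * adj m s m y)"
      by (simp add: comm_mult_right comm_row_a[OF assms(2) s] comm_swap[of "a m x" "E (Suc m) s"])
  qed
  also have "\<dots> = - (\<Sum>r=1..m. E (Suc m) r * (\<Sum>s=1..m. adj m r s x * adj m s m y))"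
    unfolding sum_product_assoc ..
  finally have "k (x - y) * comm (a m x) (c m y)
     = - (\<Sum>r=1..m. E (Suc m) r * (k (x - y) * (\<Sum>s=1..m. adj m r s x * adj m s m y)))"
    using assms by (auto simp: sum_distrib_left mult.assoc[symmetric] k_E_commute intro!: sum.cong)
  also have "\<dots> = (\<Sum>r=1..m. E (Suc m) r * adj m r m x * a m y - E (Suc m) r * adj m r m y * a m x)"
    unfolding sum_negf[symmetric]
    by (intro sum.cong refl) (simp add: adj_adj m right_diff_distrib mult.assoc a_commute_adj)
  also have "\<dots> = c m x * a m y - c m y * a m x"
    unfolding c_eq_adj[OF assms] by (simp add: sum_subtractf sum_distrib_right)
  finally show ?thesis .
qed

lemma T_Suc_adj:
  assumes "m \<le> n" "i \<in> {1..m}" "j \<in> {1..m}"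
  shows "(\<Sum>s=1..m. T (Suc m) i s x * adj m s j y)
    = (if i = j then a m y else 0) + k (x - y - 1) * adj m i j y"
proof -
  have T: "T (Suc m) i s x = T m i s y + (if i = s then k (x - y - 1) else 0)" for s
  proof -
    have "x - of_nat m - (y - of_nat (m - 1)) = x - y - 1"
      using assms by (simp add: of_nat_diff)
    then show ?thesis
      by (simp only: T_def t_shift_eq[of i s "x - of_nat m" "y - of_nat (m - 1)"] diff_Suc_1)
  qed
  show ?thesis
    unfolding T distrib_right sum.distrib using assms
    by (simp add: t_adj if_distrib[where f = "\<lambda>x. x * _"] cong: if_cong)
qed

lemma adj_T_Suc:
  assumes "m \<le> n" "i \<in> {1..m}" "j \<in> {1..m}"
  shows "(\<Sum>s=1..m. adj m i s y * T (Suc m) s j x)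
    = (if i = j then a m y else 0) + k (x - y - 1) * adj m i j y"
proof -
  have T: "adj m i s y * T (Suc m) s j x = adj m i s y * T m s j y + (if s = j then k (x - y - 1) * adj m i j y else 0)"
    if "s \<in> {1..m}" for s
  proof -
    have "x - of_nat m - (y - of_nat (m - 1)) = x - y - 1"
      using assms by (simp add: of_nat_diff)
    moreover have "adj m i j y * k z = k z * adj m i j y" for z
      by (rule comm_eq_0D[OF adj_k_commute, symmetric]) (use assms in auto)
    ultimately show ?thesis
      by (simp only: T_def t_shift_eq[of s j "x - of_nat m" "y - of_nat (m - 1)"] diff_Suc_1 distrib_left) simp
  qed
  show ?thesis
    by (subst sum.cong[OF refl T], assumption) (use assms in \<open>simp add: sum.distrib adj_t\<close>)
qed

text \<open>
  The row \<open>m\<close> of \<open>adj\<^sub>m\<^sub>+\<^sub>1(x) T\<^sub>m\<^sub>+\<^sub>1(x) = a\<^sub>m\<^sub>+\<^sub>1(x)\<close>, restricted to the first \<open>m\<close> columns and multiplied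
  by \<open>adj\<^sub>m(y)\<close> on the right.  The sum on the right-hand side has the coefficient \<open>x - y - 1\<close> because
  \<open>T\<^sub>m\<^sub>+\<^sub>1(x) = T\<^sub>m(y) + (x - y - 1)\<close> on these indices; it disappears for \<open>y = x - 1\<close>.
\<close>
lemma b_times_c:
  assumes "1 \<le> m" "Suc m \<le> n"
  shows "b m x * c m y = d m x * a m y - a (Suc m) x * a (m - 1) y
    + k (x - y - 1) * (\<Sum>s=1..m. adj (Suc m) m s x * adj m s m y)"
proof -
  have m: "m \<in> {1..m}" "m \<le> n" using assms by auto
  have row: "(\<Sum>s=1..m. adj (Suc m) m s x * T (Suc m) s j x) = (if m = j then a (Suc m) x else 0) + b m x * E (Suc m) j"
    if "j \<in> {1..m}" for j
  proof -
    have "(\<Sum>s=1..m. adj (Suc m) m s x * T (Suc m) s j x) - b m x * E (Suc m) j = (if m = j then a (Suc m) x else 0)"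
      using adj_t[of "Suc m" m j x] that assms by (simp add: adj_Suc_entries T_off_diagonal)
    then show ?thesis by (simp only: diff_eq_eq)
  qed
  have "(\<Sum>s=1..m. adj (Suc m) m s x * (\<Sum>j=1..m. T (Suc m) s j x * adj m j m y))
     = (\<Sum>j=1..m. (if m = j then a (Suc m) x * adj m m m y else 0) + b m x * (E (Suc m) j * adj m j m y))"
    unfolding sum_product_assoc by (rule sum.cong) (auto simp: row distrib_right mult.assoc)
  also have "\<dots> = a (Suc m) x * a (m - 1) y + b m x * c m y"
    using assms m by (simp add: sum.distrib c_eq_adj adj_corner sum_distrib_left)
  also have "(\<Sum>s=1..m. adj (Suc m) m s x * (\<Sum>j=1..m. T (Suc m) s j x * adj m j m y))
     = (\<Sum>s=1..m. (if s = m then adj (Suc m) m m x * a m y else 0) + k (x - y - 1) * (adj (Suc m) m s x * adj m s m y))"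
  proof (rule sum.cong[OF refl])
    fix s assume s: "s \<in> {1..m}"
    have "adj (Suc m) m s x * k z = k z * adj (Suc m) m s x" for z
      by (rule comm_eq_0D[OF adj_k_commute, symmetric]) (use assms s in auto)
    then have "adj (Suc m) m s x * (k z * w) = k z * (adj (Suc m) m s x * w)" for z w
      by (simp only: mult.assoc[symmetric])
    then show "adj (Suc m) m s x * (\<Sum>j=1..m. T (Suc m) s j x * adj m j m y)
       = (if s = m then adj (Suc m) m m x * a m y else 0) + k (x - y - 1) * (adj (Suc m) m s x * adj m s m y)"
      using s m by (simp add: T_Suc_adj distrib_left)
  qed
  also have "\<dots> = d m x * a m y + k (x - y - 1) * (\<Sum>s=1..m. adj (Suc m) m s x * adj m s m y)"
    using m by (simp add: sum.distrib d_def sum_distrib_left)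
  finally show ?thesis by (simp add: algebra_simps)
qed

text \<open>The same for the column \<open>m\<close> of \<open>T\<^sub>m\<^sub>+\<^sub>1(x) adj\<^sub>m\<^sub>+\<^sub>1(x) = a\<^sub>m\<^sub>+\<^sub>1(x)\<close>, multiplied by \<open>adj\<^sub>m(y)\<close> on the left.\<close>
lemma b_times_c':
  assumes "1 \<le> m" "Suc m \<le> n"
  shows "b m y * c m x = a m y * d m x - a (Suc m) x * a (m - 1) y
    + k (x - y - 1) * (\<Sum>s=1..m. adj m m s y * adj (Suc m) s m x)"
proof -
  have m: "m \<in> {1..m}" "m \<le> n" using assms by auto
  have col: "(\<Sum>s=1..m. T (Suc m) j s x * adj (Suc m) s m x) = (if j = m then a (Suc m) x else 0) + E j (Suc m) * c m x"
    if "j \<in> {1..m}" for j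
  proof -
    have "(\<Sum>s=1..m. T (Suc m) j s x * adj (Suc m) s m x) - E j (Suc m) * c m x = (if j = m then a (Suc m) x else 0)"
      using t_adj[of "Suc m" j m x] that assms by (simp add: adj_Suc_entries T_off_diagonal)
    then show ?thesis by (simp only: diff_eq_eq)
  qed
  have "(\<Sum>j=1..m. adj m m j y * (\<Sum>s=1..m. T (Suc m) j s x * adj (Suc m) s m x))
     = (\<Sum>j=1..m. (if j = m then adj m m m y * a (Suc m) x else 0) + adj m m j y * E j (Suc m) * c m x)"
    by (rule sum.cong) (auto simp: col distrib_left mult.assoc)
  also have "\<dots> = a (m - 1) y * a (Suc m) x + b m y * c m x"
    using assms m by (simp add: sum.distrib b_eq_adj adj_corner sum_distrib_right)
  also have "a (m - 1) y * a (Suc m) x = a (Suc m) x * a (m - 1) y"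
    by (rule comm_eq_0D[OF comm_a_a]) (use assms in auto)
  also have "(\<Sum>j=1..m. adj m m j y * (\<Sum>s=1..m. T (Suc m) j s x * adj (Suc m) s m x))
     = (\<Sum>s=1..m. (if s = m then a m y * adj (Suc m) m m x else 0) + k (x - y - 1) * (adj m m s y * adj (Suc m) s m x))"
    unfolding sum_product_assoc
    by (rule sum.cong) (use m in \<open>auto simp: adj_T_Suc distrib_right mult.assoc\<close>)
  also have "\<dots> = a m y * d m x + k (x - y - 1) * (\<Sum>s=1..m. adj m m s y * adj (Suc m) s m x)"
    using m by (simp add: sum.distrib d_def sum_distrib_left)
  finally show ?thesis by (simp add: algebra_simps)
qed

text \<open>
  Let \<open>adj\<^sub>m(y)\<close> also denote its extension by zero to size \<open>m + 1\<close>.  By \<open>comm_row_a\<close> and \<open>comm_a_column\<close> the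
  bracket of \<open>T\<^sub>m\<^sub>+\<^sub>1(x)\<close> with \<open>a\<^sub>m(y)\<close>, taken entrywise, is the matrix commutator
  \<open>T\<^sub>m\<^sub>+\<^sub>1(x) adj\<^sub>m(y) - adj\<^sub>m(y) T\<^sub>m\<^sub>+\<^sub>1(x)\<close>.  Cancelling \<open>T\<^sub>m\<^sub>+\<^sub>1(x)\<close>, the entrywise bracket of
  \<open>adj\<^sub>m\<^sub>+\<^sub>1(x)\<close> with \<open>a\<^sub>m(y)\<close> is the matrix commutator of \<open>adj\<^sub>m\<^sub>+\<^sub>1(x)\<close> with \<open>adj\<^sub>m(y)\<close>.  The lemma
  is the entry in position \<open>(m, m)\<close>.
\<close>
lemma comm_d_a:
  assumes "1 \<le> m" "Suc m \<le> n"
  shows "comm (d m x) (a m y) = (\<Sum>s=1..m. adj (Suc m) m s x * adj m s m y)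
    - (\<Sum>s=1..m. adj m m s y * adj (Suc m) s m x)"
proof -
  have m: "m \<in> {1..m}" "m \<le> n" "m \<in> {1..Suc m}" "1 \<le> m" using assms by auto
  define N where "N l z = comm (adj (Suc m) m l z) (a m y)
    - ((\<Sum>s=1..m. adj (Suc m) m s z * (if l \<in> {1..m} then adj m s l y else 0))
      - (\<Sum>s=1..m. adj m m s y * adj (Suc m) s l z))" for l z
  have k_adj: "comm (k z) (adj m i s y) = 0" if "i \<in> {1..m}" "s \<in> {1..m}" for z i s
    using adj_k_commute that m by blast
  have "N m x = 0"
  proof (rule row_cancel_T[of "Suc m" N, OF assms(2) _ _ m(3)])
    fix l assume l: "l \<in> {1..Suc m}"
    have "is_poly (\<lambda>z. - comm (a m y) (adj (Suc m) m l z))"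
      using l assms m centralizes_a[of m] comm_a_zero[OF centralizes_k]
      by (intro is_poly_uminus is_poly_comm is_poly_adj) auto
    then have 1: "is_poly (\<lambda>z. comm (adj (Suc m) m l z) (a m y))"
      by (simp add: comm_swap[of _ "a m y"])
    have 2: "is_poly (\<lambda>z. \<Sum>s=1..m. adj (Suc m) m s z * (if l \<in> {1..m} then adj m s l y else 0))"
      using assms m k_adj by (intro is_poly_sum is_poly_mult_right is_poly_adj) auto
    have 3: "is_poly (\<lambda>z. \<Sum>s=1..m. adj m m s y * adj (Suc m) s l z)"
      using assms m k_adj l by (intro is_poly_sum is_poly_mult_left is_poly_adj) auto
    show "is_poly (N l)"
      unfolding N_def by (intro is_poly_diff 1 2 3)
  next
    fix z j assume j: "j \<in> {1..Suc m}"
    let ?T = "\<lambda>i j. T (Suc m) i j z"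
    have first: "(\<Sum>l=1..Suc m. comm (adj (Suc m) m l z) (a m y) * ?T l j)
       = - (\<Sum>l=1..Suc m. adj (Suc m) m l z * comm (?T l j) (a m y))"
    proof -
      have "comm (a (Suc m) z) (a m y) = 0" using comm_a_a assms m by simp
      then have "0 = comm (if m = j then a (Suc m) z else 0) (a m y)"
        by (cases "m = j") auto
      then have "0 = comm (\<Sum>l=1..Suc m. adj (Suc m) m l z * ?T l j) (a m y)"
        by (simp only: adj_t[OF assms(2) m(3) j])
      also have "\<dots> = (\<Sum>l=1..Suc m. adj (Suc m) m l z * comm (?T l j) (a m y))
         + (\<Sum>l=1..Suc m. comm (adj (Suc m) m l z) (a m y) * ?T l j)"
        unfolding comm_sum_left comm_mult_left sum.distrib ..
      finally show ?thesis by (simp only: eq_neg_iff_add_eq_0 add.commute)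
    qed
    have second: "(\<Sum>l=1..Suc m. (\<Sum>s=1..m. adj (Suc m) m s z * (if l \<in> {1..m} then adj m s l y else 0)) * ?T l j)
       = (\<Sum>s=1..m. adj (Suc m) m s z * (\<Sum>l=1..m. adj m s l y * ?T l j))"
      unfolding sum_product_assoc by simp
    have third: "(\<Sum>l=1..Suc m. (\<Sum>s=1..m. adj m m s y * adj (Suc m) s l z) * ?T l j)
       = (if j \<le> m then adj m m j y * a (Suc m) z else 0)"
    proof -
      have "(\<Sum>l=1..Suc m. (\<Sum>s=1..m. adj m m s y * adj (Suc m) s l z) * ?T l j)
         = (\<Sum>s=1..m. adj m m s y * (\<Sum>l=1..Suc m. adj (Suc m) s l z * ?T l j))"
        unfolding sum_product_assoc ..
      also have "\<dots> = (\<Sum>s=1..m. if s = j then adj m m j y * a (Suc m) z else 0)"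
        by (rule sum.cong[OF refl], subst adj_t) (use assms j in auto)
      finally show ?thesis using j by auto
    qed
    have "(\<Sum>l=1..Suc m. adj (Suc m) m l z * comm (?T l j) (a m y))
       + (\<Sum>s=1..m. adj (Suc m) m s z * (\<Sum>l=1..m. adj m s l y * ?T l j))
       = (if j \<le> m then adj m m j y * a (Suc m) z else 0)"
    proof (cases "j \<le> m")
      case True
      then have j': "j \<in> {1..m}" using j by auto
      have T0: "comm (?T l j) (a m y) = 0" if "l \<in> {1..m}" for l
        using a_commute_t[OF m(2) that j', of y "z - 1"] by (simp add: comm_def T_def m algebra_simps)
      have "(\<Sum>l=1..Suc m. adj (Suc m) m l z * comm (?T l j) (a m y))
         = adj (Suc m) m (Suc m) z * (\<Sum>s=1..m. E (Suc m) s * adj m s j y)"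
      proof -
        have "(\<Sum>l=1..m. adj (Suc m) m l z * comm (?T l j) (a m y)) = 0"
          by (rule sum.neutral) (simp add: T0)
        then show ?thesis using True comm_row_a[OF assms(2) j'] by (simp add: T_off_diagonal)
      qed
      moreover have "(\<Sum>s=1..m. adj (Suc m) m s z * (\<Sum>l=1..m. adj m s l y * ?T l j))
         = (\<Sum>s=1..m. adj (Suc m) m s z * (\<Sum>l=1..m. ?T s l * adj m l j y))"
        by (rule sum.cong[OF refl]) (use j' m in \<open>simp add: T_Suc_adj adj_T_Suc\<close>)
      moreover have "\<dots> = (\<Sum>l=1..m. (\<Sum>s=1..m. adj (Suc m) m s z * ?T s l) * adj m l j y)"
        by (rule sum_product_assoc)
      moreover have "\<dots> = (\<Sum>l=1..m. (if l = m then a (Suc m) z * adj m m j y else 0)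
           - adj (Suc m) m (Suc m) z * (E (Suc m) l * adj m l j y))"
      proof (rule sum.cong[OF refl])
        fix l assume l: "l \<in> {1..m}"
        have "(\<Sum>s=1..m. adj (Suc m) m s z * ?T s l) + adj (Suc m) m (Suc m) z * E (Suc m) l = (if m = l then a (Suc m) z else 0)"
          using adj_t[of "Suc m" m l z] l assms by (simp add: T_off_diagonal)
        then have "(\<Sum>s=1..m. adj (Suc m) m s z * ?T s l) = (if m = l then a (Suc m) z else 0) - adj (Suc m) m (Suc m) z * E (Suc m) l"
          by (simp only: eq_diff_eq)
        then show "(\<Sum>s=1..m. adj (Suc m) m s z * ?T s l) * adj m l j y = (if l = m then a (Suc m) z * adj m m j y else 0)
           - adj (Suc m) m (Suc m) z * (E (Suc m) l * adj m l j y)"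
          by (auto simp: left_diff_distrib mult.assoc)
      qed
      moreover have "adj m m j y * a (Suc m) z = a (Suc m) z * adj m m j y"
      proof (rule comm_eq_0D, rule comm_eq_0_swap, rule comm_adj_zero)
        show "centralizes m (a (Suc m) z)"
          by (rule centralizes_mono[OF centralizes_a]) (use assms in auto)
      qed (use m j' in auto)
      ultimately show ?thesis
        using True m by (simp add: sum_subtractf sum_distrib_left)
    next
      case False
      then have j': "j = Suc m" using j by auto
      have T1: "comm (?T l j) (a m y) = - (\<Sum>s=1..m. adj m l s y * E s (Suc m))" if "l \<in> {1..m}" for l
        using that comm_a_column[OF assms(2) that, of y] comm_swap[of "E l (Suc m)" "a m y"]
        by (simp add: j' T_off_diagonal)
      have "centralizes m (E (Suc m) (Suc m))" by (rule centralizes_E) (use assms in auto)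
      then have T2: "comm (?T (Suc m) j) (a m y) = 0"
        using comm_a_zero[of m _ m] comm_a_zero[OF centralizes_k, of m] m
        by (simp add: j' T_def t_def comm_add_left)
      show ?thesis
      proof -
        have "(\<Sum>l=1..m. adj (Suc m) m l z * comm (?T l j) (a m y))
          = - (\<Sum>l=1..m. adj (Suc m) m l z * (\<Sum>s=1..m. adj m l s y * E s (Suc m)))"
          unfolding sum_negf[symmetric] by (rule sum.cong[OF refl]) (simp add: T1)
        moreover have "(\<Sum>l=1..m. adj m s l y * ?T l j) = (\<Sum>l=1..m. adj m s l y * E l (Suc m))" for s
          by (rule sum.cong[OF refl]) (auto simp: j' T_off_diagonal)
        ultimately show ?thesis using False T2 by simp
      qed
    qed
    then show "(\<Sum>l=1..Suc m. N l z * ?T l j) = 0"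
      unfolding N_def left_diff_distrib sum_subtractf first second third
      by (simp add: algebra_simps)
  qed
  then show ?thesis using m by (simp add: N_def d_def)
qed

text \<open>
  Apply \<open>E (m + 1) m\<close> to the relation \<open>comm_a_b\<close> with \<open>x\<close> and \<open>y\<close> exchanged.  This leaves the unwanted terms
  \<open>b(x) c(y) - b(y) c(x)\<close> and \<open>(x - y) [d(x), a(y)]\<close>, which are equal by the previous three lemmas.
\<close>
lemma comm_b_c:
  assumes "1 \<le> m" "Suc m \<le> n"
  shows "k (x - y) * comm (b m x) (c m y) = d m x * a m y - d m y * a m x"
proof -
  let ?f = "E (Suc m) m"
  have aa: "a m x * a m y = a m y * a m x"
    by (rule comm_eq_0D[OF comm_a_a]) (use assms in auto)
  have kf: "comm ?f (k z) = 0" for z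
    using assms by (intro comm_E_k) auto
  have "k (y - x) * comm (a m y) (b m x) = b m x * a m y - b m y * a m x"
    by (rule comm_a_b[OF assms])
  from arg_cong[OF this, of "comm ?f"]
  have "k (y - x) * (comm (c m y) (b m x) + comm (a m y) (d m x - a m x))
    = (d m x - a m x) * a m y + b m x * c m y - ((d m y - a m y) * a m x + b m y * c m x)"
    by (simp add: comm_mult_right comm_diff_right kf comm_jacobi[of ?f] raise_lower assms)
  also have "comm (a m y) (d m x - a m x) = - comm (d m x) (a m y)"
    using comm_swap[of "a m y" "d m x"] comm_eq_0_swap[OF comm_a_a, of m m y x] assms
    by (simp add: comm_diff_right comm_a_a)
  finally have 1: "k (y - x) * comm (c m y) (b m x) = d m x * a m y - d m y * a m x
      + (b m x * c m y - b m y * c m x) + k (y - x) * comm (d m x) (a m y)"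
    by (simp add: algebra_simps aa)
  have "b m x * c m y - b m y * c m x = comm (d m x) (a m y) + k (x - y - 1) * comm (d m x) (a m y)"
  proof -
    define S S' where "S = (\<Sum>s=1..m. adj (Suc m) m s x * adj m s m y)"
      and "S' = (\<Sum>s=1..m. adj m m s y * adj (Suc m) s m x)"
    have "comm (d m x) (a m y) = S - S'"
      unfolding S_def S'_def by (rule comm_d_a[OF assms])
    then have "k (x - y - 1) * comm (d m x) (a m y) = k (x - y - 1) * S - k (x - y - 1) * S'"
      by (simp only: right_diff_distrib)
    moreover have "b m x * c m y = d m x * a m y - a (Suc m) x * a (m - 1) y + k (x - y - 1) * S"
      unfolding S_def by (rule b_times_c[OF assms])
    moreover have "b m y * c m x = a m y * d m x - a (Suc m) x * a (m - 1) y + k (x - y - 1) * S'"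
      unfolding S'_def by (rule b_times_c'[OF assms])
    ultimately show ?thesis by (simp add: comm_def[of "d m x"])
  qed
  also have "\<dots> = k (x - y) * comm (d m x) (a m y)"
    by (simp add: k_diff left_diff_distrib)
  finally have 2: "b m x * c m y - b m y * c m x = k (x - y) * comm (d m x) (a m y)" .
  have "k (x - y) = - k (y - x)" by (simp flip: k_uminus)
  with 1 2 have "k (y - x) * comm (c m y) (b m x) = d m x * a m y - d m y * a m x"
    by simp
  then show ?thesis
    using comm_swap[of "b m x" "c m y"] \<open>k (x - y) = - k (y - x)\<close> by simp
qed

lemma b_c_product:
  assumes "1 \<le> m" "Suc m \<le> n"
  shows "b m u * c m (u - 1) = d m u * a m (u - 1) - a (Suc m) u * a (m - 1) (u - 1)"
  using b_times_c[OF assms, of u "u - 1"] by simp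

text \<open>This differs from \<open>b_c_product\<close> by the value of \<open>[b(u), c(u - 1)]\<close>.\<close>
lemma c_b_product:
  assumes "1 \<le> m" "Suc m \<le> n"
  shows "c m (u - 1) * b m u = d m (u - 1) * a m u - a (Suc m) u * a (m - 1) (u - 1)"
proof -
  have "b m u * c m (u - 1) - c m (u - 1) * b m u = d m u * a m (u - 1) - d m (u - 1) * a m u"
    using comm_b_c[OF assms, of u "u - 1"] by (simp add: comm_def)
  then show ?thesis unfolding b_c_product[OF assms] by (simp add: algebra_simps)
qed

lemma centralizes_b_c:
  assumes "1 \<le> m" "Suc m \<le> n"
  shows "centralizes (m - 1) (b m u)" "centralizes (m - 1) (c m u)"
proof -
  have "centralizes (m - 1) (E m (Suc m))" "centralizes (m - 1) (E (Suc m) m)"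
    by (rule centralizes_E; use assms in simp)+
  moreover have "centralizes (m - 1) (a m u)"
    by (rule centralizes_mono[OF centralizes_a]) (use assms in auto)
  ultimately show "centralizes (m - 1) (b m u)" "centralizes (m - 1) (c m u)"
    unfolding b_def c_def by (auto intro: centralizes_comm)
qed

lemma comm_b_c_zero:
  assumes "centralizes (Suc l) x" "1 \<le> l"
  shows "comm x (b l u) = 0" "comm x (c l u) = 0"
proof -
  have "comm x (a l u) = 0" "comm x (E l (Suc l)) = 0" "comm x (E (Suc l) l) = 0"
    using assms comm_a_zero[OF assms(1), of l] by (auto simp: centralizes_def)
  then show "comm x (b l u) = 0" "comm x (c l u) = 0"
    by (simp_all add: b_def c_def comm_jacobi[of x])
qed

lemma comm_b_b_far:
  assumes "1 \<le> l" "l + 2 \<le> m" "Suc m \<le> n"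
  shows "comm (b m x) (b l y) = 0" "comm (c m x) (c l y) = 0"
proof -
  have *: "Suc l \<le> m - 1" "1 \<le> m" using assms by auto
  show "comm (b m x) (b l y) = 0" "comm (c m x) (c l y) = 0"
    using centralizes_mono[OF centralizes_b_c(1) *(1)] centralizes_mono[OF centralizes_b_c(2) *(1)]
      comm_b_c_zero(1)[OF _ assms(1)] comm_b_c_zero(2)[OF _ assms(1)] assms * by blast+
qed

text \<open>
  The generator with the smaller index lies in a subalgebra that commutes with the other one; for \<open>l = m - 1\<close> this
  includes \<open>E l (l + 1)\<close>, respectively \<open>E (m + 1) m\<close>, which has to be checked separately.
\<close>
lemma comm_b_c_distinct:
  assumes "1 \<le> l" "1 \<le> m" "Suc l \<le> n" "Suc m \<le> n" "l \<noteq> m"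
  shows "comm (b l x) (c m y) = 0"
proof -
  consider "l < m" | "m < l" using assms by linarith
  then show ?thesis
  proof cases
    case 1
    have "comm (c m y) (a l x) = 0"
      by (rule comm_a_zero[OF centralizes_b_c(2), of _ l]) (use assms 1 in auto)
    moreover have "comm (c m y) (E l (Suc l)) = 0"
    proof -
      have "comm (E l (Suc l)) (E (Suc m) m) = 0" using assms 1 by (subst comm_E) auto
      moreover have "comm (E l (Suc l)) (a m y) = 0"
        by (rule comm_E_a_zero) (use assms 1 in auto)
      ultimately have "comm (E l (Suc l)) (c m y) = 0"
        by (simp add: c_def comm_jacobi[of "E l (Suc l)"])
      then show ?thesis by (rule comm_eq_0_swap)
    qed
    ultimately have "comm (c m y) (b l x) = 0"
      by (simp add: b_def comm_jacobi[of "c m y"])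
    then show ?thesis by (rule comm_eq_0_swap)
  next
    case 2
    have "comm (b l x) (a m y) = 0"
      by (rule comm_a_zero[OF centralizes_b_c(1), of _ m]) (use assms 2 in auto)
    moreover have "comm (b l x) (E (Suc m) m) = 0"
    proof -
      have "comm (E (Suc m) m) (E l (Suc l)) = 0" using assms 2 by (subst comm_E) auto
      moreover have "comm (E (Suc m) m) (a l x) = 0"
        by (rule comm_E_a_zero) (use assms 2 in auto)
      ultimately have "comm (E (Suc m) m) (b l x) = 0"
        by (simp add: b_def comm_jacobi[of "E (Suc m) m"])
      then show ?thesis by (rule comm_eq_0_swap)
    qed
    ultimately show ?thesis by (simp add: c_def comm_jacobi[of "b l x"])
  qed
qed

lemma comm_a_b_c_distinct:
  assumes "1 \<le> m" "Suc m \<le> n" "l \<le> n" "l \<noteq> m"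
  shows "comm (a l x) (b m y) = 0" "comm (a l x) (c m y) = 0"
proof -
  consider "l \<le> m - 1" | "Suc m \<le> l" using assms by linarith
  then have "comm (a l x) (b m y) = 0 \<and> comm (a l x) (c m y) = 0"
  proof cases
    case 1
    then show ?thesis
      using comm_a_zero[OF centralizes_b_c(1)] comm_a_zero[OF centralizes_b_c(2)] assms comm_eq_0_swap
      by blast
  next
    case 2
    then show ?thesis
      using comm_b_c_zero[OF centralizes_mono[OF centralizes_a]] assms by blast
  qed
  then show "comm (a l x) (b m y) = 0" "comm (a l x) (c m y) = 0" by auto
qed

text \<open>
  The corner of \<open>adj (m + 1)\<close> is \<open>a m\<close>, and multiplication by \<open>T\<close> preserves the top coefficient; so \<open>a (m + 1)\<close>
  inherits the leading coefficient \<open>1\<close> from \<open>a m\<close>.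
\<close>
lemma polytop_a:
  assumes "m \<le> n"
  shows "polytop m 1 (a m)"
  using assms
proof (induction m)
  case 0
  then show ?case using polytop_const[of 1] by simp
next
  case (Suc m)
  have "\<exists>e. polytop m e (adj (Suc m) (Suc m) s)" if "s \<in> {1..Suc m}" for s
    using polytop_adj_ex[of "Suc m" "Suc m" s] that Suc.prems by simp
  then obtain e where e: "\<And>s. s \<in> {1..Suc m} \<Longrightarrow> polytop m (e s) (adj (Suc m) (Suc m) s)"
    by metis
  have "adj (Suc m) (Suc m) (Suc m) = a m"
    using adj_corner[of "Suc m"] Suc.prems by auto
  then have "e (Suc m) = 1"
    using e[of "Suc m"] Suc by (auto intro: polytop_unique)
  moreover have "polytop (Suc m) (e (Suc m)) (\<lambda>z. \<Sum>s=1..Suc m. adj (Suc m) (Suc m) s z * t s (Suc m) (z - of_nat m))"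
    by (rule polytop_row_times_t) (use e Suc.prems in auto)
  moreover have "(\<Sum>s=1..Suc m. adj (Suc m) (Suc m) s z * t s (Suc m) (z - of_nat m)) = a (Suc m) z" for z
    using adj_t[of "Suc m" "Suc m" "Suc m" z] Suc.prems by (simp add: T_def)
  ultimately show ?case by simp
qed

lemma polytop_adj:
  assumes "m \<le> n" "i \<in> {1..m}" "s \<in> {1..m}"
  shows "polytop (m - 1) (if i = s then 1 else 0) (adj m i s)"
proof -
  obtain e where e: "\<And>s. s \<in> {1..m} \<Longrightarrow> polytop (m - 1) (e s) (adj m i s)"
    using polytop_adj_ex[OF assms(1,2)] by metis
  have "polytop (Suc (m - 1)) (e s) (\<lambda>z. \<Sum>r=1..m. adj m i r z * t r s (z - of_nat (m - 1)))"
    by (rule polytop_row_times_t) (use e assms in auto)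
  then have "polytop m (e s) (\<lambda>z. if i = s then a m z else 0)"
    using adj_t[OF assms] assms by (simp add: T_def)
  then have "e s = (if i = s then 1 else 0)"
    using polytop_a[OF assms(1)] polytop_zero polytop_unique by (cases "i = s") auto
  then show ?thesis using e[OF assms(3)] by simp
qed

lemma polytop_b:
  assumes "1 \<le> m" "Suc m \<le> n"
  shows "polytop (m - 1) (E m (Suc m)) (b m)"
proof -
  have "polytop (m - 1) (\<Sum>s=1..m. (if m = s then 1 else 0) * E s (Suc m))
    (\<lambda>z. \<Sum>s=1..m. adj m m s z * E s (Suc m))"
    using assms by (intro polytop_sum polytop_mult_right polytop_adj) (auto simp: k_E)
  also have "(\<Sum>s=1..m. (if m = s then 1 else 0) * E s (Suc m)) = (\<Sum>s=1..m. if s = m then E m (Suc m) else 0)"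
    by (rule sum.cong) auto
  also have "(\<lambda>z. \<Sum>s=1..m. adj m m s z * E s (Suc m)) = b m"
    using assms by (simp add: b_eq_adj fun_eq_iff)
  finally show ?thesis using assms by simp
qed

lemma polytop_c:
  assumes "1 \<le> m" "Suc m \<le> n"
  shows "polytop (m - 1) (E (Suc m) m) (c m)"
proof -
  have "polytop (m - 1) (\<Sum>s=1..m. E (Suc m) s * (if s = m then 1 else 0))
    (\<lambda>z. \<Sum>s=1..m. E (Suc m) s * adj m s m z)"
    using assms by (intro polytop_sum polytop_mult_left polytop_adj) (auto simp: k_E)
  also have "(\<Sum>s=1..m. E (Suc m) s * (if s = m then 1 else 0)) = (\<Sum>s=1..m. if s = m then E (Suc m) m else 0)"
    by (rule sum.cong) auto
  also have "(\<lambda>z. \<Sum>s=1..m. E (Suc m) s * adj m s m z) = c m"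
    using assms by (simp add: c_eq_adj fun_eq_iff)
  finally show ?thesis using assms by simp
qed

lemma b_eq_D:
  assumes "1 \<le> m" "Suc m \<le> n"
  shows "b m u = D m id (id(m := Suc m)) u"
  using comm_E_a_eq[of m "Suc m" m u] raise_lower(1)[OF assms, of u] assms by simp

lemma c_eq_D:
  assumes "1 \<le> m" "Suc m \<le> n"
  shows "c m u = D m (id(m := Suc m)) id u"
  using comm_E_a_eq[of "Suc m" m m u] assms by (simp add: c_def)

end


section \<open>Additive endomorphisms\<close>

typedef (overloaded) ('v::ab_group_add) endo = "{f :: 'v \<Rightarrow> 'v. \<forall>x y. f (x + y) = f x + f y}"
  morphisms ap Endo
  by (rule exI[of _ id]) simp

setup_lifting type_definition_endo

instantiation endo :: (ab_group_add) "{ring, monoid_mult}"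
begin

lift_definition zero_endo :: "'a endo" is "\<lambda>_. 0" by simp
lift_definition one_endo :: "'a endo" is "\<lambda>v. v" by simp
lift_definition plus_endo :: "'a endo \<Rightarrow> 'a endo \<Rightarrow> 'a endo" is "\<lambda>f g v. f v + g v"
  by (simp add: algebra_simps)
lift_definition minus_endo :: "'a endo \<Rightarrow> 'a endo \<Rightarrow> 'a endo" is "\<lambda>f g v. f v - g v"
  by (simp add: algebra_simps)
lift_definition uminus_endo :: "'a endo \<Rightarrow> 'a endo" is "\<lambda>f v. - f v"
  by simp
lift_definition times_endo :: "'a endo \<Rightarrow> 'a endo \<Rightarrow> 'a endo" is "\<lambda>f g v. f (g v)"
  by simp

instance
  by standard (transfer; simp add: fun_eq_iff algebra_simps)+

end

lemmas ap_simps [simp] = zero_endo.rep_eq one_endo.rep_eq plus_endo.rep_eq minus_endo.rep_eq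
  uminus_endo.rep_eq times_endo.rep_eq

lemma ap_add: "ap f (x + y) = ap f x + ap f y"
  using ap[of f] by simp

lemma ap_zero [simp]: "ap f 0 = 0"
  using ap_add[of f 0 0] by simp

lemma ap_sum_left: "ap (\<Sum>i\<in>A. f i) v = (\<Sum>i\<in>A. ap (f i) v)"
  by (induction A rule: infinite_finite_induct) auto

lemma ap_sum_right: "ap f (\<Sum>i\<in>A. v i) = (\<Sum>i\<in>A. ap f (v i))"
  by (induction A rule: infinite_finite_induct) (auto simp: ap_add)


section \<open>Modules as representations of the free algebra\<close>

text \<open>
  The operators \<open>opr V i j\<close> with indices outside \<open>{1..n}\<close> are arbitrary functions; \<open>act_E\<close> replaces them by \<open>0\<close>, so that
  \<open>act_free\<close> is multiplicative on the whole free algebra.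
\<close>
definition act_scl :: "'v::ab_group_add gl_mod \<Rightarrow> complex \<Rightarrow> 'v endo" where
  "act_scl V z = Endo (scl V z)"

definition act_E :: "nat \<Rightarrow> 'v::ab_group_add gl_mod \<Rightarrow> nat \<Rightarrow> nat \<Rightarrow> 'v endo" where
  "act_E n V i j = (if i \<in> {1..n} \<and> j \<in> {1..n} then Endo (opr V i j) else 0)"

definition act_word :: "nat \<Rightarrow> 'v::ab_group_add gl_mod \<Rightarrow> (nat \<times> nat) fword \<Rightarrow> 'v endo" where
  "act_word n V w = prod_list (map (\<lambda>(i, j). act_E n V i j) (letters w))"

definition act_free :: "nat \<Rightarrow> 'v::ab_group_add gl_mod \<Rightarrow> free_gl \<Rightarrow> 'v endo" where
  "act_free n V f = (\<Sum>w\<in>Poly_Mapping.keys f. act_scl V (Poly_Mapping.lookup f w) * act_word n V w)"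

locale gl_mod =
  fixes n :: nat and V :: "'v::ab_group_add gl_mod"
  assumes gl_module: "gl_module n V"
begin

lemma vector_space: "vector_space (scl V)"
  using gl_module by (simp add: gl_module_def)

sublocale vs: vector_space "scl V"
  by (rule vector_space)

lemma opr_linear: "i \<in> {1..n} \<Longrightarrow> j \<in> {1..n} \<Longrightarrow> Vector_Spaces.linear (scl V) (scl V) (opr V i j)"
  using gl_module by (simp add: gl_module_def)

lemma opr_add: "i \<in> {1..n} \<Longrightarrow> j \<in> {1..n} \<Longrightarrow> opr V i j (x + y) = opr V i j x + opr V i j y"
  and opr_scale: "i \<in> {1..n} \<Longrightarrow> j \<in> {1..n} \<Longrightarrow> opr V i j (scl V z x) = scl V z (opr V i j x)"
  using opr_linear[of i j] unfolding Vector_Spaces.linear_iff by blast+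

abbreviation "k \<equiv> act_scl V"
abbreviation "E \<equiv> act_E n V"

lemma ap_k [simp]: "ap (k z) v = scl V z v"
  unfolding act_scl_def by (subst Endo_inverse) (auto simp: vs.scale_right_distrib)

lemma ap_E: "i \<in> {1..n} \<Longrightarrow> j \<in> {1..n} \<Longrightarrow> ap (E i j) v = opr V i j v"
  unfolding act_E_def by (simp add: Endo_inverse opr_add)

lemma endo_eqI: "(\<And>v. ap f v = ap g v) \<Longrightarrow> f = g"
  by (metis ap_inject ext)

sublocale gl_family n k E
proof
  fix x y z :: complex and i j p q
  show "k (x + y) = k x + k y" by (rule endo_eqI) (simp add: vs.scale_left_distrib)
  show "k (x * y) = k x * k y" by (rule endo_eqI) simp
  show "k 1 = 1" by (rule endo_eqI) simp
  assume i: "i \<in> {1..n}" and j: "j \<in> {1..n}"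
  then show "comm (k z) (E i j) = 0"
    by (intro endo_eqI) (simp only: comm_def ap_simps ap_k ap_E opr_scale diff_self)
  assume p: "p \<in> {1..n}" and q: "q \<in> {1..n}"
  have "opr V i j (opr V p q v) - opr V p q (opr V i j v)
          = (if j = p then opr V i q v else 0) - (if i = q then opr V p j v else 0)" for v
    using gl_module i j p q unfolding gl_module_def by blast
  then show "comm (E i j) (E p q) = (if j = p then E i q else 0) - (if i = q then E p j else 0)"
    using i j p q by (intro endo_eqI) (auto simp only: comm_def ap_simps ap_E split: if_split)
qed

lemma comm_k_E_any: "comm (k z) (E i j) = 0"
  using k_E[of i j z] by (cases "i \<in> {1..n} \<and> j \<in> {1..n}") (auto simp: act_E_def)

lemma comm_k_word: "comm (k z) (act_word n V w) = 0"
  unfolding act_word_def by (rule comm_prod_list_eq_0) (auto simp: comm_k_E_any)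

lemma act_word_zero [simp]: "act_word n V 0 = 1"
  by (simp add: act_word_def zero_fword_def)

lemma act_word_add: "act_word n V (v + w) = act_word n V v * act_word n V w"
  by (simp add: act_word_def plus_fword_def)

lemma act_free_superset:
  assumes "finite S" "Poly_Mapping.keys f \<subseteq> S"
  shows "act_free n V f = (\<Sum>w\<in>S. k (Poly_Mapping.lookup f w) * act_word n V w)"
  unfolding act_free_def by (rule sum.mono_neutral_left) (use assms in \<open>auto simp: in_keys_iff\<close>)

lemma act_free_add: "act_free n V (f + g) = act_free n V f + act_free n V g"
proof -
  let ?S = "Poly_Mapping.keys f \<union> Poly_Mapping.keys g"
  have "finite ?S" by simp
  moreover have "Poly_Mapping.keys (f + g) \<subseteq> ?S" by (rule Poly_Mapping.keys_add)
  ultimately show ?thesis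
    by (simp add: act_free_superset[of ?S] lookup_add k_add distrib_right sum.distrib)
qed

lemma act_free_zero [simp]: "act_free n V 0 = 0"
  by (simp add: act_free_def)

lemma act_free_single: "act_free n V (Poly_Mapping.single w z) = k z * act_word n V w"
  by (subst act_free_superset[of "{w}"]) auto

lemma act_free_uminus: "act_free n V (- f) = - act_free n V f"
  using act_free_add[of f "- f"] by (simp add: eq_neg_iff_add_eq_0 add.commute)

lemma act_free_diff: "act_free n V (f - g) = act_free n V f - act_free n V g"
  using act_free_add[of f "- g"] by (simp add: act_free_uminus)

lemma act_free_one [simp]: "act_free n V 1 = 1"
  using act_free_single[of 0 1] by simp

lemma act_free_sum: "act_free n V (\<Sum>i\<in>A. f i) = (\<Sum>i\<in>A. act_free n V (f i))"
  by (induction A rule: infinite_finite_induct) (auto simp: act_free_add)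

lemma free_gl_induct [case_names single add]:
  fixes f :: free_gl
  assumes "\<And>w z. P (Poly_Mapping.single w z)" "\<And>f g. P f \<Longrightarrow> P g \<Longrightarrow> P (f + g)"
  shows "P f"
proof -
  have sum: "P (\<Sum>w\<in>S. Poly_Mapping.single w (Poly_Mapping.lookup f w))" if "finite S" for S
    using that
  proof (induction S rule: finite_induct)
    case empty
    show ?case using assms(1)[of 0 0] by simp
  qed (simp add: assms)
  have "f = (\<Sum>w\<in>Poly_Mapping.keys f. Poly_Mapping.single w (Poly_Mapping.lookup f w))"
    by (rule poly_mapping_eqI) (simp add: lookup_sum lookup_single when_def in_keys_iff)
  then show ?thesis using sum[of "Poly_Mapping.keys f"] by simp
qed

lemma act_free_mult: "act_free n V (f * g) = act_free n V f * act_free n V g"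
proof (induction f rule: free_gl_induct)
  case (single w z)
  show ?case
  proof (induction g rule: free_gl_induct)
    case (single w' z')
    have "act_word n V w * k z' = k z' * act_word n V w"
      using comm_eq_0D[OF comm_k_word] by metis
    then show ?case
      by (simp add: mult_single act_free_single k_mult act_word_add) (metis mult.assoc)
  qed (simp add: act_free_add distrib_left)
qed (simp add: act_free_add distrib_right)

lemma act_free_prod_list: "act_free n V (prod_list xs) = prod_list (map (act_free n V) xs)"
  by (induction xs) (simp_all add: act_free_mult)

lemma act_free_cst: "act_free n V (cst z) = k z"
  by (simp add: cst_def act_free_single)

lemma act_free_gen: "act_free n V (gen i j) = E i j"
  by (simp add: gen_def act_free_single act_word_def)

lemma act_free_T: "act_free n V (T_gl i j u) = t j i u"
  by (auto simp: T_gl_def t_def act_free_add act_free_cst act_free_gen)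

lemma act_free_sign: "act_free n V (of_int (sign \<sigma>)) = k (of_int (sign \<sigma>))"
  by (cases \<sigma> rule: sign_cases) (simp_all add: act_free_uminus k_uminus)

lemma act_free_qdet:
  "act_free n V (qdet m (\<lambda>r s. T_gl (\<beta> r) (\<alpha> s)) u) = D m \<alpha> \<beta> u"
  unfolding qdet_def D_def act_free_sum
  by (simp only: act_free_mult act_free_sign act_free_prod_list map_map o_def act_free_T)

lemma act_free_a: "act_free n V (a_gen m u) = a m u"
  using act_free_qdet[of m id id u] by (simp add: a_gen_def a_def)

lemma act_free_b:
  assumes "1 \<le> m" "Suc m \<le> n"
  shows "act_free n V (b_gen m u) = b m u"
  using act_free_qdet[of m "id(m := Suc m)" id u] unfolding b_eq_D[OF assms]
  by (simp add: b_gen_def fun_upd_def Suc_eq_plus1[symmetric] cong: if_cong)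

lemma act_free_c: "1 \<le> m \<Longrightarrow> Suc m \<le> n \<Longrightarrow> act_free n V (c_gen m u) = c m u"
  using act_free_qdet[of m id "id(m := Suc m)" u]
  by (simp add: c_gen_def Suc_eq_plus1[symmetric] c_eq_D fun_upd_def cong: if_cong)

lemma free_act_eq:
  assumes "f \<in> carrier (free_alg n)"
  shows "free_act V f v = ap (act_free n V f) v"
proof -
  have word: "foldr (\<lambda>(i, j). opr V i j) xs v = ap (prod_list (map (\<lambda>(i, j). E i j) xs)) v"
    if "set xs \<subseteq> {1..n} \<times> {1..n}" for xs
    using that by (induction xs) (auto simp: ap_E)
  show ?thesis
    unfolding free_act_def act_free_def ap_sum_left
    using assms by (intro sum.cong refl) (simp add: free_alg_def act_word_def word)
qed

end


section \<open>The enveloping algebra and the Gelfand-Tsetlin subalgebra\<close>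

lemma (in ring) ideal_closedI:
  assumes "I \<subseteq> carrier R" "\<zero> \<in> I" "\<And>x y. \<lbrakk>x \<in> I; y \<in> I\<rbrakk> \<Longrightarrow> x \<oplus> y \<in> I"
    and l: "\<And>a x. \<lbrakk>a \<in> I; x \<in> carrier R\<rbrakk> \<Longrightarrow> x \<otimes> a \<in> I"
    and r: "\<And>a x. \<lbrakk>a \<in> I; x \<in> carrier R\<rbrakk> \<Longrightarrow> a \<otimes> x \<in> I"
  shows "ideal I R"
proof (rule idealI[OF ring_axioms _ l r])
  show "subgroup I (add_monoid R)"
  proof (rule add.subgroupI)
    fix x assume x: "x \<in> I"
    then have "(\<ominus> \<one>) \<otimes> x \<in> I" by (intro l) auto
    then show "\<ominus> x \<in> I" using x assms(1) by (simp add: l_minus subset_iff)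
  qed (use assms in auto)
qed

lemma free_alg_simps [simp]:
  "mult (free_alg n) = (*)" "one (free_alg n) = 1" "zero (free_alg n) = 0" "add (free_alg n) = (+)"
  by (simp_all add: free_alg_def)

lemma free_alg_carrier:
  "f \<in> carrier (free_alg n) \<longleftrightarrow> (\<forall>w\<in>Poly_Mapping.keys f. set (letters w) \<subseteq> {1..n} \<times> {1..n})"
  by (simp add: free_alg_def)

lemma carrier_add: "f \<in> carrier (free_alg n) \<Longrightarrow> g \<in> carrier (free_alg n) \<Longrightarrow> f + g \<in> carrier (free_alg n)"
  using Poly_Mapping.keys_add[of f g] unfolding free_alg_carrier by blast

lemma carrier_uminus: "f \<in> carrier (free_alg n) \<Longrightarrow> - f \<in> carrier (free_alg n)"
  unfolding free_alg_carrier by simp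

lemma carrier_diff: "f \<in> carrier (free_alg n) \<Longrightarrow> g \<in> carrier (free_alg n) \<Longrightarrow> f - g \<in> carrier (free_alg n)"
  using carrier_add[of f n "- g"] carrier_uminus by simp

lemma carrier_mult:
  assumes "f \<in> carrier (free_alg n)" "g \<in> carrier (free_alg n)"
  shows "f * g \<in> carrier (free_alg n)"
  unfolding free_alg_carrier
proof
  fix w assume "w \<in> Poly_Mapping.keys (f * g)"
  then obtain v v' where "w = v + v'" "v \<in> Poly_Mapping.keys f" "v' \<in> Poly_Mapping.keys g"
    using Poly_Mapping.keys_mult[of f g] by auto
  then show "set (letters w) \<subseteq> {1..n} \<times> {1..n}"
    using assms unfolding free_alg_carrier by (simp add: plus_fword_def)
qed

lemma carrier_cst [simp]: "cst z \<in> carrier (free_alg n)"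
  by (simp add: free_alg_carrier cst_def zero_fword_def)

lemma carrier_zero [simp]: "0 \<in> carrier (free_alg n)"
  by (simp add: free_alg_carrier)

lemma carrier_one [simp]: "1 \<in> carrier (free_alg n)"
  by (simp add: free_alg_carrier zero_fword_def)

lemma carrier_gen: "i \<in> {1..n} \<Longrightarrow> j \<in> {1..n} \<Longrightarrow> gen i j \<in> carrier (free_alg n)"
  by (simp add: free_alg_carrier gen_def)

lemma carrier_sum: "(\<And>i. i \<in> A \<Longrightarrow> f i \<in> carrier (free_alg n)) \<Longrightarrow> (\<Sum>i\<in>A. f i) \<in> carrier (free_alg n)"
  by (induction A rule: infinite_finite_induct) (auto intro: carrier_add)

lemma carrier_prod_list: "(\<And>f. f \<in> set fs \<Longrightarrow> f \<in> carrier (free_alg n)) \<Longrightarrow> prod_list fs \<in> carrier (free_alg n)"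
  by (induction fs) (auto intro: carrier_mult)

lemma carrier_T: "i \<in> {1..n} \<Longrightarrow> j \<in> {1..n} \<Longrightarrow> T_gl i j u \<in> carrier (free_alg n)"
  unfolding T_gl_def by (auto intro!: carrier_add carrier_gen)

lemma carrier_qdet:
  assumes "\<And>r s u. r \<in> {1..m} \<Longrightarrow> s \<in> {1..m} \<Longrightarrow> X r s u \<in> carrier (free_alg n)"
  shows "qdet m X u \<in> carrier (free_alg n)"
  unfolding qdet_def
proof (intro carrier_sum carrier_mult carrier_prod_list)
  fix \<sigma> assume "\<sigma> \<in> {\<sigma>. \<sigma> permutes {1..m}}"
  then have \<sigma>: "\<sigma> permutes {1..m}" by simp
  show "of_int (sign \<sigma>) \<in> carrier (free_alg n)"
    by (cases \<sigma> rule: sign_cases) (auto intro: carrier_uminus)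
  fix f assume "f \<in> set (map (\<lambda>r. X r (\<sigma> r) (u - of_nat (r - 1))) [1..<m + 1])"
  then obtain r where "r \<in> set [1..<m + 1]" "f = X r (\<sigma> r) (u - of_nat (r - 1))"
    unfolding set_map by blast
  moreover from this have "r \<in> {1..m}" by auto
  ultimately show "f \<in> carrier (free_alg n)"
    using assms permutes_in_image[OF \<sigma>] by blast
qed

lemma carrier_a_gen: "m \<le> n \<Longrightarrow> a_gen m u \<in> carrier (free_alg n)"
  unfolding a_gen_def by (intro carrier_qdet carrier_T) auto

lemma carrier_b_gen: "Suc m \<le> n \<Longrightarrow> b_gen m u \<in> carrier (free_alg n)"
  unfolding b_gen_def by (intro carrier_qdet carrier_T) auto

lemma carrier_c_gen: "Suc m \<le> n \<Longrightarrow> c_gen m u \<in> carrier (free_alg n)"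
  unfolding c_gen_def by (intro carrier_qdet carrier_T) auto

lemma ring_free_alg: "ring (free_alg n)"
proof (rule ringI)
  show "abelian_group (free_alg n)"
  proof (rule abelian_groupI)
    fix f assume "f \<in> carrier (free_alg n)"
    then show "\<exists>g\<in>carrier (free_alg n). g \<oplus>\<^bsub>free_alg n\<^esub> f = \<zero>\<^bsub>free_alg n\<^esub>"
      by (intro bexI[of _ "- f"]) (auto intro: carrier_uminus)
  qed (auto simp: add.assoc add.commute intro: carrier_add)
  show "Group.monoid (free_alg n)"
    by (rule monoidI) (auto simp: mult.assoc intro: carrier_mult)
qed (auto simp: algebra_simps)

definition gl_relators :: "nat \<Rightarrow> free_gl set" where
  "gl_relators n = {gen i j * gen k l - gen k l * gen i j
        - ((if j = k then gen i l else 0) - (if i = l then gen k j else 0)) | i j k l.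
      i \<in> {1..n} \<and> j \<in> {1..n} \<and> k \<in> {1..n} \<and> l \<in> {1..n}}"

lemma gl_relators_carrier: "gl_relators n \<subseteq> carrier (free_alg n)"
  unfolding gl_relators_def
  by (auto intro!: carrier_diff carrier_add carrier_mult carrier_gen carrier_uminus simp del: atLeastAtMost_iff)

lemma ideal_gl_ideal: "ideal (gl_ideal n) (free_alg n)"
  unfolding gl_ideal_def gl_relators_def[symmetric]
  by (rule ring.genideal_ideal[OF ring_free_alg gl_relators_carrier])

lemma ring_U: "ring (U_gl n)"
  unfolding U_gl_def by (rule ideal.quotient_is_ring[OF ideal_gl_ideal])

lemma cls_hom: "cls n \<in> ring_hom (free_alg n) (U_gl n)"
  unfolding U_gl_def cls_def using ideal.rcos_ring_hom[OF ideal_gl_ideal] by simp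

lemma cls_closed: "f \<in> carrier (free_alg n) \<Longrightarrow> cls n f \<in> carrier (U_gl n)"
  by (rule ring_hom_closed[OF cls_hom])

lemma U_carrierE:
  assumes "x \<in> carrier (U_gl n)"
  obtains f where "f \<in> carrier (free_alg n)" "x = cls n f"
  using assms unfolding U_gl_def FactRing_def cls_def A_RCOSETS_def' by auto

lemma cls_mult: "\<lbrakk>f \<in> carrier (free_alg n); g \<in> carrier (free_alg n)\<rbrakk> \<Longrightarrow>
    cls n f \<otimes>\<^bsub>U_gl n\<^esub> cls n g = cls n (f * g)"
  using ring_hom_mult[OF cls_hom] by fastforce

lemma cls_add: "\<lbrakk>f \<in> carrier (free_alg n); g \<in> carrier (free_alg n)\<rbrakk> \<Longrightarrow>
    cls n f \<oplus>\<^bsub>U_gl n\<^esub> cls n g = cls n (f + g)"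
  using ring_hom_add[OF cls_hom] by fastforce

lemma cls_one: "cls n 1 = \<one>\<^bsub>U_gl n\<^esub>"
  using ring_hom_one[OF cls_hom] by simp

lemma cls_zero: "cls n 0 = \<zero>\<^bsub>U_gl n\<^esub>"
  using ring_hom_zero[OF cls_hom ring_free_alg ring_U] by simp

lemma gen_subalg_carrier:
  assumes "S \<subseteq> carrier (U_gl n)"
  shows "gen_subalg n S \<subseteq> carrier (U_gl n)"
    and "subring (gen_subalg n S) (U_gl n)"
proof -
  have "range (\<lambda>z. cls n (cst z)) \<union> S \<subseteq> carrier (U_gl n)"
    using assms by (auto intro: cls_closed)
  then show "gen_subalg n S \<subseteq> carrier (U_gl n)" "subring (gen_subalg n S) (U_gl n)"
    unfolding gen_subalg_def
    by (rule ring.generate_ring_incl[OF ring_U], rule ring.generate_ring_is_subring[OF ring_U])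
qed

lemma U_sub_carrier: "k \<le> n \<Longrightarrow> U_sub n k \<subseteq> carrier (U_gl n)"
  unfolding U_sub_def by (rule gen_subalg_carrier) (auto intro!: cls_closed carrier_gen)

lemma Gamma_carrier_eq: "carrier (Gamma n) = gen_subalg n (\<Union>k\<in>{1..n}. Z_sub n k)"
  by (simp add: Gamma_def)

lemma Z_sub_carrier: "(\<Union>k\<in>{1..n}. Z_sub n k) \<subseteq> carrier (U_gl n)"
proof
  fix x assume "x \<in> (\<Union>k\<in>{1..n}. Z_sub n k)"
  then obtain k where "k \<le> n" "x \<in> U_sub n k" unfolding Z_sub_def by auto
  then show "x \<in> carrier (U_gl n)" using U_sub_carrier by blast
qed

lemma Gamma_carrier: "carrier (Gamma n) \<subseteq> carrier (U_gl n)"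
  unfolding Gamma_carrier_eq by (rule gen_subalg_carrier[OF Z_sub_carrier])

lemma Gamma_simps [simp]:
  "mult (Gamma n) = mult (U_gl n)" "one (Gamma n) = one (U_gl n)"
  "zero (Gamma n) = zero (U_gl n)" "add (Gamma n) = add (U_gl n)"
  by (simp_all add: Gamma_def)

lemma ring_Gamma: "ring (Gamma n)"
proof -
  have "ring (U_gl n\<lparr>carrier := gen_subalg n (\<Union>k\<in>{1..n}. Z_sub n k)\<rparr>)"
    using ring.subring_iff[OF ring_U gen_subalg_carrier(1)[OF Z_sub_carrier]]
      gen_subalg_carrier(2)[OF Z_sub_carrier] by blast
  then show ?thesis unfolding Gamma_def .
qed

lemma cls_cst_Gamma: "cls n (cst z) \<in> carrier (Gamma n)"
  unfolding Gamma_carrier_eq gen_subalg_def by (rule generate_ring.incl) auto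

definition mL_gens :: "nat \<Rightarrow> tableau \<Rightarrow> free_gl set set" where
  "mL_gens n M = {cls n (a_gen k u - cst (alpha k u M)) | k u. k \<in> {1..n}}"

text \<open>
  As the generators of \<open>mL n L\<close> belong to it, they lie in \<open>\<Gamma>\<close> as soon as \<open>mL n L\<close> does; adding scalars gives the
  elements \<open>a\<^sub>m(u)\<close> themselves.
\<close>
lemma a_gen_Gamma:
  assumes "mL n L \<subseteq> carrier (Gamma n)" "m \<in> {1..n}"
  shows "cls n (a_gen m u) \<in> carrier (Gamma n)"
proof -
  interpret G: ring "Gamma n" by (rule ring_Gamma)
  have "mL_gens n L \<subseteq> mL n L"
    unfolding mL_def mL_gens_def[symmetric] genideal_def by blast
  then have 1: "cls n (a_gen m u - cst (alpha m u L)) \<in> carrier (Gamma n)"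
    using assms unfolding mL_gens_def by blast
  have "cls n (a_gen m u - cst (alpha m u L)) \<oplus>\<^bsub>Gamma n\<^esub> cls n (cst (alpha m u L))
    = cls n (a_gen m u)"
    using assms carrier_a_gen[of m n u] by (simp add: cls_add carrier_diff)
  then show ?thesis using G.a_closed[OF 1 cls_cst_Gamma, of "alpha m u L"] by simp
qed

lemma mL_gens_Gamma:
  assumes "\<And>m u. m \<in> {1..n} \<Longrightarrow> cls n (a_gen m u) \<in> carrier (Gamma n)"
  shows "mL_gens n M \<subseteq> carrier (Gamma n)"
proof -
  interpret G: ring "Gamma n" by (rule ring_Gamma)
  have "cls n (a_gen m u - cst (alpha m u M)) \<in> carrier (Gamma n)" if m: "m \<in> {1..n}" for m u
  proof -
    have "cls n (a_gen m u) \<oplus>\<^bsub>Gamma n\<^esub> cls n (cst (- alpha m u M)) = cls n (a_gen m u + cst (- alpha m u M))"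
      using m carrier_a_gen[of m n u] by (simp add: cls_add)
    moreover have "cst (- z) = - cst z" for z
      by (rule poly_mapping_eqI) (simp add: cst_def lookup_single when_def)
    ultimately show ?thesis
      using G.a_closed[OF assms[OF m] cls_cst_Gamma, of u "- alpha m u M"] by simp
  qed
  then show ?thesis unfolding mL_gens_def by blast
qed

context gl_mod
begin

lemma gl_ideal_acts_zero:
  assumes "g \<in> gl_ideal n"
  shows "g \<in> carrier (free_alg n)" "act_free n V g = 0"
proof -
  interpret F: ring "free_alg n" by (rule ring_free_alg)
  define I where "I = {f \<in> carrier (free_alg n). act_free n V f = 0}"
  have "ideal I (free_alg n)"
    by (rule F.ideal_closedI) (auto simp: I_def act_free_add act_free_mult intro: carrier_add carrier_mult)
  moreover have "gl_relators n \<subseteq> I"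
  proof -
    have "act_free n V f = 0" if f0: "f \<in> gl_relators n" for f
    proof -
      obtain i j p q where f: "f = gen i j * gen p q - gen p q * gen i j
        - ((if j = p then gen i q else 0) - (if i = q then gen p j else 0))"
        and r: "i \<in> {1..n}" "j \<in> {1..n}" "p \<in> {1..n}" "q \<in> {1..n}"
        using f0 unfolding gl_relators_def mem_Collect_eq by (elim exE conjE) (rule that, assumption+)
      have if_act: "act_free n V (if Q then x else 0) = (if Q then act_free n V x else 0)" for Q x
        by simp
      have "act_free n V f = comm (E i j) (E p q) - ((if j = p then E i q else 0) - (if i = q then E p j else 0))"
        by (simp only: f act_free_diff act_free_mult act_free_gen comm_def if_act)
      then show ?thesis by (simp only: comm_E[OF r] diff_self)
    qed
    then show ?thesis using gl_relators_carrier by (auto simp: I_def)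
  qed
  ultimately have "gl_ideal n \<subseteq> I"
    unfolding gl_ideal_def gl_relators_def[symmetric] by (rule F.genideal_minimal)
  then show "g \<in> carrier (free_alg n)" "act_free n V g = 0"
    using assms by (auto simp: I_def)
qed

lemma U_act_cls:
  assumes f: "f \<in> carrier (free_alg n)"
  shows "U_act V (cls n f) v = ap (act_free n V f) v"
proof -
  have "free_act V g v = ap (act_free n V f) v" if "g \<in> cls n f" for g
  proof -
    obtain h where h: "h \<in> gl_ideal n" "g = h + f"
      using \<open>g \<in> cls n f\<close> unfolding cls_def a_r_coset_def' by auto
    then have "g \<in> carrier (free_alg n)"
      using gl_ideal_acts_zero(1) f carrier_add by blast
    then show ?thesis
      using h gl_ideal_acts_zero(2)[OF h(1)] by (simp add: free_act_eq act_free_add)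
  qed
  moreover have "f \<in> cls n f"
    using additive_subgroup.zero_closed[OF ideal.axioms(1)[OF ideal_gl_ideal]] f
    unfolding cls_def a_r_coset_def' by force
  ultimately have "(\<lambda>g. free_act V g v) ` cls n f = {ap (act_free n V f) v}"
    by (auto intro!: image_eqI[of _ _ f])
  then show ?thesis unfolding U_act_def by simp
qed

lemma U_act_mult:
  assumes "x \<in> carrier (U_gl n)" "y \<in> carrier (U_gl n)"
  shows "U_act V (x \<otimes>\<^bsub>U_gl n\<^esub> y) v = U_act V x (U_act V y v)"
  using assms by (elim U_carrierE) (simp add: cls_mult U_act_cls carrier_mult act_free_mult)

lemma U_act_add:
  assumes "x \<in> carrier (U_gl n)" "y \<in> carrier (U_gl n)"
  shows "U_act V (x \<oplus>\<^bsub>U_gl n\<^esub> y) v = U_act V x v + U_act V y v"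
  using assms by (elim U_carrierE) (simp add: cls_add U_act_cls carrier_add act_free_add)

lemma U_act_one: "U_act V \<one>\<^bsub>U_gl n\<^esub> v = v"
  unfolding cls_one[symmetric] by (subst U_act_cls) auto

lemma U_act_zero: "U_act V \<zero>\<^bsub>U_gl n\<^esub> v = 0"
  unfolding cls_zero[symmetric] by (subst U_act_cls) auto

lemma U_act_cst: "U_act V (cls n (cst z)) v = scl V z v"
  by (subst U_act_cls) (auto simp: act_free_cst)

lemma comm_k_act_free: "comm (k z) (act_free n V f) = 0"
  unfolding act_free_def by (simp add: comm_sum_right comm_mult_right comm_k_word)

lemma ap_act_scale: "ap (act_free n V f) (scl V z v) = scl V z (ap (act_free n V f) v)"
  using arg_cong[OF comm_eq_0D[OF comm_k_act_free], of "\<lambda>g. ap g v" z f] by simp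

lemma U_act_linear:
  assumes "x \<in> carrier (U_gl n)"
  shows "U_act V x (v + w) = U_act V x v + U_act V x w" "U_act V x (scl V z v) = scl V z (U_act V x v)"
    "U_act V x 0 = 0" "U_act V x (\<Sum>i\<in>A. f i) = (\<Sum>i\<in>A. U_act V x (f i))"
  using assms by (elim U_carrierE; simp add: U_act_cls ap_add ap_act_scale ap_sum_right)+

lemma U_act_a: "m \<le> n \<Longrightarrow> U_act V (cls n (a_gen m u)) v = ap (a m u) v"
  by (simp add: U_act_cls carrier_a_gen act_free_a)

lemma U_act_b: "1 \<le> m \<Longrightarrow> Suc m \<le> n \<Longrightarrow> U_act V (cls n (b_gen m u)) v = ap (b m u) v"
  by (simp add: U_act_cls carrier_b_gen act_free_b)

lemma U_act_c: "1 \<le> m \<Longrightarrow> Suc m \<le> n \<Longrightarrow> U_act V (cls n (c_gen m u)) v = ap (c m u) v"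
  by (simp add: U_act_cls carrier_c_gen act_free_c)

end


section \<open>Tableaux and eigenvalues\<close>

lemma alpha_poly: "alpha m x M = poly (\<Prod>i=1..m. [:M m i, 1:]) x"
  by (simp add: alpha_def poly_prod add.commute)

lemma alpha_eq_at_puncture:
  assumes "\<And>x. x \<noteq> y \<Longrightarrow> alpha m x M = alpha m x M'"
  shows "alpha m y M = alpha m y M'"
proof -
  define p where "p = (\<Prod>i=1..m. [:M m i, 1:]) - (\<Prod>i=1..m. [:M' m i, 1:])"
  have "poly ([:- y, 1:] * p) x = 0" for x
    using assms[of x] by (cases "x = y") (simp_all add: p_def flip: alpha_poly)
  then have "[:- y, 1:] * p = 0"
    using poly_all_0_iff_0 by blast
  then have "p = 0" by (simp only: mult_eq_0_iff pCons_eq_0_iff one_neq_zero simp_thms)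
  then show ?thesis by (simp add: p_def alpha_poly)
qed

lemma alpha_root: "i \<in> {1..m} \<Longrightarrow> alpha m (- M m i) M = 0"
  unfolding alpha_def by (rule prod_zero) auto

text \<open>
  The entries of the row \<open>m\<close> are the negatives of the roots, so those of \<open>M\<close> occur among those of \<open>M'\<close>; \<open>m\<close> distinct
  values fill the row.
\<close>
lemma alpha_eq_imp_inj:
  assumes "\<And>u. alpha m u M = alpha m u M'" "inj_on (M m) {1..m}"
  shows "inj_on (M' m) {1..m}"
proof (rule eq_card_imp_inj_on)
  have "M m ` {1..m} \<subseteq> M' m ` {1..m}"
  proof
    fix z assume "z \<in> M m ` {1..m}"
    then obtain i where i: "i \<in> {1..m}" "z = M m i" by blast
    then have "alpha m (- z) M' = 0" using assms(1) alpha_root[of i m M] by simp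
    then obtain j where "j \<in> {1..m}" "- z + M' m j = 0" unfolding alpha_def by auto
    then show "z \<in> M' m ` {1..m}" by (intro image_eqI[of _ _ j]) auto
  qed
  then have "card (M m ` {1..m}) \<le> card (M' m ` {1..m})" by (intro card_mono) auto
  then show "card (M' m ` {1..m}) = card {1..m}"
    using card_image[OF assms(2)] card_image_le[of "{1..m}" "M' m"] by simp
qed simp

lemma shift_same [simp]: "shift M m i s m i = M m i + s"
  and shift_other: "(l, j) \<noteq> (m, i) \<Longrightarrow> shift M m i s l j = M l j"
  by (auto simp: shift_def)

lemma alpha_shift_other: "l \<noteq> m \<Longrightarrow> alpha l u (shift M m i s) = alpha l u M"
  by (simp add: alpha_def shift_def)

lemma alpha_shift:
  assumes "i \<in> {1..m}"
  shows "(x + M m i) * alpha m x (shift M m i s) = (x + M m i + s) * alpha m x M"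
proof -
  have "(\<Prod>j\<in>{1..m} - {i}. x + shift M m i s m j) = (\<Prod>j\<in>{1..m} - {i}. x + M m j)"
    by (rule prod.cong) (auto simp: shift_other)
  moreover have "alpha m x N = (x + N m i) * (\<Prod>j\<in>{1..m} - {i}. x + N m j)" for N
    unfolding alpha_def using assms by (subst prod.remove[of _ i]) auto
  ultimately show ?thesis by simp
qed

lemma mL_cong:
  assumes "\<And>m u. m \<in> {1..n} \<Longrightarrow> alpha m u M = alpha m u M'"
  shows "mL n M = mL n M'"
proof -
  have "mL_gens n M = mL_gens n M'" using assms unfolding mL_gens_def by metis
  then show ?thesis by (simp add: mL_def mL_gens_def)
qed

lemma NC_intD:
  assumes "M \<in> NC_int n L" "m \<in> {1..n - 1}" "i \<in> {1..m}" "j \<in> {1..m}" "i \<noteq> j"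
    "L m i - L m j = of_int p" "M m i - M m j = of_int q"
  shows "q \<noteq> 0 \<and> sgn q = sgn p"
  using assms unfolding NC_int_def by blast

lemma NC_int_integral:
  "\<lbrakk>M \<in> NC_int n L; m \<in> {1..n - 1}; i \<in> {1..m}\<rbrakk> \<Longrightarrow> M m i - L m i \<in> \<int>"
  unfolding NC_int_def L_int_def by blast

lemma NC_int_difference:
  assumes "M \<in> NC_int n L" "m \<in> {1..n - 1}" "i \<in> {1..m}" "j \<in> {1..m}" "L m i - L m j = of_int p"
  obtains q :: int where "M m i - M m j = of_int q"
proof -
  have "(M m i - L m i) - (M m j - L m j) + of_int p \<in> \<int>"
    by (intro Ints_add Ints_diff NC_int_integral[OF assms(1,2)] assms(3,4) Ints_of_int)
  then have "(M m i - L m i) - (M m j - L m j) + (L m i - L m j) \<in> \<int>"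
    by (simp only: assms(5))
  then have "M m i - M m j \<in> \<int>" by simp
  then show ?thesis using that by (auto elim: Ints_cases)
qed

lemma NC_int_inj:
  assumes "M \<in> NC_int n L" "m \<in> {1..n - 1}"
  shows "inj_on (M m) {1..m}"
proof (rule inj_onI, rule ccontr)
  fix i j assume ij: "i \<in> {1..m}" "j \<in> {1..m}" "M m i = M m j" "i \<noteq> j"
  have "(M m j - L m j) - (M m i - L m i) \<in> \<int>"
    by (intro Ints_diff NC_int_integral[OF assms] ij)
  then have "L m i - L m j \<in> \<int>" using ij by simp
  then obtain p where "L m i - L m j = of_int p" by (auto elim: Ints_cases)
  then show False using NC_intD[OF assms ij(1,2,4), of p 0] ij(3) by simp
qed

text \<open>
  A shift changes integral differences within a row by at most one.  A nonzero integer that loses its sign this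
  way becomes \<open>0\<close>.
\<close>
lemma NC_int_shift:
  assumes M: "M \<in> NC_int n L" and m: "m \<in> {1..n - 1}" and i: "i \<in> {1..m}"
    and s: "s \<in> {1, -1}" and out: "shift M m i s \<notin> NC_int n L"
  shows "\<not> inj_on (shift M m i s m) {1..m}"
proof -
  let ?S = "shift M m i s"
  obtain s' :: int where s': "s = of_int s'" "\<bar>s'\<bar> = 1"
    using s by (cases "s = 1") (auto intro: that[of 1] that[of "- 1"])
  have "?S \<in> L_int n L"
  proof -
    have 1: "M \<in> tableaux n" "\<And>m i. m \<in> {1..n-1} \<Longrightarrow> i \<in> {1..m} \<Longrightarrow> M m i - L m i \<in> \<int>"
      "\<And>i. i \<in> {1..n} \<Longrightarrow> M n i = L n i"
      using M unfolding NC_int_def L_int_def by blast+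
    have "?S \<in> tableaux n"
      using 1(1) m i unfolding tableaux_def by (auto simp: shift_def)
    moreover have "?S m' i' - L m' i' \<in> \<int>" if "m' \<in> {1..n-1}" "i' \<in> {1..m'}" for m' i'
    proof (cases "(m', i') = (m, i)")
      case True
      have "(M m i - L m i) + s \<in> \<int>" using 1(2)[OF m i] s'(1) by (intro Ints_add) auto
      then show ?thesis using True by (simp add: algebra_simps)
    next
      case False
      then show ?thesis using 1(2)[OF that] by (simp add: shift_other)
    qed
    moreover have "?S n i' = L n i'" if "i' \<in> {1..n}" for i'
      using 1(3)[OF that] m by (auto simp: shift_def)
    ultimately show ?thesis unfolding L_int_def by blast
  qed
  then obtain m' i' j' and p q :: int where *: "m' \<in> {1..n-1}" "i' \<in> {1..m'}" "j' \<in> {1..m'}"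
    "i' \<noteq> j'" "L m' i' - L m' j' = of_int p" "?S m' i' - ?S m' j' = of_int q"
    "\<not> (q \<noteq> 0 \<and> sgn q = sgn p)"
    using out unfolding NC_int_def by blast
  obtain q0 where q0: "M m' i' - M m' j' = of_int q0"
    using NC_int_difference[OF M *(1,2,3,5)] .
  have q0': "q0 \<noteq> 0" "sgn q0 = sgn p"
    using NC_intD[OF M *(1-5) q0] by auto
  have m': "m' = m"
  proof (rule ccontr)
    assume "m' \<noteq> m"
    then have "q = q0" using *(6) q0 by (simp add: shift_other)
    then show False using q0' *(7) by simp
  qed
  have "of_int (q - q0) = (if i' = i then s else if j' = i then - s else 0)"
    using *(4) m' q0 *(6) by (auto simp: shift_def algebra_simps)
  also have "\<dots> = of_int (if i' = i then s' else if j' = i then - s' else 0)"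
    by (simp add: s'(1))
  finally have "q - q0 = (if i' = i then s' else if j' = i then - s' else 0)"
    by (simp only: of_int_eq_iff)
  then have "\<bar>q - q0\<bar> \<le> 1" using s'(2) by auto
  then have "q = 0"
    using q0' *(7) by (auto simp: sgn_if split: if_splits)
  then have "?S m i' = ?S m j'" using *(6) m' by simp
  then show ?thesis using *(2-4) m' unfolding inj_on_def by blast
qed

section \<open>Weight spaces of a tame module\<close>
locale nct_mod = gl_mod n V for n and V :: "'v::ab_group_add gl_mod" +
  fixes L :: tableau
  assumes NCT: "V \<in> NCT n L" and mL_Gamma: "mL n L \<subseteq> carrier (Gamma n)"
begin

sublocale \<Gamma>: ring "Gamma n"
  by (rule ring_Gamma)

lemma \<Gamma>_U: "x \<in> carrier (Gamma n) \<Longrightarrow> x \<in> carrier (U_gl n)"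
  using Gamma_carrier by blast

lemma a_gen_\<Gamma>: "m \<in> {1..n} \<Longrightarrow> cls n (a_gen m u) \<in> carrier (Gamma n)"
  by (rule a_gen_Gamma[OF mL_Gamma])

lemma mL_gens_\<Gamma>: "mL_gens n M \<subseteq> carrier (Gamma n)"
  by (rule mL_gens_Gamma[OF a_gen_\<Gamma>])

lemma mL_ideal: "ideal (mL n M) (Gamma n)" and mL_gens_subset: "mL_gens n M \<subseteq> mL n M"
  unfolding mL_def mL_gens_def[symmetric]
  using \<Gamma>.genideal_ideal[OF mL_gens_\<Gamma>] \<Gamma>.genideal_self[OF mL_gens_\<Gamma>] by auto

definition basis :: "'v set" where
  "basis = (SOME B. \<not> vs.dependent B \<and> vs.span B = UNIV \<and>
     (\<forall>e\<in>B. \<forall>x\<in>carrier (Gamma n). \<exists>z. U_act V x e = scl V z e))"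

lemma basis: "vs.independent basis" "vs.span basis = UNIV"
  "e \<in> basis \<Longrightarrow> x \<in> carrier (Gamma n) \<Longrightarrow> \<exists>z. U_act V x e = scl V z e"
proof -
  have "tame n V" using NCT by (simp add: NCT_def)
  from someI_ex[OF this[unfolded tame_def], folded basis_def]
  show "vs.independent basis" "vs.span basis = UNIV"
    "e \<in> basis \<Longrightarrow> x \<in> carrier (Gamma n) \<Longrightarrow> \<exists>z. U_act V x e = scl V z e"
    by blast+
qed

lemma basis_nonzero: "e \<in> basis \<Longrightarrow> e \<noteq> 0"
  using basis(1) vs.dependent_zero by blast

abbreviation coeff :: "'v \<Rightarrow> 'v \<Rightarrow> complex" where
  "coeff \<equiv> vs.representation basis"

definition support :: "'v \<Rightarrow> 'v set" where
  "support v = {e. coeff v e \<noteq> 0}"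

lemma support: "finite (support v)" "support v \<subseteq> basis"
  "(\<Sum>e\<in>support v. scl V (coeff v e) e) = v"
  using vs.finite_representation vs.representation_ne_zero
    vs.sum_nonzero_representation_eq[OF basis(1), of v] basis(2)
  unfolding support_def by blast+

definition eig :: "tableau \<Rightarrow> 'v set" where
  "eig M = {v. \<forall>m\<in>{1..n}. \<forall>u. ap (a m u) v = scl V (alpha m u M) v}"

lemma eigD: "v \<in> eig M \<Longrightarrow> m \<le> n \<Longrightarrow> ap (a m u) v = scl V (alpha m u M) v"
  by (cases "m = 0") (auto simp: eig_def alpha_def)

lemma ap_a_scale: "ap (a m u) (scl V z v) = scl V z (ap (a m u) v)"
  using ap_act_scale[of "a_gen m u"] by (simp add: act_free_a)

lemma subspace_eig: "vs.subspace (eig M)"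
  by (rule vs.subspaceI) (auto simp: eig_def ap_add ap_a_scale vs.scale_right_distrib mult.commute)

lemma gt_spaceI:
  assumes "ideal I (Gamma n)" "\<And>x r. \<lbrakk>x \<in> I; r \<in> carrier (Gamma n)\<rbrakk> \<Longrightarrow> U_act V x (U_act V r v) = 0"
  shows "v \<in> gt_space n V I"
proof -
  have I: "x \<in> carrier (U_gl n)" if "x \<in> I" for x
    using ideal.Icarr[OF assms(1) that] \<Gamma>_U by blast
  have "x \<in> carrier (U_gl n) \<and> U_act V x v = 0" if "x \<in> ideal_prod (Gamma n) I (carrier (Gamma n))" for x
    using that
  proof (induction rule: ideal_prod.induct)
    case (prod i j)
    then show ?case
      using I \<Gamma>_U assms(2) ring.ring_simprules(5)[OF ring_U] by (simp add: U_act_mult)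
  next
    case (sum x y)
    then show ?case
      using ring.ring_simprules(1)[OF ring_U] by (simp add: U_act_add)
  qed
  then show ?thesis
    unfolding gt_space_def ideal_power_def by (intro CollectI exI[of _ "Suc 0"]) simp
qed

text \<open>
  A basis vector is an eigenvector of \<open>\<Gamma>\<close>, and its annihilator is the kernel of the character of eigenvalues.
  An ideal that is strictly larger contains an element with nonzero eigenvalue; a scalar multiple of it
  differs from any given \<open>r\<close> by an element of the annihilator.
\<close>
lemma annihilator_maximal:
  assumes e: "e \<in> basis"
  defines "K \<equiv> {x \<in> carrier (Gamma n). U_act V x e = 0}"
  shows "maximalideal K (Gamma n)" "e \<in> gt_space n V K"
proof -
  have eigen: "\<exists>z. U_act V x e = scl V z e" if "x \<in> carrier (Gamma n)" for x
    using basis(3)[OF e that] .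
  have K: "ideal K (Gamma n)"
  proof (rule \<Gamma>.ideal_closedI)
    fix x r assume x: "x \<in> K" and r: "r \<in> carrier (Gamma n)"
    have x': "x \<in> carrier (Gamma n)" "x \<in> carrier (U_gl n)" "r \<in> carrier (U_gl n)" "U_act V x e = 0"
      using x r \<Gamma>_U by (auto simp: K_def)
    obtain z where z: "U_act V r e = scl V z e" using eigen[OF r] by blast
    have "U_act V (x \<otimes>\<^bsub>U_gl n\<^esub> r) e = 0" "U_act V (r \<otimes>\<^bsub>U_gl n\<^esub> x) e = 0"
      by (simp_all add: U_act_mult x' z U_act_linear)
    then show "x \<otimes>\<^bsub>Gamma n\<^esub> r \<in> K" "r \<otimes>\<^bsub>Gamma n\<^esub> x \<in> K"
      using \<Gamma>.m_closed[OF x'(1) r] \<Gamma>.m_closed[OF r x'(1)] by (simp_all add: K_def)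
  next
    fix x y assume "x \<in> K" "y \<in> K"
    then show "x \<oplus>\<^bsub>Gamma n\<^esub> y \<in> K"
      using \<Gamma>.a_closed[of x y] \<Gamma>_U by (simp add: K_def U_act_add)
  next
    show "\<zero>\<^bsub>Gamma n\<^esub> \<in> K"
      using \<Gamma>.zero_closed by (simp add: K_def U_act_zero)
  qed (auto simp: K_def)
  show "e \<in> gt_space n V K"
  proof (rule gt_spaceI[OF K])
    fix x r assume x: "x \<in> K" and r: "r \<in> carrier (Gamma n)"
    obtain z where z: "U_act V r e = scl V z e" using eigen[OF r] by blast
    then show "U_act V x (U_act V r e) = 0"
      using x \<Gamma>_U by (simp add: K_def U_act_linear)
  qed
  show "maximalideal K (Gamma n)"
  proof (rule maximalidealI[OF K])
    have "\<one>\<^bsub>Gamma n\<^esub> \<notin> K" using basis_nonzero[OF e] by (simp add: K_def U_act_one)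
    then show "carrier (Gamma n) \<noteq> K" using \<Gamma>.one_closed by blast
  next
    fix J assume J: "ideal J (Gamma n)" "K \<subseteq> J" "J \<subseteq> carrier (Gamma n)"
    show "J = K \<or> J = carrier (Gamma n)"
    proof (rule disjCI)
      interpret J: ideal J "Gamma n" by fact
      assume "J \<noteq> carrier (Gamma n)"
      show "J = K"
      proof (rule ccontr)
        assume "J \<noteq> K"
        then obtain x where x: "x \<in> J" "x \<notin> K" using J by blast
        then have xG: "x \<in> carrier (Gamma n)" using J by blast
        obtain z where z: "U_act V x e = scl V z e" using eigen[OF xG] by blast
        with x xG have "z \<noteq> 0" by (auto simp: K_def)
        have "r \<in> J" if r: "r \<in> carrier (Gamma n)" for r
        proof -
          obtain w where w: "U_act V r e = scl V w e" using eigen[OF r] by blast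
          define y where "y = cls n (cst (- w / z)) \<otimes>\<^bsub>Gamma n\<^esub> x"
          have y: "y \<in> J" unfolding y_def by (rule J.I_l_closed[OF x(1) cls_cst_Gamma])
          then have yG: "y \<in> carrier (Gamma n)" using J by blast
          have "U_act V y e = scl V (- w) e"
            using xG \<Gamma>_U cls_cst_Gamma \<open>z \<noteq> 0\<close> by (simp add: y_def U_act_mult U_act_cst z)
          then have "r \<oplus>\<^bsub>Gamma n\<^esub> y \<in> K"
            using \<Gamma>.a_closed[OF r yG] r yG \<Gamma>_U by (simp add: K_def U_act_add w flip: vs.scale_left_distrib)
          then have "r \<oplus>\<^bsub>Gamma n\<^esub> y \<in> J" using J by blast
          then have "(r \<oplus>\<^bsub>Gamma n\<^esub> y) \<ominus>\<^bsub>Gamma n\<^esub> y \<in> J"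
            unfolding a_minus_def by (rule J.a_closed[OF _ J.a_inv_closed[OF y]])
          also have "(r \<oplus>\<^bsub>Gamma n\<^esub> y) \<ominus>\<^bsub>Gamma n\<^esub> y = r"
            using r yG by (simp add: a_minus_def \<Gamma>.a_assoc \<Gamma>.r_neg del: Gamma_simps)
          finally show ?thesis .
        qed
        then show False using \<open>J \<noteq> carrier (Gamma n)\<close> J by blast
      qed
    qed
  qed
qed

end

context nct_mod
begin

lemma basis_eig:
  assumes "e \<in> basis"
  shows "\<exists>M\<in>NC_int n L. e \<in> eig M"
proof -
  define K where "K = {x \<in> carrier (Gamma n). U_act V x e = 0}"
  have "maximalideal K (Gamma n)" "e \<in> gt_space n V K"
    using annihilator_maximal[OF assms] by (simp_all add: K_def)
  then have "K \<in> gt_support n V"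
    using basis_nonzero[OF assms] unfolding gt_support_def by blast
  then have "K \<in> NC n L" using NCT by (auto simp: NCT_def)
  then obtain M where M: "M \<in> NC_int n L" "K = mL n M" by (auto simp: NC_def)
  have "ap (a m u) e = scl V (alpha m u M) e" if m: "m \<in> {1..n}" for m u
  proof -
    have "cls n (a_gen m u - cst (alpha m u M)) \<in> K"
      using mL_gens_subset[of M] m unfolding M(2) mL_gens_def by blast
    then have "U_act V (cls n (a_gen m u - cst (alpha m u M))) e = 0" by (simp add: K_def)
    moreover have "a_gen m u - cst (alpha m u M) \<in> carrier (free_alg n)"
      using m by (intro carrier_diff carrier_a_gen) auto
    ultimately show ?thesis
      by (simp add: U_act_cls act_free_diff act_free_a act_free_cst)
  qed
  then show ?thesis using M(1) unfolding eig_def by blast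
qed

definition weight :: "'v \<Rightarrow> tableau" where
  "weight e = (SOME M. M \<in> NC_int n L \<and> e \<in> eig M)"

lemma weight:
  assumes "e \<in> basis"
  shows "weight e \<in> NC_int n L" "e \<in> eig (weight e)"
  using someI_ex[of "\<lambda>M. M \<in> NC_int n L \<and> e \<in> eig M"] basis_eig[OF assms]
  unfolding weight_def by blast+

text \<open>
  For a diagonalizable operator, a power that kills \<open>v\<close> multiplies each basis component of \<open>v\<close> by the same power of
  its eigenvalue.
\<close>
lemma support_nilpotent:
  assumes scale: "\<And>z w. ap X (scl V z w) = scl V z (ap X w)"
    and eigen: "\<And>e. e \<in> basis \<Longrightarrow> ap X e = scl V (lam e) e"
    and zero: "ap (X ^ p) v = 0" and e: "e \<in> support v"
  shows "lam e = 0"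
proof -
  have pow: "ap (X ^ p) (scl V z w) = scl V (z * lam w ^ p) w" if "w \<in> basis" for z w p
    by (induction p arbitrary: z) (use that in \<open>simp_all add: scale eigen ac_simps\<close>)
  have "0 = ap (X ^ p) (\<Sum>e\<in>support v. scl V (coeff v e) e)"
    using zero support(3) by simp
  also have "\<dots> = (\<Sum>e\<in>support v. scl V (coeff v e * lam e ^ p) e)"
    unfolding ap_sum_right by (rule sum.cong[OF refl], rule pow) (use support(2)[of v] in blast)
  finally have "coeff v e * lam e ^ p = 0"
    using vs.independentD[OF basis(1) support(1,2), where u = "\<lambda>e. coeff v e * lam e ^ p"] e by simp
  then show ?thesis using e by (simp add: support_def)
qed

lemma support_a:
  assumes "m \<le> n" "ap ((a m u - k z) ^ p) v = 0" "e \<in> support v"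
  shows "alpha m u (weight e) = z"
proof -
  have "alpha m u (weight e) - z = 0"
  proof (rule support_nilpotent[OF _ _ assms(2,3), of "\<lambda>e. alpha m u (weight e) - z"])
    fix x w show "ap (a m u - k z) (scl V x w) = scl V x (ap (a m u - k z) w)"
      by (simp add: ap_a_scale vs.scale_right_diff_distrib mult.commute)
    fix e assume "e \<in> basis"
    then show "ap (a m u - k z) e = scl V (alpha m u (weight e) - z) e"
      using eigD[OF weight(2) assms(1)] by (simp add: vs.scale_left_diff_distrib)
  qed
  then show ?thesis by simp
qed

lemma eig_support_alpha:
  assumes "v \<in> eig M" "e \<in> support v" "m \<le> n"
  shows "alpha m u (weight e) = alpha m u M"
  by (rule support_a[of m u _ 1 v e]) (use assms eigD[of v M m u] in simp_all)

lemma eig_weightI: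
  assumes "e \<in> basis" "\<And>m u. m \<in> {1..n} \<Longrightarrow> alpha m u (weight e) = alpha m u M"
  shows "e \<in> eig M"
  using weight(2)[OF assms(1)] assms(2) by (simp add: eig_def)

lemma eig_support:
  assumes "v \<in> eig M" "e \<in> support v"
  shows "e \<in> eig M" "mL n (weight e) = mL n M"
proof -
  have alpha: "alpha m u (weight e) = alpha m u M" if "m \<in> {1..n}" for m u
    by (rule eig_support_alpha[OF assms]) (use that in simp)
  show "e \<in> eig M"
    by (rule eig_weightI[OF _ alpha]) (use assms(2) support(2)[of v] in blast)+
  show "mL n (weight e) = mL n M" by (rule mL_cong[OF alpha])
qed

lemma eigI_support:
  assumes "\<And>e. e \<in> support v \<Longrightarrow> e \<in> eig M"
  shows "v \<in> eig M"
proof -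
  have "(\<Sum>e\<in>support v. scl V (coeff v e) e) \<in> eig M"
    by (intro vs.subspace_sum[OF subspace_eig] vs.subspace_scale[OF subspace_eig] assms)
  then show ?thesis by (simp only: support(3))
qed

text \<open>
  A power of \<open>m\<^sub>M\<close> contains the same power of each generator \<open>a\<^sub>m(u) - \<alpha>\<^sub>m(u)\<close>, which gives one inclusion
  by \<open>support_nilpotent\<close>.  For the other one, the annihilator of each basis vector in the support of an eigenvector
  contains the generators, hence the whole of \<open>m\<^sub>M\<close>.
\<close>
lemma gt_space_eq: "gt_space n V (mL n M) = eig M"
proof
  show "gt_space n V (mL n M) \<subseteq> eig M"
  proof
    fix v assume "v \<in> gt_space n V (mL n M)"
    then obtain p where p: "\<And>x. x \<in> ideal_power n (mL n M) p \<Longrightarrow> U_act V x v = 0"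
      unfolding gt_space_def by blast
    have nilpotent: "ap ((a m u - k (alpha m u M)) ^ p) v = 0" if m: "m \<in> {1..n}" for m u
    proof -
      let ?f = "a_gen m u - cst (alpha m u M)"
      have f: "?f \<in> carrier (free_alg n)"
        using m by (intro carrier_diff carrier_a_gen) auto
      have "\<exists>x\<in>ideal_power n (mL n M) q. x \<in> carrier (U_gl n) \<and>
          (\<forall>v. U_act V x v = ap ((a m u - k (alpha m u M)) ^ q) v)" for q
      proof (induction q)
        case 0
        show ?case
          by (rule bexI[of _ "\<one>\<^bsub>Gamma n\<^esub>"])
             (use \<Gamma>.one_closed ring.ring_simprules(6)[OF ring_U] in \<open>simp_all add: U_act_one ideal_power_def\<close>)
      next
        case (Suc q)
        then obtain x where x: "x \<in> ideal_power n (mL n M) q" "x \<in> carrier (U_gl n)"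
          "\<And>v. U_act V x v = ap ((a m u - k (alpha m u M)) ^ q) v" by blast
        have "cls n ?f \<in> mL n M"
          using mL_gens_subset[of M] m unfolding mL_gens_def by blast
        then have "cls n ?f \<otimes>\<^bsub>Gamma n\<^esub> x \<in> ideal_power n (mL n M) (Suc q)"
          using x(1) by (simp add: ideal_power_def ideal_prod.prod del: Gamma_simps)
        moreover have "cls n ?f \<otimes>\<^bsub>U_gl n\<^esub> x \<in> carrier (U_gl n)"
          using ring.ring_simprules(5)[OF ring_U] cls_closed[OF f] x(2) by blast
        moreover have "U_act V (cls n ?f \<otimes>\<^bsub>U_gl n\<^esub> x) v = ap ((a m u - k (alpha m u M)) ^ Suc q) v" for v
          using cls_closed[OF f] f x m
          by (simp add: U_act_mult U_act_cls act_free_diff act_free_a act_free_cst)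
        ultimately show ?case by auto
      qed
      then show ?thesis using p by metis
    qed
    show "v \<in> eig M"
    proof (rule eigI_support, rule eig_weightI)
      fix e assume e: "e \<in> support v"
      then show "e \<in> basis" using support(2) by blast
      fix m u assume "m \<in> {1..n}"
      then show "alpha m u (weight e) = alpha m u M"
        using support_a[of m u "alpha m u M" p v e] nilpotent e by auto
    qed
  qed
  show "eig M \<subseteq> gt_space n V (mL n M)"
  proof
    fix v assume v: "v \<in> eig M"
    show "v \<in> gt_space n V (mL n M)"
    proof (rule gt_spaceI[OF mL_ideal])
      fix x r assume x: "x \<in> mL n M" and r: "r \<in> carrier (Gamma n)"
      have xG: "x \<in> carrier (U_gl n)" using ideal.Icarr[OF mL_ideal x] \<Gamma>_U by blast
      have kill: "U_act V x (U_act V r (scl V (coeff v e) e)) = 0" if e: "e \<in> support v" for e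
      proof -
        have eb: "e \<in> basis" using e support(2) by blast
        define K where "K = {x \<in> carrier (Gamma n). U_act V x e = 0}"
        have "ideal K (Gamma n)"
          using maximalideal.axioms(1)[OF annihilator_maximal(1)[OF eb]] by (simp add: K_def)
        moreover have "mL_gens n M \<subseteq> K"
        proof
          fix y assume y: "y \<in> mL_gens n M"
          then obtain m u where m: "m \<in> {1..n}" and y': "y = cls n (a_gen m u - cst (alpha m u M))"
            unfolding mL_gens_def by blast
          have "a_gen m u - cst (alpha m u M) \<in> carrier (free_alg n)"
            using m by (intro carrier_diff carrier_a_gen) auto
          then have "U_act V y e = ap (a m u) e - scl V (alpha m u M) e"
            by (simp add: y' U_act_cls act_free_diff act_free_a act_free_cst)
          then have "U_act V y e = 0" using eigD[OF eig_support(1)[OF v e]] m by simp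
          then show "y \<in> K" using mL_gens_\<Gamma> y by (auto simp: K_def)
        qed
        ultimately have "mL n M \<subseteq> K"
          unfolding mL_def mL_gens_def[symmetric] by (rule \<Gamma>.genideal_minimal)
        then have "U_act V x e = 0" using x by (auto simp: K_def)
        moreover obtain z where "U_act V r e = scl V z e" using basis(3)[OF eb r] by blast
        ultimately show ?thesis
          using xG r \<Gamma>_U by (simp add: U_act_linear)
      qed
      have "U_act V x (U_act V r v) = U_act V x (U_act V r (\<Sum>e\<in>support v. scl V (coeff v e) e))"
        by (simp only: support(3))
      also have "\<dots> = (\<Sum>e\<in>support v. U_act V x (U_act V r (scl V (coeff v e) e)))"
        using xG r \<Gamma>_U by (simp only: U_act_linear)
      also have "\<dots> = 0" by (rule sum.neutral) (use kill in blast)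
      finally show "U_act V x (U_act V r v) = 0" .
    qed
  qed
qed

text \<open>A basis vector in the support would have the same eigenvalues as a tableau in \<open>NC\<close>, whose rows have distinct entries.\<close>
lemma eig_critical:
  assumes "v \<in> eig M" "m \<in> {1..n - 1}" "\<not> inj_on (M m) {1..m}"
  shows "v = 0"
proof -
  have "support v = {}"
  proof (rule ccontr)
    assume "support v \<noteq> {}"
    then obtain e where e: "e \<in> support v" by blast
    then have "inj_on (weight e m) {1..m}"
      using NC_int_inj[OF weight(1) assms(2)] support(2) by blast
    moreover have "alpha m u (weight e) = alpha m u M" for u
      using eig_support_alpha[OF assms(1) e] assms(2) by auto
    ultimately show False using alpha_eq_imp_inj assms(3) by blast
  qed
  then show ?thesis using support(3)[of v] by simp
qed

text \<open>
  The hypothesis \<open>same\<close> determines \<open>a m x\<close> on \<open>w\<close> only for \<open>x \<noteq> - M m i\<close>.  The remaining eigenvalue is found on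
  the basis vectors in the support of \<open>w\<close>, where it is a polynomial in \<open>x\<close>.
\<close>
lemma eig_shift:
  assumes m: "m \<in> {1..n}" and i: "i \<in> {1..m}"
    and other: "\<And>l u. l \<in> {1..n} \<Longrightarrow> l \<noteq> m \<Longrightarrow> ap (a l u) w = scl V (alpha l u M) w"
    and same: "\<And>x. scl V (x + M m i) (ap (a m x) w) = scl V ((x + M m i + s) * alpha m x M) w"
  shows "w \<in> eig (shift M m i s)"
proof -
  let ?S = "shift M m i s"
  have away: "ap (a m x) w = scl V (alpha m x ?S) w" if "x \<noteq> - M m i" for x
  proof -
    have x: "x + M m i \<noteq> 0" using that by (simp add: eq_neg_iff_add_eq_0)
    have "scl V (x + M m i) (ap (a m x) w) = scl V (x + M m i) (scl V (alpha m x ?S) w)"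
      using same[of x] alpha_shift[OF i, of x M s] by simp
    then show ?thesis using x unfolding vs.scale_cancel_left by blast
  qed
  have *: "alpha m x (weight e) = alpha m x ?S" if e: "e \<in> support w" for e x
  proof -
    have away': "alpha m y (weight e) = alpha m y ?S" if "y \<noteq> - M m i" for y
    proof -
      have "ap ((a m y - k (alpha m y ?S)) ^ 1) w = 0" using away[OF that] by simp
      then show ?thesis using support_a[of m y "alpha m y ?S" 1 w e] m e by simp
    qed
    show ?thesis
    proof (cases "x = - M m i")
      case True
      then show ?thesis using alpha_eq_at_puncture[OF away'] by simp
    qed (rule away')
  qed
  show ?thesis
  proof (rule eigI_support, rule eig_weightI)
    fix e assume e: "e \<in> support w"
    then show "e \<in> basis" using support(2)[of w] by blast
    fix l u assume l: "l \<in> {1..n}"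
    show "alpha l u (weight e) = alpha l u ?S"
    proof (cases "l = m")
      case True
      then show ?thesis using *[OF e] by simp
    next
      case False
      have "ap ((a l u - k (alpha l u M)) ^ 1) w = 0"
        using other[OF l False, of u] by simp
      then have "alpha l u (weight e) = alpha l u M"
        using support_a[of l u "alpha l u M" 1 w e] l e by simp
      then show ?thesis using False by (simp add: alpha_shift_other)
    qed
  qed
qed

section \<open>The Drinfeld relations on weight spaces\<close>

text \<open>
  The second condition holds automatically on the tableaux reached by an edge (\<open>lies_at_shift\<close>).  With it, edges that
  the quiver interprets as zero need no case distinctions (\<open>arr_eq\<close>).
\<close>
definition lies_at :: "tableau \<Rightarrow> 'v \<Rightarrow> bool" where
  "lies_at M v \<longleftrightarrow> v \<in> eig M \<and> (M \<notin> NC_int n L \<longrightarrow> v = 0)"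

lemma lies_at_shift:
  assumes "M \<in> NC_int n L" "m \<in> {1..n - 1}" "i \<in> {1..m}" "s \<in> {1, -1}" "w \<in> eig (shift M m i s)"
  shows "lies_at (shift M m i s) w"
  using assms(5) eig_critical[OF assms(5,2)] NC_int_shift[OF assms(1-4)] unfolding lies_at_def by blast

lemma ap_scale_a: "ap (b m u) (scl V z v) = scl V z (ap (b m u) v)"
  "ap (c m u) (scl V z v) = scl V z (ap (c m u) v)" if "1 \<le> m" "Suc m \<le> n"
  using ap_act_scale[of "b_gen m u" z v] ap_act_scale[of "c_gen m u" z v] that
  by (simp_all add: act_free_b act_free_c)

text \<open>With \<open>y = - M m i\<close> a root of the eigenvalue of \<open>a m\<close>, the relation between \<open>a(x)\<close> and \<open>b(y)\<close> reads
  \<open>(x - y) a(x) w = (x - y + 1) \<alpha>(x) w\<close> for \<open>w = b(y) v\<close>.\<close>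
lemma b_step:
  assumes "lies_at M v" "m \<in> {1..n - 1}" "i \<in> {1..m}"
  shows "lies_at (shift M m i 1) (ap (b m (- M m i)) v)"
proof (cases "M \<in> NC_int n L")
  case True
  let ?y = "- M m i"
  let ?w = "ap (b m ?y) v"
  have m: "1 \<le> m" "Suc m \<le> n" "m \<le> n" using assms by auto
  have v: "v \<in> eig M" using assms(1) by (simp add: lies_at_def)
  have "?w \<in> eig (shift M m i 1)"
  proof (rule eig_shift)
    fix l u assume l: "l \<in> {1..n}" "l \<noteq> m"
    have "a l u * b m ?y = b m ?y * a l u"
      by (rule comm_eq_0D[OF comm_a_b_c_distinct(1)]) (use l m in auto)
    from arg_cong[OF this, of "\<lambda>X. ap X v"] show "ap (a l u) ?w = scl V (alpha l u M) ?w"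
      using l eigD[OF v, of l u] m by (simp add: ap_scale_a)
  next
    fix x
    have "ap (a m ?y) v = 0" using eigD[OF v m(3)] alpha_root[OF assms(3)] by simp
    then have "ap (k (x - ?y) * comm (a m x) (b m ?y)) v = scl V (alpha m x M) ?w"
      using eigD[OF v m(3), of x] m unfolding comm_a_b[OF m(1,2)] by (simp add: ap_scale_a)
    then have "scl V (x + M m i) (ap (a m x) ?w - scl V (alpha m x M) ?w) = scl V (alpha m x M) ?w"
      using eigD[OF v m(3), of x] m by (simp add: comm_def ap_scale_a)
    then show "scl V (x + M m i) (ap (a m x) ?w) = scl V ((x + M m i + 1) * alpha m x M) ?w"
      by (simp add: vs.scale_right_diff_distrib diff_eq_eq distrib_right vs.scale_left_distrib add.commute)
  qed (use m assms in auto)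
  then show ?thesis using True assms by (intro lies_at_shift) auto
next
  case False
  then show ?thesis using assms(1) vs.subspace_0[OF subspace_eig] by (simp add: lies_at_def)
qed

lemma c_step:
  assumes "lies_at M v" "m \<in> {1..n - 1}" "i \<in> {1..m}"
  shows "lies_at (shift M m i (-1)) (ap (c m (- M m i)) v)"
proof (cases "M \<in> NC_int n L")
  case True
  let ?y = "- M m i"
  let ?w = "ap (c m ?y) v"
  have m: "1 \<le> m" "Suc m \<le> n" "m \<le> n" using assms by auto
  have v: "v \<in> eig M" using assms(1) by (simp add: lies_at_def)
  have "?w \<in> eig (shift M m i (-1))"
  proof (rule eig_shift)
    fix l u assume l: "l \<in> {1..n}" "l \<noteq> m"
    have "a l u * c m ?y = c m ?y * a l u"
      by (rule comm_eq_0D[OF comm_a_b_c_distinct(2)]) (use l m in auto)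
    from arg_cong[OF this, of "\<lambda>X. ap X v"] show "ap (a l u) ?w = scl V (alpha l u M) ?w"
      using l eigD[OF v, of l u] m by (simp add: ap_scale_a)
  next
    fix x
    have "ap (a m ?y) v = 0" using eigD[OF v m(3)] alpha_root[OF assms(3)] by simp
    then have "ap (k (x - ?y) * comm (a m x) (c m ?y)) v = - scl V (alpha m x M) ?w"
      using eigD[OF v m(3), of x] m unfolding comm_a_c[OF m(1,2)] by (simp add: ap_scale_a)
    then have "scl V (x + M m i) (ap (a m x) ?w - scl V (alpha m x M) ?w) = - scl V (alpha m x M) ?w"
      using eigD[OF v m(3), of x] m by (simp add: comm_def ap_scale_a)
    then have "scl V (x + M m i) (ap (a m x) ?w) = scl V (x + M m i) (scl V (alpha m x M) ?w) - scl V (alpha m x M) ?w"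
      unfolding vs.scale_right_diff_distrib by (simp only: diff_eq_eq) simp
    also have "\<dots> = scl V ((x + M m i) * alpha m x M - alpha m x M) ?w"
      by (simp only: vs.scale_scale vs.scale_left_diff_distrib)
    also have "(x + M m i) * alpha m x M - alpha m x M = (x + M m i + (-1)) * alpha m x M"
      by (simp add: algebra_simps)
    finally show "scl V (x + M m i) (ap (a m x) ?w) = scl V ((x + M m i + (-1)) * alpha m x M) ?w" .
  qed (use m assms in auto)
  then show ?thesis using True assms by (intro lies_at_shift) auto
next
  case False
  then show ?thesis using assms(1) vs.subspace_0[OF subspace_eig] by (simp add: lies_at_def)
qed

end


context nct_mod
begin

lemma lies_at_eig: "M \<in> NC_int n L \<Longrightarrow> v \<in> eig M \<Longrightarrow> lies_at M v"
  by (simp add: lies_at_def)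

lemma lies_at_zero: "lies_at M 0"
  using vs.subspace_0[OF subspace_eig] by (simp add: lies_at_def)

lemma lies_atD: "lies_at M v \<Longrightarrow> M \<in> NC_int n L \<Longrightarrow> v \<in> eig M" "lies_at M v \<Longrightarrow> v \<in> eig M"
  by (simp_all add: lies_at_def)

lemma edge_elt_carrier: "e \<in> edges n \<Longrightarrow> cls n (edge_elt M e) \<in> carrier (U_gl n)"
  unfolding edges_def by (auto intro!: cls_closed carrier_a_gen carrier_b_gen carrier_c_gen)

lemma edge_acts:
  assumes e: "e \<in> edges n" and v: "lies_at M v"
  shows "lies_at (target M e) (U_act V (cls n (edge_elt M e)) v)"
proof (cases e)
  case (LoopA l m i)
  then have "U_act V (cls n (edge_elt M e)) v = scl V (alpha l (- M m i) M) v"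
    using e eigD[OF lies_atD(2)[OF v], of l] by (auto simp: edges_def U_act_a)
  then show ?thesis
    using v vs.subspace_scale[OF subspace_eig] LoopA by (simp add: lies_at_def)
next
  case (EdgeB m i)
  then show ?thesis using e b_step[OF v, of m i] by (auto simp: edges_def U_act_b)
next
  case (EdgeC m i)
  then show ?thesis using e c_step[OF v, of m i] by (auto simp: edges_def U_act_c)
qed

lemma arr_eq:
  assumes e: "e \<in> edges n" and v: "lies_at M v"
  shows "arr n L (F_NC n V) M e v = U_act V (cls n (edge_elt M e)) v"
proof (cases "M \<in> NC_int n L")
  case True
  then show ?thesis
    using edge_acts[OF e v] by (auto simp: arr_def F_NC_def lies_at_def)
next
  case False
  then have "v = 0" using v by (simp add: lies_at_def)
  then show ?thesis using False U_act_linear(3)[OF edge_elt_carrier[OF e]] by (simp add: arr_def)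
qed

lemma edges_intros:
  "l \<in> {1..n} \<Longrightarrow> m \<in> {1..n - 1} \<Longrightarrow> i \<in> {1..m} \<Longrightarrow> LoopA l m i \<in> edges n"
  "m \<in> {1..n - 1} \<Longrightarrow> i \<in> {1..m} \<Longrightarrow> EdgeB m i \<in> edges n"
  "m \<in> {1..n - 1} \<Longrightarrow> i \<in> {1..m} \<Longrightarrow> EdgeC m i \<in> edges n"
  unfolding edges_def by blast+

abbreviation "arrow \<equiv> arr n L (F_NC n V)"

lemma arrow_A:
  assumes "lies_at M v" "l \<in> {1..n}" "m \<in> {1..n - 1}" "i \<in> {1..m}"
  shows "arrow M (LoopA l m i) v = scl V (alpha l (- M m i) M) v"
  using assms arr_eq[OF edges_intros(1)[OF assms(2-4)] assms(1)] eigD[OF lies_atD(2)[OF assms(1)], of l]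
  by (simp add: U_act_a)

lemma arrow_B:
  assumes "lies_at M v" "m \<in> {1..n - 1}" "i \<in> {1..m}"
  shows "arrow M (EdgeB m i) v = ap (b m (- M m i)) v"
proof -
  have "1 \<le> m" "Suc m \<le> n" using assms by auto
  then show ?thesis using arr_eq[OF edges_intros(2)[OF assms(2-3)] assms(1)] by (simp add: U_act_b)
qed

lemma arrow_C:
  assumes "lies_at M v" "m \<in> {1..n - 1}" "i \<in> {1..m}"
  shows "arrow M (EdgeC m i) v = ap (c m (- M m i)) v"
proof -
  have "1 \<le> m" "Suc m \<le> n" using assms by auto
  then show ?thesis using arr_eq[OF edges_intros(3)[OF assms(2-3)] assms(1)] by (simp add: U_act_c)
qed

lemma a_vertex_zero: "lies_at M v \<Longrightarrow> m \<le> n \<Longrightarrow> i \<in> {1..m} \<Longrightarrow> ap (a m (- M m i)) v = 0"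
  using eigD[OF lies_atD(2)] alpha_root[of i m M] by simp

text \<open>For \<open>l = m\<close> the right-hand side of \<open>comm_b_c\<close> ends in \<open>a(x)\<close> and \<open>a(y)\<close>, which kill \<open>v\<close>, and \<open>x \<noteq> y\<close>.\<close>
lemma rel_C_B:
  assumes M: "M \<in> NC_int n L" and v: "lies_at M v"
    and m: "m \<in> {1..n - 1}" "i \<in> {1..m}" and l: "l \<in> {1..n - 1}" "j \<in> {1..l}"
    and ne: "l \<noteq> m \<or> i \<noteq> j"
  shows "arrow (shift M l j 1) (EdgeC m i) (arrow M (EdgeB l j) v)
    = arrow (shift M m i (-1)) (EdgeB l j) (arrow M (EdgeC m i) v)"
proof -
  have ne': "(l, j) \<noteq> (m, i)" "(m, i) \<noteq> (l, j)" using ne by auto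
  have r: "1 \<le> m" "Suc m \<le> n" "1 \<le> l" "Suc l \<le> n" "m \<le> n" using m l by auto
  define x y where "x = - M l j" and "y = - M m i"
  have "ap (comm (b l x) (c m y)) v = 0"
  proof (cases "l = m")
    case False
    then have "comm (b l x) (c m y) = 0" by (intro comm_b_c_distinct r)
    then show ?thesis by simp
  next
    case True
    have "x \<noteq> y"
    proof
      assume "x = y"
      then have "M m j = M m i" using True by (simp add: x_def y_def)
      then have "j = i" using inj_onD[OF NC_int_inj[OF M m(1)]] m(2) l(2) True by blast
      then show False using ne True by simp
    qed
    moreover have "ap (a m x) v = 0" "ap (a m y) v = 0"
      using a_vertex_zero[OF v r(5), of j] a_vertex_zero[OF v r(5), of i] m l True
      by (simp_all add: x_def y_def)
    then have "ap (k (x - y) * comm (b m x) (c m y)) v = 0"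
      unfolding comm_b_c[OF r(1,2)] by simp
    ultimately show ?thesis using True by simp
  qed
  then have swap: "ap (c m y) (ap (b l x) v) = ap (b l x) (ap (c m y) v)"
    by (simp add: comm_def)
  have "arrow (shift M l j 1) (EdgeC m i) (arrow M (EdgeB l j) v) = ap (c m y) (ap (b l x) v)"
    using arrow_C[OF b_step[OF v l] m] by (simp add: arrow_B[OF v l] shift_other[OF ne'(2)] x_def y_def)
  moreover have "arrow (shift M m i (-1)) (EdgeB l j) (arrow M (EdgeC m i) v) = ap (b l x) (ap (c m y) v)"
    using arrow_B[OF c_step[OF v m] l] by (simp add: arrow_C[OF v m] shift_other[OF ne'(1)] x_def y_def)
  ultimately show ?thesis using swap by simp
qed

lemma rel_B_B:
  assumes v: "lies_at M v"
    and m: "m \<in> {1..n - 1}" "i \<in> {1..m}" and l: "l \<in> {1..n - 1}" "j \<in> {1..l}"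
    and far: "\<bar>int l - int m\<bar> \<noteq> 1 \<and> (l, j) \<noteq> (m, i)"
  shows "arrow (shift M l j 1) (EdgeB m i) (arrow M (EdgeB l j) v)
      = arrow (shift M m i 1) (EdgeB l j) (arrow M (EdgeB m i) v)"
    and "arrow (shift M l j (-1)) (EdgeC m i) (arrow M (EdgeC l j) v)
      = arrow (shift M m i (-1)) (EdgeC l j) (arrow M (EdgeC m i) v)"
proof -
  have ne': "(l, j) \<noteq> (m, i)" "(m, i) \<noteq> (l, j)" using far by auto
  have r: "1 \<le> m" "Suc m \<le> n" "1 \<le> l" "Suc l \<le> n" "m \<le> n" using m l by auto
  have "comm (b m x) (b l y) = 0 \<and> comm (c m x) (c l y) = 0" for x y
  proof -
    consider "l = m" | "l + 2 \<le> m" | "m + 2 \<le> l" using far by linarith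
    then show ?thesis
    proof cases
      case 1
      then show ?thesis using comm_b_b comm_c_c r by simp
    next
      case 2
      then show ?thesis using comm_b_b_far[OF r(3) 2 r(2)] by simp
    next
      case 3
      then show ?thesis
        using comm_eq_0_swap comm_b_b_far[OF r(1) 3 r(4)] by blast
    qed
  qed
  then have "b m x * b l y = b l y * b m x" "c m x * c l y = c l y * c m x" for x y
    by (auto intro: comm_eq_0D)
  note swap = this
  have bb: "ap (b m x) (ap (b l y) v) = ap (b l y) (ap (b m x) v)"
    and cc: "ap (c m x) (ap (c l y) v) = ap (c l y) (ap (c m x) v)" for x y
    using arg_cong[OF swap(1)[of x y], of "\<lambda>X. ap X v"] arg_cong[OF swap(2)[of x y], of "\<lambda>X. ap X v"]
    by (simp_all only: times_endo.rep_eq)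
  show "arrow (shift M l j 1) (EdgeB m i) (arrow M (EdgeB l j) v)
      = arrow (shift M m i 1) (EdgeB l j) (arrow M (EdgeB m i) v)"
    using arrow_B[OF b_step[OF v l] m] arrow_B[OF b_step[OF v m] l] bb
    by (simp only: arrow_B[OF v l] arrow_B[OF v m] shift_other[OF ne'(1)] shift_other[OF ne'(2)])
  show "arrow (shift M l j (-1)) (EdgeC m i) (arrow M (EdgeC l j) v)
      = arrow (shift M m i (-1)) (EdgeC l j) (arrow M (EdgeC m i) v)"
    using arrow_C[OF c_step[OF v l] m] arrow_C[OF c_step[OF v m] l] cc
    by (simp only: arrow_C[OF v l] arrow_C[OF v m] shift_other[OF ne'(1)] shift_other[OF ne'(2)])
qed

text \<open>In the two product formulas the term with \<open>d\<close> ends in \<open>a m (- M m i)\<close>, which kills \<open>v\<close>.\<close>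
lemma rel_B_C_inverse:
  assumes v: "lies_at M v" and m: "m \<in> {1..n - 1}" "i \<in> {1..m}"
  shows "arrow (shift M m i (-1)) (EdgeB m i) (arrow M (EdgeC m i) v)
      = scl V (- alpha (m + 1) (- M m i + 1) M * alpha (m - 1) (- M m i) M) v"
    and "arrow (shift M m i 1) (EdgeC m i) (arrow M (EdgeB m i) v)
      = scl V (- alpha (m + 1) (- M m i) M * alpha (m - 1) (- M m i - 1) M) v"
proof -
  have r: "1 \<le> m" "Suc m \<le> n" "m \<le> n" "m - 1 \<le> n" using m by auto
  note zero = a_vertex_zero[OF v r(3) m(2)]
  have "ap (b m (- M m i + 1) * c m (- M m i)) v
    = - ap (a (Suc m) (- M m i + 1)) (ap (a (m - 1) (- M m i)) v)"
    using b_c_product[OF r(1,2), of "- M m i + 1"] zero by simp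
  also have "\<dots> = scl V (- alpha (m + 1) (- M m i + 1) M * alpha (m - 1) (- M m i) M) v"
    using eigD[OF lies_atD(2)[OF v] r(2)] eigD[OF lies_atD(2)[OF v] r(4)]
    by (simp add: ap_a_scale mult.commute Suc_eq_plus1)
  finally show "arrow (shift M m i (-1)) (EdgeB m i) (arrow M (EdgeC m i) v)
      = scl V (- alpha (m + 1) (- M m i + 1) M * alpha (m - 1) (- M m i) M) v"
    using arrow_B[OF c_step[OF v m] m] by (simp add: arrow_C[OF v m])
  have "ap (c m (- M m i - 1) * b m (- M m i)) v
    = - ap (a (Suc m) (- M m i)) (ap (a (m - 1) (- M m i - 1)) v)"
    using c_b_product[OF r(1,2), of "- M m i"] zero by simp
  also have "\<dots> = scl V (- alpha (m + 1) (- M m i) M * alpha (m - 1) (- M m i - 1) M) v"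
    using eigD[OF lies_atD(2)[OF v] r(2)] eigD[OF lies_atD(2)[OF v] r(4)]
    by (simp add: ap_a_scale mult.commute Suc_eq_plus1)
  finally show "arrow (shift M m i 1) (EdgeC m i) (arrow M (EdgeB m i) v)
      = scl V (- alpha (m + 1) (- M m i) M * alpha (m - 1) (- M m i - 1) M) v"
    using arrow_C[OF b_step[OF v m] m] by (simp add: arrow_B[OF v m])
qed

lemma arrow_A_zero:
  assumes "lies_at M v" "m \<in> {1..n - 1}" "i \<in> {1..m}"
  shows "arrow M (LoopA m m i) v = 0"
  using arrow_A[OF assms(1) _ assms(2,3), of m] assms alpha_root[OF assms(3), of M] by auto

lemma arrow_zero: "e \<in> edges n \<Longrightarrow> arrow M e 0 = 0"
  using arr_eq[OF _ lies_at_zero] U_act_linear(3)[OF edge_elt_carrier] by simp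

lemma arrow_A_zero_shifted:
  assumes "lies_at M v" "m \<in> {1..n - 1}" "i \<in> {1..m}" "j \<in> {1..m}"
  shows "arrow (shift M m j 1) (LoopA m m i) (arrow M (EdgeB m j) v) = 0"
    and "arrow (shift M m j (-1)) (LoopA m m i) (arrow M (EdgeC m j) v) = 0"
  using b_step[OF assms(1,2,4)] c_step[OF assms(1,2,4)] assms
  by (simp_all add: arrow_B arrow_C arrow_A_zero)

lemma F_NC_simps [simp]: "rscl (F_NC n V) = scl V" "vsp (F_NC n V) = gt_space n V"
  "emap (F_NC n V) M e = U_act V (cls n (edge_elt M e))"
  by (simp_all add: F_NC_def)

text \<open>In the last pair of relations, each path passes a loop whose eigenvalue is zero, so both sides vanish.\<close>
lemma relations: "drinfeld_relations n L (F_NC n V)"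
  unfolding drinfeld_relations_def Let_def F_NC_simps gt_space_eq
  by (intro ballI conjI allI impI; frule (1) lies_at_eig;
      (rule arrow_A, assumption+ | rule rel_C_B, assumption+ | rule rel_B_B, assumption+ |
       rule rel_B_C_inverse, assumption+ |
       (simp only: arrow_A_zero_shifted arrow_A_zero arrow_zero edges_intros,
        simp add: at_vertex_def)))

lemma D_rep_F_NC: "D_rep n L (F_NC n V)"
  unfolding D_rep_def F_NC_simps
proof (intro conjI ballI impI relations vector_space)
  fix \<omega> assume "\<omega> \<in> NC n L"
  then show "vs.subspace (gt_space n V \<omega>)"
    unfolding NC_def using gt_space_eq subspace_eig by auto
next
  fix M e assume M: "M \<in> NC_int n L" and e: "e \<in> edges n" and target: "target M e \<in> NC_int n L"
  show "linear_between (scl V) (gt_space n V (mL n M)) (scl V) (gt_space n V (mL n (target M e)))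
    (U_act V (cls n (edge_elt M e)))"
    unfolding linear_between_def gt_space_eq
    using edge_acts[OF e lies_at_eig[OF M]] U_act_linear[OF edge_elt_carrier[OF e]] lies_atD(2)
    by auto
qed

end

section \<open>The functor\<close>
lemma linear_map_sum:
  assumes "Vector_Spaces.linear s t f"
  shows "f (\<Sum>i\<in>A. g i) = (\<Sum>i\<in>A. f (g i))"
proof -
  have add: "f (x + y) = f x + f y" for x y
    using assms unfolding Vector_Spaces.linear_iff by blast
  then have "f 0 = 0" using add[of 0 0] by simp
  then show ?thesis using add by (induction A rule: infinite_finite_induct) auto
qed

lemma (in nct_mod) linear_expand:
  assumes "Vector_Spaces.linear (scl V) sc f"
  shows "f v = (\<Sum>e\<in>support v. sc (coeff v e) (f e))"
proof -
  have "f v = f (\<Sum>e\<in>support v. scl V (coeff v e) e)" by (simp only: support(3))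
  also have "\<dots> = (\<Sum>e\<in>support v. sc (coeff v e) (f e))"
    using assms by (simp add: linear_map_sum[OF assms] Vector_Spaces.linear_iff)
  finally show ?thesis .
qed

lemma (in nct_mod) basis_gt_space:
  assumes "e \<in> basis"
  shows "e \<in> gt_space n V (mL n (weight e))" "mL n (weight e) \<in> NC n L"
  using weight[OF assms] by (auto simp: gt_space_eq NC_def)

lemma (in nct_mod) linear_eqI:
  assumes "Vector_Spaces.linear (scl V) sc f" "Vector_Spaces.linear (scl V) sc g"
    and "\<And>M v. M \<in> NC_int n L \<Longrightarrow> v \<in> gt_space n V (mL n M) \<Longrightarrow> f v = g v"
  shows "f = g"
proof
  fix v
  have "f e = g e" if "e \<in> support v" for e
    using that support(2)[of v] assms(3)[OF weight(1) basis_gt_space(1)] by blast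
  then show "f v = g v"
    by (simp add: linear_expand[OF assms(1), of v] linear_expand[OF assms(2), of v])
qed

text \<open>
  Linear maps on the weight spaces glue to a linear map on the module: define it on the basis, each basis vector
  being sent by the map of its own weight space.
\<close>
lemma (in nct_mod) linear_assemble:
  assumes sc: "vector_space sc"
    and lin: "\<And>\<omega>. \<omega> \<in> NC n L \<Longrightarrow> linear_between (scl V) (gt_space n V \<omega>) sc (A \<omega>) (\<phi> \<omega>)"
  shows "\<exists>f. Vector_Spaces.linear (scl V) sc f \<and> (\<forall>\<omega>\<in>NC n L. \<forall>v\<in>gt_space n V \<omega>. f v = \<phi> \<omega> v)"
proof -
  interpret P: vector_space_pair "scl V" sc
    using vector_space sc by (simp add: vector_space_pair_def)
  define f where "f = P.construct basis (\<lambda>e. \<phi> (mL n (weight e)) e)"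
  have f: "Vector_Spaces.linear (scl V) sc f"
    unfolding f_def by (rule P.linear_construct[OF basis(1)])
  have "f v = \<phi> \<omega> v" if \<omega>: "\<omega> \<in> NC n L" and v: "v \<in> gt_space n V \<omega>" for \<omega> v
  proof -
    obtain M where M: "\<omega> = mL n M" "M \<in> NC_int n L" using \<omega> by (auto simp: NC_def)
    have v': "v \<in> eig M" using v by (simp add: M gt_space_eq)
    have sub: "vs.subspace (gt_space n V \<omega>)" by (simp add: M gt_space_eq subspace_eig)
    have add: "\<phi> \<omega> (x + y) = \<phi> \<omega> x + \<phi> \<omega> y" and scale: "\<phi> \<omega> (scl V z x) = sc z (\<phi> \<omega> x)"
      if "x \<in> gt_space n V \<omega>" "y \<in> gt_space n V \<omega>" for x y z
      using lin[OF \<omega>] that unfolding linear_between_def by blast+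
    have zero: "\<phi> \<omega> 0 = 0" using add[of 0 0] vs.subspace_0[OF sub] by simp
    have supp: "e \<in> gt_space n V \<omega>" "f e = \<phi> \<omega> e" if e: "e \<in> support v" for e
    proof -
      show "e \<in> gt_space n V \<omega>" using eig_support(1)[OF v' e] by (simp add: M gt_space_eq)
      have "e \<in> basis" using e support(2)[of v] by blast
      then show "f e = \<phi> \<omega> e"
        using P.construct_basis[OF basis(1), of e "\<lambda>e. \<phi> (mL n (weight e)) e"] eig_support(2)[OF v' e]
        by (simp add: f_def M)
    qed
    have "\<phi> \<omega> (\<Sum>e\<in>S. scl V (coeff v e) e) = (\<Sum>e\<in>S. sc (coeff v e) (\<phi> \<omega> e))
      \<and> (\<Sum>e\<in>S. scl V (coeff v e) e) \<in> gt_space n V \<omega>" if "finite S" "S \<subseteq> support v" for S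
      using that
    proof (induction S rule: finite_induct)
      case empty
      then show ?case using zero vs.subspace_0[OF sub] by simp
    next
      case (insert e S)
      then have "scl V (coeff v e) e \<in> gt_space n V \<omega>"
        using supp(1) vs.subspace_scale[OF sub] by blast
      then show ?case
        using insert supp(1)[of e] vs.subspace_add[OF sub] by (simp add: add scale)
    qed
    from this[OF support(1), of v] have "\<phi> \<omega> v = (\<Sum>e\<in>support v. sc (coeff v e) (\<phi> \<omega> e))"
      by (simp only: support(3) subset_refl simp_thms)
    then show ?thesis using linear_expand[OF f, of v] supp(2) by simp
  qed
  then show ?thesis using f by blast
qed

lemma hom_act_free:
  assumes "gl_mod n V" "gl_mod n W" and f: "f \<in> gl_hom n V W"
  shows "f (ap (act_free n V g) v) = ap (act_free n W g) (f v)"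
proof -
  interpret V: gl_mod n V by fact
  interpret W: gl_mod n W by fact
  have lin: "Vector_Spaces.linear (scl V) (scl W) f"
    and opr: "\<And>i j v. i \<in> {1..n} \<Longrightarrow> j \<in> {1..n} \<Longrightarrow> f (opr V i j v) = opr W i j (f v)"
    using f by (auto simp: gl_hom_def)
  have E: "f (ap (act_E n V i j) v) = ap (act_E n W i j) (f v)" for i j v
    using linear_map_sum[OF lin, of "\<lambda>_. 0" "{}"]
    by (cases "i \<in> {1..n} \<and> j \<in> {1..n}") (auto simp: opr V.ap_E W.ap_E, auto simp: act_E_def)
  have "f (ap (prod_list (map (\<lambda>(i, j). act_E n V i j) xs)) v)
     = ap (prod_list (map (\<lambda>(i, j). act_E n W i j) xs)) (f v)" for xs
    by (induction xs arbitrary: v) (auto simp: E)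
  then have "f (ap (act_word n V w) v) = ap (act_word n W w) (f v)" for w
    by (simp add: act_word_def)
  moreover have "f (scl V z x) = scl W z (f x)" for z x
    using lin unfolding Vector_Spaces.linear_iff by blast
  ultimately show ?thesis
    unfolding act_free_def ap_sum_left by (simp add: linear_map_sum[OF lin])
qed

lemma hom_U_act:
  assumes "gl_mod n V" "gl_mod n W" "f \<in> gl_hom n V W" "x \<in> carrier (U_gl n)"
  shows "f (U_act V x v) = U_act W x (f v)"
  using assms(4) hom_act_free[OF assms(1-3)]
  by (elim U_carrierE) (simp add: gl_mod.U_act_cls[OF assms(1)] gl_mod.U_act_cls[OF assms(2)])

lemma hom_gt_space:
  assumes "nct_mod n V L" "nct_mod n W L" and f: "f \<in> gl_hom n V W"
    and \<omega>: "\<omega> \<in> NC n L" and v: "v \<in> gt_space n V \<omega>"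
  shows "f v \<in> gt_space n W \<omega>"
proof -
  interpret V: nct_mod n V L by fact
  interpret W: nct_mod n W L by fact
  obtain M where M: "\<omega> = mL n M" using \<omega> by (auto simp: NC_def)
  have "W.a m u = act_free n W (a_gen m u)" "V.a m u = act_free n V (a_gen m u)" for m u
    by (simp_all add: W.act_free_a V.act_free_a)
  then have a: "f (ap (V.a m u) v) = ap (W.a m u) (f v)" for m u
    using hom_act_free[OF V.gl_mod_axioms W.gl_mod_axioms f] by simp
  have "f (scl V z x) = scl W z (f x)" for z x
    using f unfolding gl_hom_def Vector_Spaces.linear_iff by blast
  then show ?thesis
    using v a unfolding M V.gt_space_eq W.gt_space_eq V.eig_def W.eig_def by simp metis
qed

lemma F_NC_mor_hom:
  assumes "nct_mod n V L" "nct_mod n W L" and f: "f \<in> gl_hom n V W"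
  shows "F_NC_mor n L V f \<in> D_hom n L (F_NC n V) (F_NC n W)"
proof -
  interpret V: nct_mod n V L by fact
  interpret W: nct_mod n W L by fact
  have lin: "f (x + y) = f x + f y" "f (scl V z x) = scl W z (f x)" for x y z
    using f unfolding gl_hom_def Vector_Spaces.linear_iff by blast+
  note rep = V.D_rep_F_NC[unfolded D_rep_def V.F_NC_simps]
  show ?thesis
    unfolding D_hom_def V.F_NC_simps W.F_NC_simps
  proof (intro CollectI conjI ballI impI)
    show "F_NC_mor n L V f \<in> (\<Pi>\<^sub>E \<omega>\<in>NC n L. extensional (gt_space n V \<omega>))"
      unfolding F_NC_mor_def by simp
  next
    fix \<omega> assume \<omega>: "\<omega> \<in> NC n L"
    then have "V.vs.subspace (gt_space n V \<omega>)" using rep by blast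
    then show "linear_between (scl V) (gt_space n V \<omega>) (scl W) (gt_space n W \<omega>) (F_NC_mor n L V f \<omega>)"
      unfolding linear_between_def F_NC_mor_def
      using \<omega> hom_gt_space[OF assms \<omega>] lin V.vs.subspace_add V.vs.subspace_scale by auto
  next
    fix M e v assume M: "M \<in> NC_int n L" and e: "e \<in> edges n" and t: "target M e \<in> NC_int n L"
      and v: "v \<in> gt_space n V (mL n M)"
    have "U_act V (cls n (edge_elt M e)) v \<in> gt_space n V (mL n (target M e))"
      using rep M e t v unfolding linear_between_def by blast
    moreover have "f (U_act V (cls n (edge_elt M e)) v) = U_act W (cls n (edge_elt M e)) (f v)"
      by (rule hom_U_act[OF V.gl_mod_axioms W.gl_mod_axioms f V.edge_elt_carrier[OF e]])
    ultimately show "F_NC_mor n L V f (mL n (target M e)) (U_act V (cls n (edge_elt M e)) v)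
        = U_act W (cls n (edge_elt M e)) (F_NC_mor n L V f (mL n M) v)"
      using M t v by (simp add: F_NC_mor_def NC_def)
  qed
qed

lemma F_NC_mor_id: "F_NC_mor n L V id = D_id n L (F_NC n V)"
  by (auto simp: F_NC_mor_def D_id_def F_NC_def fun_eq_iff restrict_def)

lemma F_NC_mor_comp:
  assumes "nct_mod n V L" "nct_mod n W L" and f: "f \<in> gl_hom n V W"
  shows "F_NC_mor n L V (g \<circ> f) = D_comp n L (F_NC n V) (F_NC_mor n L W g) (F_NC_mor n L V f)"
  using hom_gt_space[OF assms]
  by (auto simp: F_NC_mor_def D_comp_def F_NC_def fun_eq_iff restrict_def compose_def)

lemma F_NC_faithful:
  assumes "nct_mod n V L" and f: "f \<in> gl_hom n V W" and g: "g \<in> gl_hom n V W"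
    and eq: "F_NC_mor n L V f = F_NC_mor n L V g"
  shows "f = g"
proof -
  interpret V: nct_mod n V L by fact
  show ?thesis
  proof (rule V.linear_eqI)
    show "Vector_Spaces.linear (scl V) (scl W) f" "Vector_Spaces.linear (scl V) (scl W) g"
      using f g by (auto simp: gl_hom_def)
    fix M v assume "M \<in> NC_int n L" and "v \<in> gt_space n V (mL n M)"
    then have "F_NC_mor n L V f (mL n M) v = f v" "F_NC_mor n L V g (mL n M) v = g v"
      by (auto simp: F_NC_mor_def NC_def)
    then show "f v = g v" using eq by simp
  qed
qed

section \<open>Irreducible modules and isomorphisms\<close>

text \<open>
  The matrix units \<open>E 1 1\<close>, \<open>E m (m + 1)\<close>, \<open>E (m + 1) m\<close> generate \<open>gl\<^sub>n\<close>.  This is stated for an arbitrary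
  predicate on the indices so that it applies both to invariant subspaces of one module and to maps between two.
\<close>
lemma gl_generators_induct:
  assumes base: "Q 1 1" "\<And>m. 1 \<le> m \<Longrightarrow> m < n \<Longrightarrow> Q m (Suc m) \<and> Q (Suc m) m"
    and off: "\<And>i j q. \<lbrakk>i \<in> {1..n}; j \<in> {1..n}; q \<in> {1..n}; i \<noteq> q; Q i j; Q j q\<rbrakk> \<Longrightarrow> Q i q"
    and diag: "\<And>i j. \<lbrakk>i \<in> {1..n}; j \<in> {1..n}; i \<noteq> j; Q i i; Q i j; Q j i\<rbrakk> \<Longrightarrow> Q j j"
    and "i \<in> {1..n}" "j \<in> {1..n}"
  shows "Q i j"
proof -
  have far: "Q i (i + Suc d) \<and> Q (i + Suc d) i" if "1 \<le> i" "i + Suc d \<le> n" for i d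
    using that(2)
  proof (induction d)
    case 0
    then show ?case using base(2)[of i] that(1) by simp
  next
    case (Suc d)
    let ?j = "i + Suc d"
    have range: "i \<in> {1..n}" "?j \<in> {1..n}" "Suc ?j \<in> {1..n}" "i \<noteq> Suc ?j" "Suc ?j \<noteq> i"
      using Suc.prems that(1) by auto
    have "Q i ?j \<and> Q ?j i" by (rule Suc.IH) (use Suc.prems in simp)
    moreover have "Q ?j (Suc ?j) \<and> Q (Suc ?j) ?j"
      by (rule base(2)) (use Suc.prems that(1) in auto)
    ultimately have "Q i (Suc ?j) \<and> Q (Suc ?j) i"
      using off[OF range(1-4)] off[OF range(3,2,1,5)] by blast
    then show ?case by (simp only: add_Suc_right)
  qed
  have dg: "Q (Suc d) (Suc d)" if "Suc d \<le> n" for d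
    using that
  proof (induction d)
    case 0
    show ?case using base(1) unfolding One_nat_def .
  next
    case (Suc d)
    have "Q (Suc d) (Suc (Suc d)) \<and> Q (Suc (Suc d)) (Suc d)"
      by (rule base(2)) (use Suc.prems in auto)
    moreover have "Q (Suc d) (Suc d)" by (rule Suc.IH) (use Suc.prems in simp)
    moreover have "Suc d \<in> {1..n}" "Suc (Suc d) \<in> {1..n}" "Suc d \<noteq> Suc (Suc d)"
      using Suc.prems by auto
    ultimately show ?case using diag by blast
  qed
  consider "i = j" | "i < j" | "j < i" by linarith
  then show ?thesis
  proof cases
    case 1
    moreover have "Suc (i - 1) = i" using \<open>i \<in> {1..n}\<close> by simp
    moreover have "i \<le> n" using \<open>i \<in> {1..n}\<close> by simp
    ultimately show ?thesis using dg[of "i - 1"] by metis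
  next
    case 2
    then have "i + Suc (j - Suc i) = j" by simp
    moreover have "1 \<le> i" "j \<le> n" using assms(5,6) by simp_all
    ultimately show ?thesis using far[of i "j - Suc i"] by metis
  next
    case 3
    then have "j + Suc (i - Suc j) = i" by simp
    moreover have "1 \<le> j" "i \<le> n" using assms(5,6) by simp_all
    ultimately show ?thesis using far[of j "i - Suc j"] by metis
  qed
qed

lemma (in gl_mod) ap_E_scale: "ap (E i j) (scl V z v) = scl V z (ap (E i j) v)"
  using ap_act_scale[of "gen i j"] by (simp add: act_free_gen)

lemma (in gl_mod) E_commutators:
  assumes "i \<in> {1..n}" "j \<in> {1..n}" "q \<in> {1..n}"
  shows "i \<noteq> q \<Longrightarrow> E i q = comm (E i j) (E j q)"
    and "E j j = E i i - comm (E i j) (E j i)"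
  by (simp_all only: comm_E[OF assms(1,2,2,3)] comm_E[OF assms(1,2,2,1)] if_True if_False simp_thms diff_0_right)
     simp

lemma (in gl_mod) ap_E_commutators:
  assumes "i \<in> {1..n}" "j \<in> {1..n}" "q \<in> {1..n}"
  shows "i \<noteq> q \<Longrightarrow> ap (E i q) v = ap (E i j) (ap (E j q) v) - ap (E j q) (ap (E i j) v)"
    and "ap (E j j) v = ap (E i i) v - (ap (E i j) (ap (E j i) v) - ap (E j i) (ap (E i j) v))"
proof -
  show "ap (E j j) v = ap (E i i) v - (ap (E i j) (ap (E j i) v) - ap (E j i) (ap (E i j) v))"
    using arg_cong[OF E_commutators(2)[OF assms], of "\<lambda>X. ap X v"] by (simp only: comm_def ap_simps)
  assume "i \<noteq> q"
  from arg_cong[OF E_commutators(1)[OF assms this], of "\<lambda>X. ap X v"]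
  show "ap (E i q) v = ap (E i j) (ap (E j q) v) - ap (E j q) (ap (E i j) v)"
    by (simp only: comm_def ap_simps)
qed

lemma interpolation_weights:
  assumes "inj_on (M m) {1..m}" "1 \<le> m"
  shows "\<exists>w. \<forall>p\<le>m - 1. (\<Sum>i=1..m. w i * (- M m i) ^ p) = (if p = m - 1 then 1 else (0::complex))"
proof -
  have inj: "inj_on (\<lambda>i. - M m i) {1..m}"
  proof (rule inj_onI)
    fix i j assume "i \<in> {1..m}" "j \<in> {1..m}" "- M m i = - M m j"
    then show "i = j" using inj_onD[OF assms(1)] by (simp only: neg_equal_iff_equal)
  qed
  have ne: "{1..m} \<noteq> {}" using assms(2) by simp
  obtain w where w: "\<forall>p<card {1..m}. (\<Sum>i=1..m. w i * (- M m i) ^ p) = (if p = card {1..m} - 1 then 1 else 0)"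
    using top_coeff_functional[OF finite_atLeastAtMost ne inj] by (elim exE)
  show ?thesis
  proof (intro exI allI impI)
    fix p assume "p \<le> m - 1"
    then have "p < m" using assms(2) by linarith
    then show "(\<Sum>i=1..m. w i * (- M m i) ^ p) = (if p = m - 1 then 1 else 0)"
      using w[rule_format, of p] unfolding card_atLeastAtMost diff_Suc_1 by blast
  qed
qed

text \<open>The weights \<open>w\<close> depend only on the tableau, so two modules admit the same formula.\<close>
lemma (in nct_mod) E_from_edges:
  assumes "1 \<le> m" "Suc m \<le> n"
    and "\<forall>p\<le>m - 1. (\<Sum>i=1..m. w i * (- M m i) ^ p) = (if p = m - 1 then 1 else 0)"
  shows "E m (Suc m) = (\<Sum>i=1..m. k (w i) * b m (- M m i))"
    and "E (Suc m) m = (\<Sum>i=1..m. k (w i) * c m (- M m i))"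
proof -
  have w: "(\<Sum>i=1..m. w i * (- M m i) ^ p) = (if p = m - 1 then 1 else 0)" if "p \<le> m - 1" for p
    using assms(3) that by blast
  show "E m (Suc m) = (\<Sum>i=1..m. k (w i) * b m (- M m i))"
    by (rule polytop_interpolation[OF finite_atLeastAtMost w polytop_b[OF assms(1,2)]])
  show "E (Suc m) m = (\<Sum>i=1..m. k (w i) * c m (- M m i))"
    by (rule polytop_interpolation[OF finite_atLeastAtMost w polytop_c[OF assms(1,2)]])
qed

lemma (in nct_mod) E_1_1:
  assumes "1 \<le> n" "v \<in> eig M"
  shows "ap (E 1 1) v = scl V (alpha 1 0 M) v"
proof -
  have "a 1 0 = adj 1 1 1 0 * T 1 1 1 0"
    using adj_t[of 1 1 1 0] assms(1) by simp
  also have "adj 1 1 1 0 = 1"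
    using adj_corner[of 1 0] assms(1) by simp
  also have "T 1 1 1 0 = E 1 1" by (simp add: T_def t_def)
  finally show ?thesis using eigD[OF assms(2,1), of 0] by simp
qed

text \<open>
  The span \<open>S\<close> of a subrepresentation \<open>W\<close> is stable under the generators of \<open>gl\<^sub>n\<close>, so it is \<open>0\<close> or everything.
  In the second case the projection to the weight space of \<open>\<omega>\<close> maps \<open>S\<close> into \<open>W \<omega>\<close>, which is therefore the
  full weight space.
\<close>
lemma F_NC_irreducible:
  assumes "nct_mod n V L" and irr: "gl_irreducible n V" and n: "2 \<le> n"
  shows "D_irreducible n L (F_NC n V)"
proof -
  interpret nct_mod n V L by fact
  have nonzero: "\<exists>\<omega>\<in>NC n L. gt_space n V \<omega> \<noteq> {0}"
  proof -
    obtain v :: 'a where "v \<noteq> 0" using irr unfolding gl_irreducible_def by auto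
    then have "support v \<noteq> {}" using support(3)[of v] by auto
    then obtain e where "e \<in> basis" using support(2)[of v] by blast
    then show ?thesis using basis_gt_space[of e] basis_nonzero[of e] by blast
  qed
  have "(\<forall>\<omega>\<in>NC n L. W \<omega> = {0}) \<or> (\<forall>\<omega>\<in>NC n L. W \<omega> = gt_space n V \<omega>)"
    if W: "\<forall>\<omega>\<in>NC n L. vs.subspace (W \<omega>) \<and> W \<omega> \<subseteq> gt_space n V \<omega>"
    and stable: "\<forall>M\<in>NC_int n L. \<forall>e\<in>edges n. target M e \<in> NC_int n L \<longrightarrow>
            U_act V (cls n (edge_elt M e)) ` W (mL n M) \<subseteq> W (mL n (target M e))" for W
  proof -
    define S where "S = vs.span (\<Union>\<omega>\<in>NC n L. W \<omega>)"
    have S: "vs.subspace S" unfolding S_def by (rule vs.subspace_span)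
    have W_S: "v \<in> S" if "v \<in> W (mL n M)" "M \<in> NC_int n L" for M v
      unfolding S_def by (rule vs.span_base) (use that in \<open>auto simp: NC_def\<close>)
    have edge: "U_act V (cls n (edge_elt M e)) v \<in> S"
      if "e \<in> edges n" "M \<in> NC_int n L" "v \<in> W (mL n M)" for e M v
    proof (cases "target M e \<in> NC_int n L")
      case True
      then have "U_act V (cls n (edge_elt M e)) v \<in> W (mL n (target M e))"
        using stable that by blast
      then show ?thesis using W_S True by blast
    next
      case False
      have "v \<in> eig M" using W that gt_space_eq unfolding NC_def by blast
      then have "U_act V (cls n (edge_elt M e)) v = 0"
        using edge_acts[OF that(1) lies_at_eig[OF that(2)]] False by (simp add: lies_at_def)
      then show ?thesis using vs.subspace_0[OF S] by simp
    qed
    have extend: "ap (E i j) v \<in> S"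
      if ij: "i \<in> {1..n}" "j \<in> {1..n}" and gen: "\<And>M v. M \<in> NC_int n L \<Longrightarrow> v \<in> W (mL n M) \<Longrightarrow> ap (E i j) v \<in> S"
        and v: "v \<in> S" for i j v
      using v unfolding S_def
    proof (induction rule: vs.span_induct)
      case step
      then show ?case using gen unfolding NC_def S_def by blast
    next
      case base
      show ?case
        using vs.subspace_0[OF S] vs.subspace_add[OF S] vs.subspace_scale[OF S]
        unfolding S_def[symmetric]
        by (intro vs.subspaceI) (auto simp: ap_add ap_E_scale)
    qed
    have inv: "\<forall>v\<in>S. ap (E i j) v \<in> S" if ij: "i \<in> {1..n}" "j \<in> {1..n}" for i j
    proof (rule gl_generators_induct[where Q = "\<lambda>i j. \<forall>v\<in>S. ap (E i j) v \<in> S", OF _ _ _ _ ij])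
      show "\<forall>v\<in>S. ap (E 1 1) v \<in> S"
      proof (rule ballI, rule extend)
        fix M v assume M: "M \<in> NC_int n L" and v: "v \<in> W (mL n M)"
        have "1 \<le> n" using n by simp
        moreover have "v \<in> eig M" using W M v gt_space_eq unfolding NC_def by blast
        ultimately have "ap (E 1 1) v = scl V (alpha 1 0 M) v" by (rule E_1_1)
        then show "ap (E 1 1) v \<in> S"
          using vs.subspace_scale[OF S W_S[OF v M]] by simp
      qed (use n in auto)
    next
      fix m assume m: "1 \<le> m" "m < n"
      have "ap (E m (Suc m)) v \<in> S \<and> ap (E (Suc m) m) v \<in> S"
        if M: "M \<in> NC_int n L" and v: "v \<in> W (mL n M)" for M v
      proof -
        have "m \<in> {1..n - 1}" using m by auto
        then obtain w where w: "\<forall>p\<le>m - 1. (\<Sum>i=1..m. w i * (- M m i) ^ p) = (if p = m - 1 then 1 else 0)"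
          using interpolation_weights[of M m] NC_int_inj[OF M] m(1) by blast
        have m': "Suc m \<le> n" using m by simp
        have bc: "ap (b m (- M m i)) v \<in> S" "ap (c m (- M m i)) v \<in> S" if i: "i \<in> {1..m}" for i
          using edge[OF edges_intros(2)[OF \<open>m \<in> {1..n - 1}\<close> i] M v]
            edge[OF edges_intros(3)[OF \<open>m \<in> {1..n - 1}\<close> i] M v]
          by (simp_all only: edge_elt.simps U_act_b[OF m(1) m'] U_act_c[OF m(1) m'])
        show ?thesis
          unfolding E_from_edges[where M = M and w = w, OF m(1) m' w] ap_sum_left ap_simps ap_k
          by (intro conjI vs.subspace_sum[OF S] vs.subspace_scale[OF S] bc)
      qed
      moreover have "m \<in> {1..n}" "Suc m \<in> {1..n}" using m by auto
      ultimately show "(\<forall>v\<in>S. ap (E m (Suc m)) v \<in> S) \<and> (\<forall>v\<in>S. ap (E (Suc m) m) v \<in> S)"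
        using extend by blast
    next
      fix i j q assume ijq: "i \<in> {1..n}" "j \<in> {1..n}" "q \<in> {1..n}" "i \<noteq> q"
        and S': "\<forall>v\<in>S. ap (E i j) v \<in> S" "\<forall>v\<in>S. ap (E j q) v \<in> S"
      show "\<forall>v\<in>S. ap (E i q) v \<in> S"
        unfolding ap_E_commutators(1)[OF ijq] by (intro ballI vs.subspace_diff[OF S]; use S' in blast)
    next
      fix i j assume ij: "i \<in> {1..n}" "j \<in> {1..n}"
        and S': "\<forall>v\<in>S. ap (E i i) v \<in> S" "\<forall>v\<in>S. ap (E i j) v \<in> S" "\<forall>v\<in>S. ap (E j i) v \<in> S"
      show "\<forall>v\<in>S. ap (E j j) v \<in> S"
        by (subst ap_E_commutators(2)[OF ij ij(1)]) (intro ballI vs.subspace_diff[OF S]; use S' in blast)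
    qed
    have "opr V i j v \<in> S" if "i \<in> {1..n}" "j \<in> {1..n}" "v \<in> S" for i j v
      using inv[OF that(1,2)] that(3) ap_E[OF that(1,2)] by simp
    then have "S = {0} \<or> S = UNIV"
      using irr S unfolding gl_irreducible_def by blast
    then show ?thesis
    proof
      assume "S = {0}"
      have "W \<omega> = {0}" if \<omega>: "\<omega> \<in> NC n L" for \<omega>
        using W_S W vs.subspace_0 \<omega> \<open>S = {0}\<close> unfolding NC_def by blast
      then show ?thesis by blast
    next
      assume univ: "S = UNIV"
      have "v \<in> W \<omega>" if \<omega>: "\<omega> \<in> NC n L" and v: "v \<in> gt_space n V \<omega>" for \<omega> v
      proof -
        have "linear_between (scl V) (gt_space n V \<omega>') (scl V) UNIV (\<lambda>v. if \<omega>' = \<omega> then v else 0)" for \<omega>'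
          by (auto simp: linear_between_def)
        from linear_assemble[where \<phi> = "\<lambda>\<omega>' v. if \<omega>' = \<omega> then v else 0", OF vector_space this]
        obtain f where f: "Vector_Spaces.linear (scl V) (scl V) f"
          and f': "\<And>\<omega>' v. \<omega>' \<in> NC n L \<Longrightarrow> v \<in> gt_space n V \<omega>' \<Longrightarrow> f v = (if \<omega>' = \<omega> then v else 0)"
          by blast
        have W0: "vs.subspace (W \<omega>)" using W \<omega> by blast
        have "f x \<in> W \<omega>" if "x \<in> S" for x
          using that unfolding S_def
        proof (induction rule: vs.span_induct)
          case (step x)
          then obtain \<omega>' where \<omega>': "\<omega>' \<in> NC n L" "x \<in> W \<omega>'" by blast
          then have "f x = (if \<omega>' = \<omega> then x else 0)" using f' W by blast
          then show ?case using \<omega>' vs.subspace_0[OF W0] by (cases "\<omega>' = \<omega>") auto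
        next
          case base
          have "f 0 = 0" using linear_map_sum[OF f, of "\<lambda>_. 0" "{}"] by simp
          then show ?case
            using f vs.subspace_0[OF W0] vs.subspace_add[OF W0] vs.subspace_scale[OF W0]
            unfolding Vector_Spaces.linear_iff by (intro vs.subspaceI) auto
        qed
        then have "f v \<in> W \<omega>" using univ by blast
        then show ?thesis using f'[OF \<omega> v] by simp
      qed
      then show ?thesis using W by blast
    qed
  qed
  then show ?thesis
    unfolding D_irreducible_def F_NC_simps using D_rep_F_NC nonzero by blast
qed

text \<open>
  The maps \<open>\<phi>\<close> of the weight spaces and their inverses \<open>\<psi>\<close> are assembled to mutually inverse linear maps \<open>f\<close> and \<open>g\<close>.
  The map \<open>f\<close> commutes with all edges, also with those that leave \<open>NC\<close> and act as zero on both sides, hence with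
  the generators of \<open>gl\<^sub>n\<close>.
\<close>
lemma F_NC_iso:
  assumes "nct_mod n V L" "nct_mod n W L" and iso: "D_iso n L (F_NC n V) (F_NC n W)" and n: "2 \<le> n"
  shows "gl_iso n V W"
proof -
  interpret V: nct_mod n V L by fact
  interpret W: nct_mod n W L by fact
  obtain \<phi> where \<phi>: "\<phi> \<in> D_hom n L (F_NC n V) (F_NC n W)"
    and bij: "\<And>\<omega>. \<omega> \<in> NC n L \<Longrightarrow> bij_betw (\<phi> \<omega>) (gt_space n V \<omega>) (gt_space n W \<omega>)"
    using iso unfolding D_iso_def V.F_NC_simps W.F_NC_simps by blast
  have lin: "linear_between (scl V) (gt_space n V \<omega>) (scl W) (gt_space n W \<omega>) (\<phi> \<omega>)"
    if "\<omega> \<in> NC n L" for \<omega>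
    using \<phi> that unfolding D_hom_def V.F_NC_simps W.F_NC_simps by blast
  have edge: "\<phi> (mL n (target M e)) (U_act V (cls n (edge_elt M e)) v) = U_act W (cls n (edge_elt M e)) (\<phi> (mL n M) v)"
    if "M \<in> NC_int n L" "e \<in> edges n" "target M e \<in> NC_int n L" "v \<in> gt_space n V (mL n M)" for M e v
    using \<phi> that unfolding D_hom_def V.F_NC_simps W.F_NC_simps by blast
  define \<psi> where "\<psi> \<omega> = inv_into (gt_space n V \<omega>) (\<phi> \<omega>)" for \<omega>
  have \<psi>: "\<psi> \<omega> y \<in> gt_space n V \<omega>" "\<phi> \<omega> (\<psi> \<omega> y) = y" if "\<omega> \<in> NC n L" "y \<in> gt_space n W \<omega>" for \<omega> y
    using bij[OF that(1)] that(2) unfolding \<psi>_def bij_betw_def by (auto intro: inv_into_into f_inv_into_f)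
  have \<psi>_\<phi>: "\<psi> \<omega> (\<phi> \<omega> x) = x" if "\<omega> \<in> NC n L" "x \<in> gt_space n V \<omega>" for \<omega> x
    using bij[OF that(1)] that(2) unfolding \<psi>_def bij_betw_def by simp
  have lin': "linear_between (scl W) (gt_space n W \<omega>) (scl V) (gt_space n V \<omega>) (\<psi> \<omega>)"
    if \<omega>: "\<omega> \<in> NC n L" for \<omega>
  proof -
    have sub: "V.vs.subspace (gt_space n V \<omega>)"
      using V.D_rep_F_NC \<omega> unfolding D_rep_def V.F_NC_simps by blast
    have "\<psi> \<omega> (x + y) = \<psi> \<omega> x + \<psi> \<omega> y" if "x \<in> gt_space n W \<omega>" "y \<in> gt_space n W \<omega>" for x y
    proof -
      have "\<phi> \<omega> (\<psi> \<omega> x + \<psi> \<omega> y) = x + y"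
        using lin[OF \<omega>] \<psi>[OF \<omega>] that unfolding linear_between_def by simp
      then show ?thesis
        using \<psi>_\<phi>[OF \<omega>, of "\<psi> \<omega> x + \<psi> \<omega> y"] \<psi>(1)[OF \<omega>] that V.vs.subspace_add[OF sub] by simp
    qed
    moreover have "\<psi> \<omega> (scl W z x) = scl V z (\<psi> \<omega> x)" if "x \<in> gt_space n W \<omega>" for z x
    proof -
      have "\<phi> \<omega> (scl V z (\<psi> \<omega> x)) = scl W z x"
        using lin[OF \<omega>] \<psi>[OF \<omega>] that unfolding linear_between_def by simp
      then show ?thesis
        using \<psi>_\<phi>[OF \<omega>, of "scl V z (\<psi> \<omega> x)"] \<psi>(1)[OF \<omega>] that V.vs.subspace_scale[OF sub] by simp
    qed
    ultimately show ?thesis using \<psi>(1)[OF \<omega>] unfolding linear_between_def by auto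
  qed
  obtain f where f: "Vector_Spaces.linear (scl V) (scl W) f"
    and f': "\<And>\<omega> v. \<omega> \<in> NC n L \<Longrightarrow> v \<in> gt_space n V \<omega> \<Longrightarrow> f v = \<phi> \<omega> v"
    using V.linear_assemble[OF W.vector_space lin] by blast
  obtain g where g: "Vector_Spaces.linear (scl W) (scl V) g"
    and g': "\<And>\<omega> v. \<omega> \<in> NC n L \<Longrightarrow> v \<in> gt_space n W \<omega> \<Longrightarrow> g v = \<psi> \<omega> v"
    using W.linear_assemble[OF V.vector_space lin'] by blast
  have \<phi>_mem: "\<phi> \<omega> v \<in> gt_space n W \<omega>" if "\<omega> \<in> NC n L" "v \<in> gt_space n V \<omega>" for \<omega> v
    using bij that unfolding bij_betw_def by blast
  have mL_NC: "mL n M \<in> NC n L" if "M \<in> NC_int n L" for M using that by (simp add: NC_def)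
  have "g \<circ> f = id"
  proof (rule V.linear_eqI)
    show "Vector_Spaces.linear (scl V) (scl V) (g \<circ> f)"
      using f g unfolding Vector_Spaces.linear_iff by simp
    show "Vector_Spaces.linear (scl V) (scl V) id"
      using V.vector_space unfolding Vector_Spaces.linear_iff by simp
    fix M v assume M: "M \<in> NC_int n L" and v: "v \<in> gt_space n V (mL n M)"
    show "(g \<circ> f) v = id v"
      using f'[OF mL_NC[OF M] v] g'[OF mL_NC[OF M] \<phi>_mem[OF mL_NC[OF M] v]] \<psi>_\<phi>[OF mL_NC[OF M] v]
      by simp
  qed
  moreover have "f \<circ> g = id"
  proof (rule W.linear_eqI)
    show "Vector_Spaces.linear (scl W) (scl W) (f \<circ> g)"
      using f g unfolding Vector_Spaces.linear_iff by simp
    show "Vector_Spaces.linear (scl W) (scl W) id"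
      using W.vector_space unfolding Vector_Spaces.linear_iff by simp
    fix M v assume M: "M \<in> NC_int n L" and v: "v \<in> gt_space n W (mL n M)"
    show "(f \<circ> g) v = id v"
      using g'[OF mL_NC[OF M] v] f'[OF mL_NC[OF M] \<psi>(1)[OF mL_NC[OF M] v]] \<psi>(2)[OF mL_NC[OF M] v]
      by simp
  qed
  ultimately have "bij f" by (rule o_bij)
  have f_add: "f (x + y) = f x + f y" "f (x - y) = f x - f y" "f (scl V z x) = scl W z (f x)" "f 0 = 0" for x y z
  proof -
    show add: "f (x + y) = f x + f y" for x y using f unfolding Vector_Spaces.linear_iff by blast
    show "f (x - y) = f x - f y" using add[of "x - y" y] by (simp add: eq_diff_eq)
    show "f (scl V z x) = scl W z (f x)" using f unfolding Vector_Spaces.linear_iff by blast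
    show "f 0 = 0" using add[of 0 0] by simp
  qed
  have f_edge: "f (U_act V (cls n (edge_elt M e)) v) = U_act W (cls n (edge_elt M e)) (f v)"
    if M: "M \<in> NC_int n L" and e: "e \<in> edges n" and v: "v \<in> gt_space n V (mL n M)" for M e v
  proof -
    have fv: "f v = \<phi> (mL n M) v" "f v \<in> gt_space n W (mL n M)"
      using f'[OF mL_NC[OF M] v] \<phi>_mem[OF mL_NC[OF M] v] by auto
    have 1: "V.lies_at (target M e) (U_act V (cls n (edge_elt M e)) v)"
      using V.edge_acts[OF e V.lies_at_eig[OF M]] v by (simp add: V.gt_space_eq)
    have 2: "W.lies_at (target M e) (U_act W (cls n (edge_elt M e)) (f v))"
      using W.edge_acts[OF e W.lies_at_eig[OF M]] fv(2) by (simp add: W.gt_space_eq)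
    show ?thesis
    proof (cases "target M e \<in> NC_int n L")
      case True
      then have "U_act V (cls n (edge_elt M e)) v \<in> gt_space n V (mL n (target M e))"
        using 1 by (simp add: V.lies_at_def V.gt_space_eq)
      then show ?thesis
        using f'[OF mL_NC[OF True]] edge[OF M e True v] fv(1) by simp
    next
      case False
      then show ?thesis using 1 2 f_add(4) by (simp add: V.lies_at_def W.lies_at_def)
    qed
  qed
  have linE: "Vector_Spaces.linear (scl V) (scl W) (\<lambda>v. f (ap (act_E n V i j) v))"
    "Vector_Spaces.linear (scl V) (scl W) (\<lambda>v. ap (act_E n W i j) (f v))"
    if ij: "i \<in> {1..n}" "j \<in> {1..n}" for i j
    using V.vector_space W.vector_space
    by (simp_all add: Vector_Spaces.linear_iff f_add V.ap_E[OF ij] W.ap_E[OF ij]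
        V.opr_add[OF ij] W.opr_add[OF ij] V.opr_scale[OF ij] W.opr_scale[OF ij])
  have one_n: "1 \<le> n" using n by simp
  have weightI: "\<forall>v. f (ap (act_E n V i j) v) = ap (act_E n W i j) (f v)"
    if ij: "i \<in> {1..n}" "j \<in> {1..n}"
      and "\<And>M v. M \<in> NC_int n L \<Longrightarrow> v \<in> gt_space n V (mL n M) \<Longrightarrow>
        f (ap (act_E n V i j) v) = ap (act_E n W i j) (f v)" for i j
    using V.linear_eqI[OF linE[OF ij] that(3)] by (simp add: fun_eq_iff)
  have comm_f: "\<forall>v. f (ap (act_E n V i j) v) = ap (act_E n W i j) (f v)"
    if ij: "i \<in> {1..n}" "j \<in> {1..n}" for i j
  proof (rule gl_generators_induct[where Q = "\<lambda>i j. \<forall>v. f (ap (act_E n V i j) v) = ap (act_E n W i j) (f v)", OF _ _ _ _ ij])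
    show "\<forall>v. f (ap (act_E n V 1 1) v) = ap (act_E n W 1 1) (f v)"
    proof (rule weightI)
      fix M v assume M: "M \<in> NC_int n L" and v: "v \<in> gt_space n V (mL n M)"
      have "f v \<in> gt_space n W (mL n M)"
        using f'[OF mL_NC[OF M] v] \<phi>_mem[OF mL_NC[OF M] v] by simp
      then show "f (ap (act_E n V 1 1) v) = ap (act_E n W 1 1) (f v)"
        using v V.E_1_1[of v M] W.E_1_1[of "f v" M] one_n
        by (simp only: V.gt_space_eq W.gt_space_eq f_add)
    qed (use n in auto)
  next
    fix m assume m: "1 \<le> m" "m < n"
    have *: "f (ap (act_E n V m (Suc m)) v) = ap (act_E n W m (Suc m)) (f v) \<and>
        f (ap (act_E n V (Suc m) m) v) = ap (act_E n W (Suc m) m) (f v)"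
      if M: "M \<in> NC_int n L" and v: "v \<in> gt_space n V (mL n M)" for M v
    proof -
      have m': "m \<in> {1..n - 1}" "Suc m \<le> n" using m by auto
      then obtain w where w: "\<forall>p\<le>m - 1. (\<Sum>i=1..m. w i * (- M m i) ^ p) = (if p = m - 1 then 1 else 0)"
        using interpolation_weights[of M m] NC_int_inj[OF M] m(1) by blast
      have "f (ap (V.b m (- M m i)) v) = ap (W.b m (- M m i)) (f v)"
        "f (ap (V.c m (- M m i)) v) = ap (W.c m (- M m i)) (f v)" if "i \<in> {1..m}" for i
        using f_edge[OF M V.edges_intros(2)[OF m'(1) that] v] f_edge[OF M V.edges_intros(3)[OF m'(1) that] v]
        by (simp_all only: edge_elt.simps V.U_act_b[OF m(1) m'(2)] V.U_act_c[OF m(1) m'(2)]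
            W.U_act_b[OF m(1) m'(2)] W.U_act_c[OF m(1) m'(2)])
      then show ?thesis
        unfolding V.E_from_edges[where M = M and w = w, OF m(1) m'(2) w] W.E_from_edges[where M = M and w = w, OF m(1) m'(2) w] ap_sum_left
          linear_map_sum[OF f] ap_simps V.ap_k W.ap_k f_add
        by (intro conjI sum.cong refl) simp_all
    qed
    show "(\<forall>v. f (ap (act_E n V m (Suc m)) v) = ap (act_E n W m (Suc m)) (f v)) \<and>
        (\<forall>v. f (ap (act_E n V (Suc m) m) v) = ap (act_E n W (Suc m) m) (f v))"
      using weightI[of m "Suc m"] weightI[of "Suc m" m] * m by auto
  next
    fix i j q assume ijq: "i \<in> {1..n}" "j \<in> {1..n}" "q \<in> {1..n}" "i \<noteq> q"
      and f: "\<forall>v. f (ap (act_E n V i j) v) = ap (act_E n W i j) (f v)"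
      "\<forall>v. f (ap (act_E n V j q) v) = ap (act_E n W j q) (f v)"
    show "\<forall>v. f (ap (act_E n V i q) v) = ap (act_E n W i q) (f v)"
      unfolding V.ap_E_commutators(1)[OF ijq] W.ap_E_commutators(1)[OF ijq] by (simp add: f f_add(2))
  next
    fix i j assume ij: "i \<in> {1..n}" "j \<in> {1..n}"
      and f: "\<forall>v. f (ap (act_E n V i i) v) = ap (act_E n W i i) (f v)"
      "\<forall>v. f (ap (act_E n V i j) v) = ap (act_E n W i j) (f v)"
      "\<forall>v. f (ap (act_E n V j i) v) = ap (act_E n W j i) (f v)"
    show "\<forall>v. f (ap (act_E n V j j) v) = ap (act_E n W j j) (f v)"
      by (subst V.ap_E_commutators(2)[OF ij ij(1)], subst W.ap_E_commutators(2)[OF ij ij(1)])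
         (simp add: f f_add(2))
  qed
  have "f \<in> gl_hom n V W"
    unfolding gl_hom_def
  proof (intro CollectI conjI f ballI allI)
    fix i j v assume "i \<in> {1..n}" "j \<in> {1..n}"
    then show "f (opr V i j v) = opr W i j (f v)"
      using spec[OF comm_f[of i j], of v] by (simp only: V.ap_E W.ap_E)
  qed
  then show ?thesis using \<open>bij f\<close> unfolding gl_iso_def by blast
qed

lemma NCT_nct_mod:
  assumes "V \<in> NCT n L" "maximalideal (mL n L) (Gamma n)"
  shows "nct_mod n V L"
proof
  show "gl_module n V" using assms(1) by (simp add: NCT_def gt_module_def)
  show "mL n L \<subseteq> carrier (Gamma n)"
    using ideal.Icarr[OF maximalideal.axioms(1)[OF assms(2)]] by blast
qed fact

theorem proposition3p6:
  fixes n :: nat and L :: tableau and \<mm> :: "free_gl set set"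
  assumes "n \<ge> 2"
    and "maximalideal \<mm> (Gamma n)"
    and "L \<in> tableaux n" and "\<mm> = mL n L" and "\<not> critical n L"
  shows
   "\<comment> \<open>\<open>F_NC\<close> is a functor\<close>
    (\<forall>V :: 'v::ab_group_add gl_mod. V \<in> NCT n L \<longrightarrow> D_rep n L (F_NC n V)) \<and>
    (\<forall>(V :: 'v gl_mod) (W :: 'w::ab_group_add gl_mod). \<forall>f\<in>gl_hom n V W.
       V \<in> NCT n L \<and> W \<in> NCT n L \<longrightarrow> F_NC_mor n L V f \<in> D_hom n L (F_NC n V) (F_NC n W)) \<and>
    (\<forall>V :: 'v gl_mod. V \<in> NCT n L \<longrightarrow> F_NC_mor n L V id = D_id n L (F_NC n V)) \<and>
    (\<forall>(V :: 'v gl_mod) (W :: 'w gl_mod) (X :: 'x::ab_group_add gl_mod).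
       \<forall>f\<in>gl_hom n V W. \<forall>g\<in>gl_hom n W X.
       V \<in> NCT n L \<and> W \<in> NCT n L \<and> X \<in> NCT n L \<longrightarrow>
         F_NC_mor n L V (g \<circ> f) = D_comp n L (F_NC n V) (F_NC_mor n L W g) (F_NC_mor n L V f)) \<and>
    \<comment> \<open>it is faithful\<close>
    (\<forall>(V :: 'v gl_mod) (W :: 'w gl_mod). \<forall>f\<in>gl_hom n V W. \<forall>g\<in>gl_hom n V W.
       V \<in> NCT n L \<and> W \<in> NCT n L \<and> F_NC_mor n L V f = F_NC_mor n L V g \<longrightarrow> f = g) \<and>
    \<comment> \<open>it maps irreducible modules to irreducible modules\<close>
    (\<forall>V :: 'v gl_mod. V \<in> NCT n L \<and> gl_irreducible n V \<longrightarrow> D_irreducible n L (F_NC n V)) \<and>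
    \<comment> \<open>it maps non-isomorphic modules to non-isomorphic representations\<close>
    (\<forall>(V :: 'v gl_mod) (W :: 'w gl_mod). V \<in> NCT n L \<and> W \<in> NCT n L \<and> \<not> gl_iso n V W \<longrightarrow>
       \<not> D_iso n L (F_NC n V) (F_NC n W))"
proof -
  have max: "maximalideal (mL n L) (Gamma n)" using assms by simp
  note mod = NCT_nct_mod[OF _ max]
  show ?thesis
    using nct_mod.D_rep_F_NC[OF mod] F_NC_mor_hom[OF mod mod] F_NC_mor_id
      F_NC_mor_comp[OF mod mod] F_NC_faithful[OF mod] F_NC_irreducible[OF mod _ assms(1)]
      F_NC_iso[OF mod mod _ assms(1)]
    by (intro conjI allI ballI impI) blast+
qed

end
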